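(* Let $\mathcal{H},A,Q,\overline{s}$ be as in the context, let $\sigma>0$, and let $B\in\mathcal{L}(\mathcal{H})$ satisfy $Be_p=-b_pe_p$ for all $p\ge1$, with real $b_p\in(-\lambda_1,\lambda_1)$ and $L:=\sup_p|b_p|<\lambda_1$. Consider the linear SPDE $du(t)=Au(t)\,dt+Bu(t)\,dt+\sigma\,dW^Q(t)$, $u(0)=u_0$, with unique invariant distribution $\mu_\infty$, and the postprocessed scheme $$u_{n+1}=J_1\Big(u_n+hB\big(u_n+\tfrac12\sigma\sqrt hJ_2\xi_n^Q\big)+\tfrac{\sqrt2-1}{2}\sigma\sqrt hJ_2\xi_n^Q\Big)+\tfrac{3-\sqrt2}{2}\sigma\sqrt hJ_2\xi_n^Q,\qquad \overline u_n=u_n+\tfrac12\sigma\sqrt hJ_3\xi_n^Q ,$$ and let $\overline\mu_\infty^h$ be the invariant distribution of the postprocessed solution $\overline u_n$. Then for any $s<\overline{s}$ there exists $C_s\in(0,+\infty)$ such that for any $\varphi\in\mathcal{C}^2(\mathcal{H},\mathbb{R})$ with $\sup_{v\in\mathcal{H}}\|D^2\varphi(v)\|<+\infty$ and any $h\in(0,1/L)$, $$\Big|\int_{\mathcal{H}}\varphi\,d\mu_\infty-\int_{\mathcal{H}}\varphi\,d\overline\mu_\infty^h\Big|\le C_s\sup_{v\in\mathcal{H}}\|D^2\varphi(v)\|\,\sigma^2h^{1+s}.$$ Moreover, if $B=0$ (i.e. $b_p=0$ for all $p$), then the method is exact: $\overline\mu_\infty^h=\mu_\infty$.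
   Context: $\mathcal{H}$ is a separable infinite-dimensional Hilbert space. $-A$ is an unbounded self-adjoint operator on $\mathcal{H}$ with eigenvalues $0<\lambda_1\le\lambda_2\le\cdots$, $\lambda_p\to+\infty$, and complete orthonormal eigenvectors $(e_p)_{p\ge1}$, $Ae_p=-\lambda_pe_p$. $Q$ is a bounded non-negative self-adjoint operator with $Qe_p=q_pe_p$, $(q_p)$ a bounded sequence of non-negative reals. The standing trace condition is $$\overline{s}=\sup\{s\in(0,1):\mathrm{Trace}((-A)^{-1+s}Q)<+\infty\}>0 .$$ $W^Q(t)=\sum_{p\ge1}\sqrt{q_p}\,\beta_p(t)e_p$ with $(\beta_p)$ independent standard scalar Wiener processes. For a timestep $h>0$: $\xi_n^Q=h^{-1/2}(W^Q((n+1)h)-W^Q(nh))$, $J_1=(I-hA)^{-1}$, $J_2=(I-\frac{3-\sqrt2}{2}hA)^{-1}$, and $J_3$ satisfies $J_3QJ_3^T=(I-\frac h2A)^{-1}Q$ (e.g. $J_3=(I-\frac h2A)^{-1/2}$). The pair $(u_n,\overline u_{n-1})$ is a Markov chain on $\mathcal{H}\times\mathcal{H}$ with a unique invariant distribution, and $\overline\mu_\infty^h$ denotes its second marginal (a centered Gaussian measure). The invariant distribution of the SPDE is $\mu_\infty=\mathcal{N}(0,\frac{\sigma^2}{2}Q(-A-B)^{-1})$. If $L=0$, $1/L$ is understood as $+\infty$. *)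

theory Defs
  imports "HOL-Probability.Probability"
begin

section \<open>Operators\<close>

text \<open>A partially defined operator \<open>T\<close> with domain \<open>D\<close> (values of \<open>T\<close> outside \<open>D\<close> are irrelevant) is
  self-adjoint if it is densely defined, linear, and its graph is the graph of its adjoint.\<close>

definition self_adjoint_on :: "'h::real_inner set \<Rightarrow> ('h \<Rightarrow> 'h) \<Rightarrow> bool" where
  "self_adjoint_on D T \<longleftrightarrow>
     subspace D \<and> closure D = UNIV \<and>
     (\<forall>x\<in>D. \<forall>y\<in>D. T (x + y) = T x + T y) \<and>
     (\<forall>c. \<forall>x\<in>D. T (c *\<^sub>R x) = c *\<^sub>R T x) \<and>
     (\<forall>x y. (x \<in> D \<and> T x = y) \<longleftrightarrow> (\<forall>z\<in>D. T z \<bullet> x = z \<bullet> y))"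

text \<open>\<open>(I - \<tau>A)\<^sup>-\<^sup>1\<close>, where \<open>I - \<tau>A\<close> has domain \<open>D\<close>.\<close>

definition resolvent :: "'h::real_inner set \<Rightarrow> ('h \<Rightarrow> 'h) \<Rightarrow> real \<Rightarrow> 'h \<Rightarrow> 'h" where
  "resolvent D A \<tau> = inv_into D (\<lambda>x. x - \<tau> *\<^sub>R A x)"

text \<open>The power \<open>(-A)\<^sup>r\<close> by functional calculus; all values are meaningful for \<open>r \<le> 0\<close>.\<close>

definition neg_power :: "(nat \<Rightarrow> real) \<Rightarrow> (nat \<Rightarrow> 'h::real_inner) \<Rightarrow> real \<Rightarrow> 'h \<Rightarrow> 'h" where
  "neg_power lam e r v = (\<Sum>p. (lam p powr r * (v \<bullet> e p)) *\<^sub>R e p)"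

text \<open>Trace in \<open>[0,\<infinity>]\<close> of a non-negative operator with respect to a complete orthonormal system.\<close>

definition nonneg_trace :: "(nat \<Rightarrow> 'h::real_inner) \<Rightarrow> ('h \<Rightarrow> 'h) \<Rightarrow> ennreal" where
  "nonneg_trace e T = (\<Sum>p. ennreal (T (e p) \<bullet> e p))"

text \<open>The supremum is taken in the extended reals, so that it is \<open>-\<infinity>\<close> if no \<open>s\<close> is admissible.\<close>

definition s_bar :: "(nat \<Rightarrow> real) \<Rightarrow> (nat \<Rightarrow> 'h::real_inner) \<Rightarrow> ('h \<Rightarrow> 'h) \<Rightarrow> ereal" where
  "s_bar lam e Q =
     Sup (ereal ` {s. 0 < s \<and> s < 1 \<and> nonneg_trace e (neg_power lam e (-1 + s) \<circ> Q) < \<infinity>})"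

text \<open>The type is a real Hilbert space (complete inner product space), separable, and it is
  infinite-dimensional because of the orthonormal sequence. All sequences are indexed from \<open>0\<close>,
  so \<open>lam 0\<close> is the smallest eigenvalue of \<open>-A\<close>.\<close>

locale spde_setting =
  fixes D :: "'h::{real_inner, polish_space} set"
    and A :: "'h \<Rightarrow> 'h"
    and lam :: "nat \<Rightarrow> real"
    and e :: "nat \<Rightarrow> 'h"
    and Q :: "'h \<Rightarrow> 'h"
    and q :: "nat \<Rightarrow> real"
  assumes orthonormal: "e i \<bullet> e j = (if i = j then 1 else 0)"
    and complete: "closure (span (range e)) = UNIV"
    and A_self_adjoint: "self_adjoint_on D (\<lambda>x. - A x)"
    and e_in_dom: "e p \<in> D"
    and A_eigen: "A (e p) = - (lam p *\<^sub>R e p)"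
    and lam_pos: "0 < lam 0"
    and lam_mono: "mono lam"
    and lam_lim: "filterlim lam at_top sequentially"
    and Q_bounded: "bounded_linear Q"
    and Q_self_adjoint: "Q x \<bullet> y = x \<bullet> Q y"
    and Q_nonneg: "0 \<le> Q x \<bullet> x"
    and Q_eigen: "Q (e p) = q p *\<^sub>R e p"
    and q_nonneg: "0 \<le> q p"
    and q_bounded: "bounded (range q)"
    and trace_condition: "0 < s_bar lam e Q"

section \<open>Wiener processes\<close>

definition standard_wiener :: "'w measure \<Rightarrow> (real \<Rightarrow> 'w \<Rightarrow> real) \<Rightarrow> bool" where
  "standard_wiener M \<beta> \<longleftrightarrow>
     prob_space M \<and>
     (\<forall>t\<ge>0. \<beta> t \<in> borel_measurable M) \<and>
     (AE \<omega> in M. \<beta> 0 \<omega> = 0) \<and>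
     (AE \<omega> in M. continuous_on {0..} (\<lambda>t. \<beta> t \<omega>)) \<and>
     (\<forall>s t. 0 \<le> s \<longrightarrow> s < t \<longrightarrow>
        distributed M lborel (\<lambda>\<omega>. \<beta> t \<omega> - \<beta> s \<omega>) (normal_density 0 (sqrt (t - s)))) \<and>
     (\<forall>n (t :: nat \<Rightarrow> real). 0 \<le> t 0 \<longrightarrow> mono t \<longrightarrow>
        prob_space.indep_vars M (\<lambda>_. borel) (\<lambda>i \<omega>. \<beta> (t (Suc i)) \<omega> - \<beta> (t i) \<omega>) {..<n})"

text \<open>Independence of the whole processes, seen as random elements of the space of all functions
  on \<open>[0,\<infinity>)\<close> with the product sigma-algebra.\<close>

definition indep_wiener_family :: "'w measure \<Rightarrow> (nat \<Rightarrow> real \<Rightarrow> 'w \<Rightarrow> real) \<Rightarrow> bool" where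
  "indep_wiener_family M \<beta> \<longleftrightarrow>
     (\<forall>p. standard_wiener M (\<beta> p)) \<and>
     prob_space.indep_vars M (\<lambda>_. PiM {0..} (\<lambda>_. borel)) (\<lambda>p \<omega>. \<lambda>t\<in>{0..}. \<beta> p t \<omega>) UNIV"

text \<open>\<open>Q\<close> need not be trace class, so \<open>W\<^sup>Q(t) = \<Sum>\<^sub>p \<surd>q\<^sub>p \<beta>\<^sub>p(t) e\<^sub>p\<close> need not converge in the Hilbert space.
  It enters only through the pairings \<open>\<langle>W\<^sup>Q(t), v\<rangle>\<close> and through images of its increments under
  smoothing operators, both defined by applying the functional or operator term by term.\<close>

definition wiener_pairing ::
  "(nat \<Rightarrow> real) \<Rightarrow> (nat \<Rightarrow> 'h::real_inner) \<Rightarrow> (nat \<Rightarrow> real \<Rightarrow> 'w \<Rightarrow> real) \<Rightarrow> real \<Rightarrow> 'h \<Rightarrow> 'w \<Rightarrow> real" where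
  "wiener_pairing q e \<beta> t v \<omega> = (\<Sum>p. sqrt (q p) * \<beta> p t \<omega> * (e p \<bullet> v))"

text \<open>\<open>J \<xi>\<^sub>n\<^sup>Q\<close> for \<open>\<xi>\<^sub>n\<^sup>Q = h\<^sup>-\<^sup>1\<^sup>/\<^sup>2 (W\<^sup>Q((n+1)h) - W\<^sup>Q(nh))\<close>.\<close>

definition noise_image ::
  "(nat \<Rightarrow> real) \<Rightarrow> (nat \<Rightarrow> 'h::real_inner) \<Rightarrow> (nat \<Rightarrow> real \<Rightarrow> 'w \<Rightarrow> real) \<Rightarrow> real \<Rightarrow> ('h \<Rightarrow> 'h)
     \<Rightarrow> nat \<Rightarrow> 'w \<Rightarrow> 'h" where
  "noise_image q e \<beta> h J n \<omega> =
     (\<Sum>p. (sqrt (q p) * ((\<beta> p ((real n + 1) * h) \<omega> - \<beta> p (real n * h) \<omega>) / sqrt h)) *\<^sub>R J (e p))"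

section \<open>Invariant distributions\<close>

definition invariant_distribution :: "('x::topological_space \<Rightarrow> 'x measure) \<Rightarrow> 'x measure \<Rightarrow> bool" where
  "invariant_distribution K \<mu> \<longleftrightarrow>
     prob_space \<mu> \<and> sets \<mu> = sets borel \<and>
     (\<forall>S\<in>sets borel. emeasure \<mu> S = (\<integral>\<^sup>+x. emeasure (K x) S \<partial>\<mu>))"

section \<open>The stochastic evolution equation\<close>

text \<open>Weak solution of \<open>du = Au dt + Bu dt + \<sigma> dW\<^sup>Q\<close>, \<open>u(0) = x\<close>: the equation is tested against
  \<open>v \<in> D\<close>, and \<open>A\<close> is moved to \<open>v\<close> by self-adjointness.\<close>

definition weak_solution ::
  "'w measure \<Rightarrow> 'h::{real_inner, polish_space} set \<Rightarrow> ('h \<Rightarrow> 'h) \<Rightarrow> ('h \<Rightarrow> 'h) \<Rightarrow> real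
     \<Rightarrow> (real \<Rightarrow> 'h \<Rightarrow> 'w \<Rightarrow> real) \<Rightarrow> 'h \<Rightarrow> (real \<Rightarrow> 'w \<Rightarrow> 'h) \<Rightarrow> bool" where
  "weak_solution M D A B \<sigma> W x u \<longleftrightarrow>
     (\<forall>t\<ge>0. u t \<in> borel_measurable M) \<and>
     (\<forall>v\<in>D. AE \<omega> in M. \<forall>t\<ge>0.
        set_integrable lborel {0..t} (\<lambda>r. u r \<omega> \<bullet> A v + B (u r \<omega>) \<bullet> v) \<and>
        u t \<omega> \<bullet> v = x \<bullet> v + (LINT r:{0..t}|lborel. u r \<omega> \<bullet> A v + B (u r \<omega>) \<bullet> v) + \<sigma> * W t v \<omega>)"

text \<open>\<open>u x\<close> is the solution started at \<open>x\<close>; \<open>\<mu>\<close> is invariant under the transition semigroup.\<close>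

definition spde_invariant ::
  "'w measure \<Rightarrow> ('h::topological_space \<Rightarrow> real \<Rightarrow> 'w \<Rightarrow> 'h) \<Rightarrow> 'h measure \<Rightarrow> bool" where
  "spde_invariant M u \<mu> \<longleftrightarrow> (\<forall>t\<ge>0. invariant_distribution (\<lambda>x. distr M borel (u x t)) \<mu>)"

section \<open>The postprocessed scheme\<close>

definition admissible_J3 ::
  "'h::real_inner set \<Rightarrow> ('h \<Rightarrow> 'h) \<Rightarrow> ('h \<Rightarrow> 'h) \<Rightarrow> real \<Rightarrow> ('h \<Rightarrow> 'h) \<Rightarrow> bool" where
  "admissible_J3 D A Q h J3 \<longleftrightarrow>
     bounded_linear J3 \<and> J3 \<circ> Q \<circ> adjoint J3 = resolvent D A (h / 2) \<circ> Q"

text \<open>One step \<open>u\<^sub>n \<mapsto> u\<^sub>n\<^sub>+\<^sub>1\<close>; the last argument is the value of \<open>J\<^sub>2 \<xi>\<^sub>n\<^sup>Q\<close>.\<close>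

definition scheme_step ::
  "'h::real_inner set \<Rightarrow> ('h \<Rightarrow> 'h) \<Rightarrow> ('h \<Rightarrow> 'h) \<Rightarrow> real \<Rightarrow> real \<Rightarrow> 'h \<Rightarrow> 'h \<Rightarrow> 'h" where
  "scheme_step D A B \<sigma> h u y =
     resolvent D A h
       (u + h *\<^sub>R B (u + (1 / 2 * \<sigma> * sqrt h) *\<^sub>R y) + ((sqrt 2 - 1) / 2 * \<sigma> * sqrt h) *\<^sub>R y)
     + ((3 - sqrt 2) / 2 * \<sigma> * sqrt h) *\<^sub>R y"

text \<open>The postprocessed value (\<open>u\<^sub>n\<close> overlined); the last argument is the value of \<open>J\<^sub>3 \<xi>\<^sub>n\<^sup>Q\<close>.\<close>

definition postprocess :: "real \<Rightarrow> real \<Rightarrow> 'h::real_inner \<Rightarrow> 'h \<Rightarrow> 'h" where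
  "postprocess \<sigma> h u y = u + (1 / 2 * \<sigma> * sqrt h) *\<^sub>R y"

text \<open>Writing \<open>w\<^sub>n\<close> for the postprocessed value of \<open>u\<^sub>n\<close>, this is the transition kernel from
  \<open>(u\<^sub>n, w\<^sub>n\<^sub>-\<^sub>1)\<close> to \<open>(u\<^sub>n\<^sub>+\<^sub>1, w\<^sub>n)\<close>.\<close>

definition scheme_kernel ::
  "'w measure \<Rightarrow> 'h::{real_inner, polish_space} set \<Rightarrow> ('h \<Rightarrow> 'h) \<Rightarrow> ('h \<Rightarrow> 'h) \<Rightarrow> (nat \<Rightarrow> 'h)
     \<Rightarrow> (nat \<Rightarrow> real) \<Rightarrow> (nat \<Rightarrow> real \<Rightarrow> 'w \<Rightarrow> real) \<Rightarrow> real \<Rightarrow> ('h \<Rightarrow> 'h) \<Rightarrow> real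
     \<Rightarrow> nat \<Rightarrow> 'h \<times> 'h \<Rightarrow> ('h \<times> 'h) measure" where
  "scheme_kernel M D A B e q \<beta> \<sigma> J3 h n = (\<lambda>(u, _). distr M borel (\<lambda>\<omega>.
     (scheme_step D A B \<sigma> h u (noise_image q e \<beta> h (resolvent D A ((3 - sqrt 2) / 2 * h)) n \<omega>),
      postprocess \<sigma> h u (noise_image q e \<beta> h J3 n \<omega>))))"

text \<open>The kernels are in fact the same for all \<open>n\<close>. The invariant distribution of the
  postprocessed solution is the second marginal of such a \<open>\<pi>\<close>.\<close>

definition scheme_invariant ::
  "'w measure \<Rightarrow> 'h::{real_inner, polish_space} set \<Rightarrow> ('h \<Rightarrow> 'h) \<Rightarrow> ('h \<Rightarrow> 'h) \<Rightarrow> (nat \<Rightarrow> 'h)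
     \<Rightarrow> (nat \<Rightarrow> real) \<Rightarrow> (nat \<Rightarrow> real \<Rightarrow> 'w \<Rightarrow> real) \<Rightarrow> real \<Rightarrow> ('h \<Rightarrow> 'h) \<Rightarrow> real
     \<Rightarrow> ('h \<times> 'h) measure \<Rightarrow> bool" where
  "scheme_invariant M D A B e q \<beta> \<sigma> J3 h \<pi> \<longleftrightarrow>
     (\<forall>n. invariant_distribution (scheme_kernel M D A B e q \<beta> \<sigma> J3 h n) \<pi>)"

section \<open>Test functions\<close>

text \<open>\<open>\<phi>\<close> is twice continuously (Frechet) differentiable with derivatives \<open>\<phi>'\<close> and \<open>\<phi>''\<close>; the norm of
  \<open>\<phi>'' v\<close> is the operator norm, i.e. the norm of the bilinear form.\<close>

definition C2_function ::
  "('h::real_inner \<Rightarrow> real) \<Rightarrow> ('h \<Rightarrow> 'h \<Rightarrow>\<^sub>L real) \<Rightarrow> ('h \<Rightarrow> 'h \<Rightarrow>\<^sub>L 'h \<Rightarrow>\<^sub>L real) \<Rightarrow> bool" where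
  "C2_function \<phi> \<phi>' \<phi>'' \<longleftrightarrow>
     (\<forall>v. (\<phi> has_derivative blinfun_apply (\<phi>' v)) (at v)) \<and>
     (\<forall>v. (\<phi>' has_derivative blinfun_apply (\<phi>'' v)) (at v)) \<and>
     continuous_on UNIV \<phi>''"

end

theory Submission
  imports Defs "HOL-Real_Asymp.Real_Asymp"
begin

text \<open>
  Everything is diagonal in the basis \<open>e\<close>, so both invariant laws are centered Gaussian measures
  with diagonal covariance, and the theorem reduces to comparing two sequences of variances.

  \<^emph>\<open>Identification of the laws.\<close> A probability measure on the Hilbert space is determined by its
  characteristic functional (\<open>char_fun_unique\<close>). Over the unit time interval the equation acts as
  \<open>x \<mapsto> S x + Z\<close>, and one step of the scheme acts on its first component as \<open>x \<mapsto> R x + Z'\<close>, where \<open>S\<close> and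
  \<open>R\<close> are diagonal strict contractions and \<open>Z\<close>, \<open>Z'\<close> are Gaussian and do not depend on \<open>x\<close>. The
  characteristic functional \<open>f\<close> of an invariant law therefore solves
  \<open>f c = f (R c) \<sqdot> exp (- quad V c / 2)\<close>, and iterating this equation towards \<open>f 0 = 1\<close> leaves a single
  solution, the Gaussian one with variances \<open>V p / (1 - (R p)\<^sup>2)\<close> (\<open>autoregression_gaussian\<close>). Uniqueness of
  the invariant law and convergence to it are thus consequences of invariance alone. For the
  equation this gives the variances \<open>\<sigma>\<^sup>2 q p / (2 (lam p + b p))\<close>. Postprocessing adds an independent
  Gaussian whose covariance \<open>J\<^sub>3 Q J\<^sub>3\<^sup>*\<close> is diagonal although \<open>J\<^sub>3\<close> need not be.

  \<^emph>\<open>Comparison.\<close> Two centered Gaussians with variances \<open>V\<close> and \<open>W\<close> are both obtained from the one with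
  variances \<open>min V W\<close> by adding independent centered Gaussian increments. A symmetric increment \<open>Y\<close> changes the
  expectation of \<open>\<phi>\<close> by a second difference only, hence by at most half of \<open>sup \<parallel>D\<^sup>2 \<phi>\<parallel>\<close> times the second
  moment of \<open>Y\<close> (\<open>gaussian_comparison\<close>). No rate is lost here: the weak error is controlled by
  \<open>\<Sum> \<bar>V p - W p\<bar>\<close>.

  \<^emph>\<open>Order of convergence.\<close> With \<open>x = h lam p\<close> and \<open>y = h b p\<close> the difference of the variances has the
  factor \<open>y x\<close> (\<open>variance_defect_eq\<close>). It vanishes for \<open>b = 0\<close>, which is the exactness
  statement. Otherwise it is at most a constant times \<open>\<sigma>\<^sup>2 h\<^sup>2 q p / (1 + x)\<^sup>2\<close>, and
  \<open>(1 + x)\<^sup>-\<^sup>2 \<le> x\<^sup>s\<^sup>-\<^sup>1\<close> trades the decay in \<open>x\<close> for the order \<open>1 + s\<close> and the summable weight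
  \<open>lam p powr (s - 1) * q p\<close> of the trace condition.

  Since \<open>Q\<close> need not be trace class, the noise terms are series of independent Gaussian vectors that
  converge only after smoothing. For a non-diagonal \<open>J\<^sub>3\<close> these vectors are not orthogonal; their almost
  sure convergence rests on a maximal inequality of Kolmogorov type (\<open>maximal_inequality\<close>).
\<close>

section \<open>Diagonal operators on a Hilbert space\<close>

locale hilbert_basis =
  fixes e :: "nat \<Rightarrow> 'h::{real_inner, polish_space}"
  assumes orthonormal: "e i \<bullet> e j = (if i = j then 1 else 0)"
    and complete: "closure (span (range e)) = UNIV"
begin

lemma sum_coord: "(\<Sum>p<n. a p *\<^sub>R e p) \<bullet> e k = (if k < n then a k else 0)"
  by (simp add: inner_sum_left orthonormal if_distrib[of "\<lambda>x. _ * x"] sum.delta cong: if_cong)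

lemma norm_sum_coord: "finite I \<Longrightarrow> (norm (\<Sum>p\<in>I. a p *\<^sub>R e p))\<^sup>2 = (\<Sum>p\<in>I. (a p)\<^sup>2)"
  unfolding power2_norm_eq_inner
  by (simp add: inner_sum_left inner_sum_right orthonormal if_distrib[of "\<lambda>x. _ * x"] sum.delta
      power2_eq_square cong: if_cong)

definition proj :: "nat \<Rightarrow> 'h \<Rightarrow> 'h" where
  "proj n x = (\<Sum>p<n. (x \<bullet> e p) *\<^sub>R e p)"

lemma proj_add: "proj n (x + y) = proj n x + proj n y"
  and proj_diff: "proj n (x - y) = proj n x - proj n y"
  and proj_scaleR: "proj n (c *\<^sub>R x) = c *\<^sub>R proj n x"
  by (simp_all add: proj_def inner_add_left inner_diff_left scaleR_left_distrib scaleR_left_diff_distrib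
      sum.distrib sum_subtractf scaleR_sum_right)

text \<open>This contraction property makes \<open>proj n x \<longlonglongrightarrow> x\<close> stable under approximation of \<open>x\<close>, so that it
  suffices to know it on the dense span of the basis.\<close>

lemma norm_diff_proj_le: "norm (x - proj n x) \<le> norm x"
proof -
  have 1: "(x - proj n x) \<bullet> proj n x = 0"
    unfolding proj_def inner_sum_right
    by (rule sum.neutral) (use sum_coord in \<open>auto simp: inner_diff_left\<close>)
  have "(norm (a + b))\<^sup>2 = (norm a)\<^sup>2 + (norm b)\<^sup>2" if "a \<bullet> b = 0" for a b :: 'h
    unfolding power2_norm_eq_inner using that by (simp add: inner_add_left inner_add_right inner_commute)
  from this[OF 1] have "(norm (x - proj n x))\<^sup>2 \<le> (norm x)\<^sup>2" by simp
  then show ?thesis using norm_ge_zero power2_le_imp_le by blast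
qed

lemma proj_eventually:
  assumes "x \<in> span (range e)"
  shows "\<exists>N. \<forall>n\<ge>N. proj n x = x"
  using assms
proof (induction rule: span_induct_alt)
  case base
  then show ?case by (auto simp: proj_def)
next
  case (step c x y)
  then obtain k N where k: "x = e k" and N: "\<forall>n\<ge>N. proj n y = y" by auto
  have "proj n (e k) = e k" if "n > k" for n
    unfolding proj_def using that by (simp add: orthonormal if_distrib[of "\<lambda>x. x *\<^sub>R _"] sum.delta cong: if_cong)
  then have "\<forall>n\<ge>max N (Suc k). proj n (c *\<^sub>R x + y) = c *\<^sub>R x + y"
    using N k by (auto simp: proj_add proj_scaleR)
  then show ?case by blast
qed

lemma proj_tendsto: "(\<lambda>n. proj n x) \<longlonglongrightarrow> x"
proof (rule metric_LIMSEQ_I)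
  fix r :: real assume "r > 0"
  have "x \<in> closure (span (range e))" using complete by simp
  then obtain y where y: "y \<in> span (range e)" "dist y x < r"
    using \<open>r > 0\<close> by (meson closure_approachable)
  obtain N where N: "\<forall>n\<ge>N. proj n y = y" using proj_eventually[OF y(1)] by blast
  have "dist (proj n x) x < r" if "n \<ge> N" for n
  proof -
    have "x - proj n x = (x - y) - proj n (x - y)" using N that by (simp add: proj_diff)
    then have "norm (x - proj n x) \<le> norm (x - y)" using norm_diff_proj_le by metis
    then show ?thesis using y(2) by (simp add: dist_norm norm_minus_commute)
  qed
  then show "\<exists>N. \<forall>n\<ge>N. dist (proj n x) x < r" by blast
qed

lemma basis_expansion: "(\<lambda>p. (x \<bullet> e p) *\<^sub>R e p) sums x"
  using proj_tendsto unfolding sums_def proj_def .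

lemma basis_expansion_linear: "bounded_linear f \<Longrightarrow> (\<lambda>p. (x \<bullet> e p) *\<^sub>R f (e p)) sums f x"
  using bounded_linear.sums[OF _ basis_expansion, of f x] by (simp add: linear_simps)

lemma parseval: "(\<lambda>p. (x \<bullet> e p) * (y \<bullet> e p)) sums (x \<bullet> y)"
  using basis_expansion_linear[OF bounded_linear_inner_left, of x y] by (simp add: inner_commute)

lemma parseval_norm: "(\<lambda>p. (x \<bullet> e p)\<^sup>2) sums (norm x)\<^sup>2"
  using parseval[of x x] by (simp add: power2_eq_square power2_norm_eq_inner[unfolded power2_eq_square])

lemma coord_eqI: "(\<And>p. x \<bullet> e p = y \<bullet> e p) \<Longrightarrow> x = y"
  using sums_unique2[OF basis_expansion[of x]] basis_expansion[of y] by simp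

lemma riesz_fischer:
  assumes a: "summable (\<lambda>p. (a p)\<^sup>2)"
  shows "\<exists>x. (\<lambda>p. a p *\<^sub>R e p) sums x \<and> (\<forall>p. x \<bullet> e p = a p)"
proof -
  have "Cauchy (\<lambda>n. \<Sum>p<n. a p *\<^sub>R e p)"
  proof (rule metric_CauchyI)
    fix r :: real assume r: "r > 0"
    then obtain N where N: "\<And>m n. m \<ge> N \<Longrightarrow> norm (\<Sum>p=m..<n. (a p)\<^sup>2) < r\<^sup>2"
      using a unfolding summable_Cauchy by (meson zero_less_power)
    have *: "dist (\<Sum>p<m. a p *\<^sub>R e p) (\<Sum>p<n. a p *\<^sub>R e p) < r" if "m \<ge> N" "n \<ge> m" for m n
    proof -
      have "(\<Sum>p<n. a p *\<^sub>R e p) - (\<Sum>p<m. a p *\<^sub>R e p) = (\<Sum>p=m..<n. a p *\<^sub>R e p)"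
        using that by (simp add: sum_diff_nat_ivl lessThan_atLeast0)
      then have "(dist (\<Sum>p<m. a p *\<^sub>R e p) (\<Sum>p<n. a p *\<^sub>R e p))\<^sup>2 = (\<Sum>p=m..<n. (a p)\<^sup>2)"
        by (simp only: dist_norm norm_minus_commute[of "\<Sum>p<m. a p *\<^sub>R e p"] norm_sum_coord finite_atLeastLessThan)
      also have "\<dots> < r\<^sup>2" using N[OF that(1), of n] by (simp add: sum_nonneg)
      finally show ?thesis using r power_less_imp_less_base by (metis less_le)
    qed
    show "\<exists>N. \<forall>m\<ge>N. \<forall>n\<ge>N. dist (\<Sum>p<m. a p *\<^sub>R e p) (\<Sum>p<n. a p *\<^sub>R e p) < r"
    proof (intro exI[of _ N] allI impI)
      fix m n assume "N \<le> m" "N \<le> n"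
      then show "dist (\<Sum>p<m. a p *\<^sub>R e p) (\<Sum>p<n. a p *\<^sub>R e p) < r"
        using *[of m n] *[of n m] by (cases "m \<le> n") (simp_all add: dist_commute)
    qed
  qed
  then obtain x where x: "(\<lambda>n. \<Sum>p<n. a p *\<^sub>R e p) \<longlonglongrightarrow> x"
    using Cauchy_convergent convergent_def by blast
  have "x \<bullet> e k = a k" for k
  proof (rule LIMSEQ_unique)
    show "(\<lambda>n. (\<Sum>p<n. a p *\<^sub>R e p) \<bullet> e k) \<longlonglongrightarrow> x \<bullet> e k" by (intro tendsto_intros x)
    show "(\<lambda>n. (\<Sum>p<n. a p *\<^sub>R e p) \<bullet> e k) \<longlonglongrightarrow> a k"
      by (rule tendsto_eventually) (auto simp: sum_coord eventually_sequentially intro!: exI[of _ "Suc k"])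
  qed
  with x show ?thesis unfolding sums_def by blast
qed

definition diag :: "(nat \<Rightarrow> real) \<Rightarrow> 'h \<Rightarrow> 'h" where
  "diag m x = (\<Sum>p. (m p * (x \<bullet> e p)) *\<^sub>R e p)"

lemma summable_bounded_coord:
  assumes "\<And>p. \<bar>m p\<bar> \<le> r"
  shows "summable (\<lambda>p. (m p * (x \<bullet> e p))\<^sup>2)" "(\<Sum>p. (m p * (x \<bullet> e p))\<^sup>2) \<le> r\<^sup>2 * (norm x)\<^sup>2"
proof -
  have s: "(\<lambda>p. r\<^sup>2 * (x \<bullet> e p)\<^sup>2) sums (r\<^sup>2 * (norm x)\<^sup>2)" by (intro sums_mult parseval_norm)
  have le: "(m p * (x \<bullet> e p))\<^sup>2 \<le> r\<^sup>2 * (x \<bullet> e p)\<^sup>2" for p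
    using assms[of p] by (simp add: power_mult_distrib abs_le_square_iff[symmetric] mult_right_mono)
  show "summable (\<lambda>p. (m p * (x \<bullet> e p))\<^sup>2)"
    by (rule summable_comparison_test'[OF sums_summable[OF s], of 0]) (use le in auto)
  from suminf_le[OF le this sums_summable[OF s]]
  show "(\<Sum>p. (m p * (x \<bullet> e p))\<^sup>2) \<le> r\<^sup>2 * (norm x)\<^sup>2" using s by (simp add: sums_iff)
qed

lemma diag_coord:
  assumes "\<And>p. \<bar>m p\<bar> \<le> r"
  shows "diag m x \<bullet> e k = m k * (x \<bullet> e k)"
proof -
  obtain y where "(\<lambda>p. (m p * (x \<bullet> e p)) *\<^sub>R e p) sums y" "\<forall>p. y \<bullet> e p = m p * (x \<bullet> e p)"
    by (rule exE[OF riesz_fischer[OF summable_bounded_coord(1)[of m r x, OF assms]]]) blast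
  then show ?thesis unfolding diag_def by (simp add: sums_iff)
qed

lemma diag_norm_le:
  assumes "\<And>p. \<bar>m p\<bar> \<le> r"
  shows "norm (diag m x) \<le> r * norm x"
proof -
  have "0 \<le> r" using assms[of 0] by linarith
  have "(norm (diag m x))\<^sup>2 = (\<Sum>p. (diag m x \<bullet> e p)\<^sup>2)" by (rule sums_unique[OF parseval_norm])
  also have "\<dots> = (\<Sum>p. (m p * (x \<bullet> e p))\<^sup>2)" by (simp only: diag_coord[of m r x, OF assms])
  also have "\<dots> \<le> r\<^sup>2 * (norm x)\<^sup>2" by (rule summable_bounded_coord(2)[of m r x, OF assms])
  also have "\<dots> = (r * norm x)\<^sup>2" by (rule power_mult_distrib[symmetric])
  finally have "(norm (diag m x))\<^sup>2 \<le> (r * norm x)\<^sup>2" .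
  moreover have "0 \<le> r * norm x" using \<open>0 \<le> r\<close> by simp
  ultimately show ?thesis by (rule power2_le_imp_le)
qed

lemma bounded_linear_diag:
  assumes "\<And>p. \<bar>m p\<bar> \<le> r"
  shows "bounded_linear (diag m)"
proof (rule bounded_linear_intro)
  show "diag m (x + y) = diag m x + diag m y" for x y
    by (rule coord_eqI) (simp add: diag_coord[of m r, OF assms] inner_add_left algebra_simps)
  show "diag m (c *\<^sub>R x) = c *\<^sub>R diag m x" for c x
    by (rule coord_eqI) (simp add: diag_coord[of m r, OF assms])
  show "norm (diag m x) \<le> norm x * r" for x using diag_norm_le[of m r, OF assms] by (simp add: mult.commute)
qed

lemma diag_inner_commute:
  assumes "\<And>p. \<bar>m p\<bar> \<le> r"
  shows "diag m x \<bullet> y = x \<bullet> diag m y"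
  by (rule sums_unique2[OF parseval], rule sums_cong[THEN iffD2, OF _ parseval])
     (simp add: diag_coord[of m r, OF assms])

lemma eigen_coord:
  assumes "bounded_linear T" "\<And>p. T (e p) = m p *\<^sub>R e p"
  shows "T x \<bullet> e k = m k * (x \<bullet> e k)"
proof -
  have "(\<lambda>p. (x \<bullet> e p) *\<^sub>R T (e p) \<bullet> e k) sums (T x \<bullet> e k)"
    using bounded_linear.sums[OF bounded_linear_inner_left basis_expansion_linear[OF assms(1)]] .
  moreover have "(\<lambda>p. (x \<bullet> e p) *\<^sub>R T (e p) \<bullet> e k) = (\<lambda>p. if p = k then m p * (x \<bullet> e p) else 0)"
    by (auto simp: assms(2) orthonormal)
  ultimately show ?thesis using sums_single[of k "\<lambda>p. m p * (x \<bullet> e p)"] sums_unique2 by metis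
qed

text \<open>The candidate is the vector with coordinates \<open>J (e p) \<bullet> y\<close>. These are square summable: applying
  \<open>J\<close> to their partial sums \<open>z\<close> gives \<open>\<parallel>z\<parallel>\<^sup>2 = J z \<bullet> y \<le> K \<parallel>z\<parallel> \<parallel>y\<parallel>\<close>.\<close>

lemma inner_adjoint:
  fixes J :: "'h \<Rightarrow> 'h"
  assumes "bounded_linear J"
  shows "J x \<bullet> y = x \<bullet> adjoint J y"
proof -
  obtain K where K: "K > 0" "\<And>x. norm (J x) \<le> norm x * K"
    using bounded_linear.pos_bounded[OF assms] by blast
  have bd: "(\<Sum>p<n. (J (e p) \<bullet> y)\<^sup>2) \<le> (K * norm y)\<^sup>2" for n y
  proof -
    let ?S = "\<Sum>p<n. (J (e p) \<bullet> y)\<^sup>2" and ?z = "\<Sum>p<n. (J (e p) \<bullet> y) *\<^sub>R e p"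
    have "J ?z \<bullet> y = ?S"
      by (simp add: linear_sum[OF bounded_linear.linear[OF assms]] linear_scale[OF bounded_linear.linear[OF assms]]
          inner_sum_left power2_eq_square)
    moreover have "J ?z \<bullet> y \<le> norm ?z * K * norm y"
      using Cauchy_Schwarz_ineq2[of "J ?z" y] mult_right_mono[OF K(2)[of ?z], of "norm y"] by auto
    moreover have nz: "(norm ?z)\<^sup>2 = ?S" by (simp add: norm_sum_coord)
    ultimately have "(norm ?z)\<^sup>2 \<le> norm ?z * (K * norm y)" by simp
    then have "norm ?z * norm ?z \<le> norm ?z * (K * norm y)" by (simp only: power2_eq_square)
    moreover have "0 \<le> K * norm y" using K(1) by simp
    ultimately have "norm ?z \<le> K * norm y"
      by (cases "norm ?z = 0") (simp_all only: mult_le_cancel_left_pos zero_less_norm_iff norm_eq_zero norm_zero simp_thms)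
    from power_mono[OF this norm_ge_zero, of 2] show ?thesis using nz by simp
  qed
  define f where "f y = (\<Sum>p. (J (e p) \<bullet> y) *\<^sub>R e p)" for y
  have fc: "f y \<bullet> e k = J (e k) \<bullet> y" for y k
  proof -
    have "summable (\<lambda>p. (J (e p) \<bullet> y)\<^sup>2)"
      by (rule bounded_imp_summable[of _ "(K * norm y)\<^sup>2"]) (use bd[where n="Suc n" for n] in \<open>auto simp: lessThan_Suc_atMost\<close>)
    then obtain z where "(\<lambda>p. (J (e p) \<bullet> y) *\<^sub>R e p) sums z" "\<forall>p. z \<bullet> e p = J (e p) \<bullet> y"
      using riesz_fischer[of "\<lambda>p. J (e p) \<bullet> y"] by blast
    then show ?thesis unfolding f_def by (simp add: sums_iff)
  qed
  have "J x \<bullet> y = x \<bullet> f y" for x y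
    by (rule sums_unique2[OF bounded_linear.sums[OF bounded_linear_inner_left basis_expansion_linear[OF assms]]],
        rule sums_cong[THEN iffD2, OF _ parseval]) (simp add: fc)
  then have "\<exists>f. \<forall>x y. J x \<bullet> y = x \<bullet> f y" by blast
  from someI_ex[OF this] show ?thesis unfolding adjoint_def by blast
qed


text \<open>Self-adjointness supplies what the eigenvalues alone do not: the graph condition shows that the
  diagonal series lies in the domain and is mapped back to \<open>x\<close>, and that \<open>A\<close> acts coordinatewise on
  all of \<open>D\<close>, which gives injectivity.\<close>

lemma resolvent_eq_diag:
  assumes sa: "self_adjoint_on D (\<lambda>x. - A x)" and dom: "\<And>p. e p \<in> D"
    and eig: "\<And>p. A (e p) = - (lam p *\<^sub>R e p)" and lam: "\<And>p. lam p > 0" and tau: "\<tau> > 0"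
  shows "resolvent D A \<tau> x = diag (\<lambda>p. 1 / (1 + \<tau> * lam p)) x"
proof -
  have graph: "(x \<in> D \<and> - A x = y) \<longleftrightarrow> (\<forall>z\<in>D. - A z \<bullet> x = z \<bullet> y)" for x y
    using sa unfolding self_adjoint_on_def by blast
  have A_coord: "A w \<bullet> e p = - (lam p * (w \<bullet> e p))" if "w \<in> D" for w p
    using graph[of "e p" "lam p *\<^sub>R e p"] dom[of p] eig[of p] that by auto
  have pos: "0 < 1 + \<tau> * lam p" for p using lam[of p] tau by (simp add: add_pos_pos)
  have bd1: "\<bar>1 / (1 + \<tau> * lam p)\<bar> \<le> 1" for p using lam[of p] tau pos[of p] by (simp add: field_simps)
  have bd2: "\<bar>lam p / (1 + \<tau> * lam p)\<bar> \<le> 1 / \<tau>" for p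
    using lam[of p] tau pos[of p] by (simp add: field_simps)
  define y where "y = diag (\<lambda>p. 1 / (1 + \<tau> * lam p)) x"
  define z where "z = diag (\<lambda>p. lam p / (1 + \<tau> * lam p)) x"
  have y: "y \<bullet> e p = 1 / (1 + \<tau> * lam p) * (x \<bullet> e p)" for p
    unfolding y_def by (rule diag_coord[of _ 1]) (rule bd1)
  have z: "z \<bullet> e p = lam p / (1 + \<tau> * lam p) * (x \<bullet> e p)" for p
    unfolding z_def by (rule diag_coord[of _ "1 / \<tau>"]) (rule bd2)
  have "- A w \<bullet> y = w \<bullet> z" if "w \<in> D" for w
    by (rule sums_unique2[OF parseval], rule sums_cong[THEN iffD2, OF _ parseval])
       (simp add: A_coord[OF that] y z)
  then have yD: "y \<in> D" and Ay: "- A y = z" using graph[of y z] by auto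
  have "y - \<tau> *\<^sub>R A y = y + \<tau> *\<^sub>R z" unfolding Ay[symmetric] by simp
  also have "\<dots> = x"
  proof (rule coord_eqI)
    fix p
    show "(y + \<tau> *\<^sub>R z) \<bullet> e p = x \<bullet> e p"
      using pos[of p] by (simp add: inner_add_left y z divide_simps) (simp add: algebra_simps)
  qed
  finally have yx: "y - \<tau> *\<^sub>R A y = x" .
  have inj: "inj_on (\<lambda>x. x - \<tau> *\<^sub>R A x) D"
  proof (rule inj_onI)
    fix v w assume vw: "v \<in> D" "w \<in> D" "v - \<tau> *\<^sub>R A v = w - \<tau> *\<^sub>R A w"
    show "v = w"
    proof (rule coord_eqI)
      fix p
      have "(1 + \<tau> * lam p) * (v \<bullet> e p) = (1 + \<tau> * lam p) * (w \<bullet> e p)"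
        using arg_cong[OF vw(3), of "\<lambda>u. u \<bullet> e p"]
        by (simp add: inner_diff_left A_coord vw(1,2) algebra_simps)
      then show "v \<bullet> e p = w \<bullet> e p" using pos[of p] by simp
    qed
  qed
  show ?thesis unfolding resolvent_def y_def[symmetric]
    by (rule inv_into_f_eq[OF inj yD yx])
qed

text \<open>The left-hand side is the variance, in direction \<open>c\<close>, of the Gaussian series with terms
  \<open>sqrt (q p) *\<^sub>R J (e p)\<close>; only \<open>J Q J\<^sup>*\<close> enters, not \<open>J\<close> itself.\<close>

lemma covariance_sums:
  fixes J Q :: "'h \<Rightarrow> 'h"
  assumes J: "bounded_linear J" and Q: "bounded_linear Q" "\<And>p. Q (e p) = q p *\<^sub>R e p"
    and JQJ: "J \<circ> Q \<circ> adjoint J = T"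
  shows "(\<lambda>p. q p * (J (e p) \<bullet> c)\<^sup>2) sums (T c \<bullet> c)"
proof -
  have "T c \<bullet> c = Q (adjoint J c) \<bullet> adjoint J c"
    unfolding JQJ[symmetric] using inner_adjoint[OF J] by simp
  moreover have "Q (adjoint J c) \<bullet> e p * (adjoint J c \<bullet> e p) = q p * (J (e p) \<bullet> c)\<^sup>2" for p
    unfolding eigen_coord[OF Q] inner_adjoint[OF J, of "e p" c]
    by (simp add: power2_eq_square inner_commute[of "e p"])
  ultimately show ?thesis using parseval[of "Q (adjoint J c)" "adjoint J c"] by simp
qed

text \<open>The trace of \<open>J Q J\<^sup>*\<close> can be computed through the images \<open>J (e p)\<close> or through the diagonal of \<open>T\<close>;
  summing the squared coordinates in both orders compares the two.\<close>

lemma norm_image_summable: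
  fixes J T :: "'h \<Rightarrow> 'h"
  assumes cov: "\<And>c. (\<lambda>p. q p * (J (e p) \<bullet> c)\<^sup>2) sums (T c \<bullet> c)"
    and q: "\<And>p. q p \<ge> 0" and tr: "summable (\<lambda>k. T (e k) \<bullet> e k)"
  shows "summable (\<lambda>p. q p * (norm (J (e p)))\<^sup>2)"
proof (rule bounded_imp_summable[of _ "\<Sum>k. T (e k) \<bullet> e k"])
  fix n
  have s: "(\<lambda>k. \<Sum>p\<le>n. q p * (J (e p) \<bullet> e k)\<^sup>2) sums (\<Sum>p\<le>n. q p * (norm (J (e p)))\<^sup>2)"
    by (intro sums_sum sums_mult parseval_norm)
  have le: "(\<Sum>p\<le>n. q p * (J (e p) \<bullet> e k)\<^sup>2) \<le> T (e k) \<bullet> e k" for k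
    unfolding sums_unique[OF cov]
    by (rule sum_le_suminf) (use cov[THEN sums_summable] q in auto)
  show "(\<Sum>p\<le>n. q p * (norm (J (e p)))\<^sup>2) \<le> (\<Sum>k. T (e k) \<bullet> e k)"
    using sums_le[OF le s summable_sums[OF tr]] .
qed (use q in auto)

end

section \<open>Characteristic functionals\<close>

definition char_fun :: "'h::{real_inner, polish_space} measure \<Rightarrow> 'h \<Rightarrow> complex" where
  "char_fun \<nu> c = (CLINT v|\<nu>. iexp (v \<bullet> c))"

lemma measurable_inner_borel [measurable]:
  fixes f :: "'a \<Rightarrow> 'h::{real_inner, polish_space}"
  assumes [measurable]: "f \<in> borel_measurable M"
  shows "(\<lambda>x. f x \<bullet> c) \<in> borel_measurable M"
  by (rule borel_measurable_continuous_on[OF _ assms]) (intro continuous_intros)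

lemma char_distr_density:
  fixes w X :: "'a \<Rightarrow> real"
  assumes [measurable]: "w \<in> borel_measurable M" "X \<in> borel_measurable M"
    and w: "\<And>x. 0 \<le> w x"
  shows "char (distr (density M w) borel X) t = (CLINT x|M. of_real (w x) * iexp (t * X x))"
  unfolding char_def
  by (simp add: integral_distr integral_density w scaleR_conv_of_real)

text \<open>The uniqueness theorem for characteristic functions on the line, transferred to the images of
  finite measures with densities \<open>w\<close> and \<open>w'\<close> by normalizing their common mass.\<close>

lemma weighted_uniqueness:
  fixes w X :: "'a \<Rightarrow> real" and w' X' :: "'b \<Rightarrow> real"
  assumes int: "integrable M w" "integrable M' w'"
    and X[measurable]: "X \<in> borel_measurable M" "X' \<in> borel_measurable M'"
    and w: "\<And>x. 0 \<le> w x" "\<And>x. 0 \<le> w' x"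
    and eq: "\<And>t. (CLINT x|M. of_real (w x) * iexp (t * X x)) = (CLINT x|M'. of_real (w' x) * iexp (t * X' x))"
    and S[measurable]: "S \<in> sets borel"
  shows "(\<integral>x. indicator S (X x) * w x \<partial>M) = (\<integral>x. indicator S (X' x) * w' x \<partial>M')"
proof -
  note [measurable] = borel_measurable_integrable[OF int(1)] borel_measurable_integrable[OF int(2)]
  define m where "m = (\<integral>x. w x \<partial>M)"
  have m': "m = (\<integral>x. w' x \<partial>M')"
    using eq[of 0] by (simp add: m_def del: of_real_eq_iff flip: of_real_eq_iff[where 'a=complex])
  have m0: "m \<ge> 0" unfolding m_def using w by simp
  show ?thesis
  proof (cases "m = 0")
    case True
    have "AE x in M. w x = 0" using integral_nonneg_eq_0_iff_AE[OF int(1)] w True m_def by simp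
    then have "(\<integral>x. indicator S (X x) * w x \<partial>M) = (\<integral>x. 0 \<partial>M)"
      by (intro integral_cong_AE) auto
    moreover have "AE x in M'. w' x = 0" using integral_nonneg_eq_0_iff_AE[OF int(2)] w True m' by simp
    then have "(\<integral>x. indicator S (X' x) * w' x \<partial>M') = (\<integral>x. 0 \<partial>M')"
      by (intro integral_cong_AE) auto
    ultimately show ?thesis by simp
  next
    case False
    then have mp: "m > 0" using m0 by simp
    have *: "real_distribution (distr (density N (\<lambda>x. v x / m)) borel Y)"
      if "integrable N v" "\<And>x. 0 \<le> v x" "(\<integral>x. v x \<partial>N) = m" "Y \<in> borel_measurable N"
      for N :: "'c measure" and v Y :: "'c \<Rightarrow> real"
    proof -
      note [measurable] = borel_measurable_integrable[OF that(1)] that(4)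
      have "emeasure (density N (\<lambda>x. v x / m)) (space N) = (\<integral>\<^sup>+x. ennreal (v x / m) \<partial>N)"
        by (subst emeasure_density) (auto intro!: nn_integral_cong)
      also have "\<dots> = ennreal (\<integral>x. v x / m \<partial>N)"
        by (rule nn_integral_eq_integral) (use that mp in auto)
      also have "\<dots> = 1" using that mp by simp
      finally have "prob_space (density N (\<lambda>x. v x / m))" by (intro prob_spaceI) simp
      from prob_space.prob_space_distr[OF this, of Y borel]
      show ?thesis by (intro real_distribution.intro real_distribution_axioms.intro) simp_all
    qed
    have "distr (density M (\<lambda>x. w x / m)) borel X = distr (density M' (\<lambda>x. w' x / m)) borel X'" (is "?L = ?R")
    proof (rule Levy_uniqueness)
      show "real_distribution ?L" using *[OF int(1) w(1) _ X(1)] m_def by simp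
      show "real_distribution ?R" using *[OF int(2) w(2) _ X(2)] m' by simp
      show "char ?L = char ?R"
      proof
        fix t
        have "char ?L t = (CLINT x|M. of_real (w x) * iexp (t * X x)) / m"
          using w mp by (subst char_distr_density) (auto simp: field_simps)
        also have "\<dots> = char ?R t" unfolding eq
          using w mp by (subst char_distr_density) (auto simp: field_simps)
        finally show "char ?L t = char ?R t" .
      qed
    qed
    moreover have "(\<integral>x. indicator S x \<partial>?L) = (\<integral>x. indicator S (X x) * w x \<partial>M) / m"
      using w mp by (subst integral_distr, simp, simp, subst integral_density) (auto simp: mult.commute)
    moreover have "(\<integral>x. indicator S x \<partial>?R) = (\<integral>x. indicator S (X' x) * w' x \<partial>M') / m"
      using w mp by (subst integral_distr, simp, simp, subst integral_density) (auto simp: mult.commute)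
    ultimately have "(\<integral>x. indicator S (X x) * w x \<partial>M) / m = (\<integral>x. indicator S (X' x) * w' x \<partial>M') / m"
      by metis
    then show ?thesis using mp by simp
  qed
qed

lemma iexp_cos_eq: "of_real (1 + cos b) * iexp a = iexp a + (iexp (a + b) + iexp (a - b)) / 2"
  and iexp_sin_eq: "of_real (1 + sin b) * iexp a = iexp a + (iexp (a + b) - iexp (a - b)) / (2 * \<i>)"
  by (simp_all add: complex_eq_iff Re_exp Im_exp cos_add cos_diff sin_add sin_diff Re_divide Im_divide power2_eq_square)
     (simp_all add: algebra_simps)

context hilbert_basis
begin

text \<open>One coordinate at a time, the oscillating factor \<open>exp (i t v\<^sub>N)\<close> is replaced by an indicator of
  \<open>v\<^sub>N\<close>. The one-dimensional uniqueness theorem needs nonnegative weights, so the remaining factor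
  \<open>exp (i \<langle>v, c\<rangle>)\<close> is split into \<open>1 + cos\<close> and \<open>1 + sin\<close>, whose product with \<open>exp (i t v\<^sub>N)\<close> is again a
  combination of exponentials covered by the induction hypothesis.\<close>

lemma char_fun_box:
  fixes \<mu> \<nu> :: "'h measure"
  assumes "prob_space \<mu>" "prob_space \<nu>" and sets[measurable_cong]: "sets \<mu> = sets borel" "sets \<nu> = sets borel"
    and eq: "\<And>c. char_fun \<mu> c = char_fun \<nu> c" and S: "\<And>k. S k \<in> sets borel"
  shows "(CLINT v|\<mu>. of_real (\<Prod>k<N. indicator (S k) (v \<bullet> e k)) * iexp (v \<bullet> c)) =
         (CLINT v|\<nu>. of_real (\<Prod>k<N. indicator (S k) (v \<bullet> e k)) * iexp (v \<bullet> c))"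
proof (induction N arbitrary: c)
  case 0
  then show ?case using eq by (simp add: char_fun_def)
next
  case (Suc N)
  interpret \<mu>: prob_space \<mu> by fact
  interpret \<nu>: prob_space \<nu> by fact
  have [measurable]: "S k \<in> sets borel" for k by (rule S)
  define G :: "'h \<Rightarrow> real" where "G v = (\<Prod>k<N. indicator (S k) (v \<bullet> e k))" for v
  have Gb: "0 \<le> G v" "G v \<le> 1" for v
    unfolding G_def by (auto intro!: prod_nonneg prod_le_1 simp: indicator_def)
  have [measurable]: "G \<in> borel_measurable borel" unfolding G_def by measurable
  have IH: "(CLINT v|\<mu>. of_real (G v) * iexp (v \<bullet> c)) = (CLINT v|\<nu>. of_real (G v) * iexp (v \<bullet> c))" for c
    using Suc unfolding G_def .
  have i1: "integrable M (\<lambda>v. of_real (G v) * iexp (v \<bullet> d))"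
    if "prob_space M" "sets M = sets borel" for M :: "'h measure" and d
  proof -
    interpret prob_space M by fact
    note [measurable_cong] = that(2)
    show ?thesis by (rule integrable_const_bound[of _ 1]) (use Gb in \<open>auto simp: norm_mult\<close>)
  qed
  have pull: "of_real (x * y) * z = of_real x * (of_real y * z)" for x y :: real and z :: complex
    by simp
  have cosF: "(CLINT v|M. of_real (G v * (1 + cos (v \<bullet> c))) * iexp (t * (v \<bullet> e N))) =
      (let F = (\<lambda>d. CLINT v|M. of_real (G v) * iexp (v \<bullet> d))
       in F (t *\<^sub>R e N) + (F (t *\<^sub>R e N + c) + F (t *\<^sub>R e N - c)) / 2)"
    if M: "prob_space M" "sets M = sets borel" for M :: "'h measure" and c t
  proof -
    have "of_real (G v * (1 + cos (v \<bullet> c))) * iexp (t * (v \<bullet> e N))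
     = of_real (G v) * iexp (v \<bullet> (t *\<^sub>R e N)) +
       (of_real (G v) * iexp (v \<bullet> (t *\<^sub>R e N + c)) + of_real (G v) * iexp (v \<bullet> (t *\<^sub>R e N - c))) / 2" for v
      unfolding pull iexp_cos_eq inner_add_right inner_diff_right inner_scaleR_right
      by (simp only: distrib_left times_divide_eq_right)
    then show ?thesis unfolding Let_def
      by (simp only: Bochner_Integration.integral_add Bochner_Integration.integral_diff
          Bochner_Integration.integrable_add Bochner_Integration.integrable_diff
          integral_divide_zero integrable_divide i1[OF M] simp_thms)
  qed
  have sinF: "(CLINT v|M. of_real (G v * (1 + sin (v \<bullet> c))) * iexp (t * (v \<bullet> e N))) =
      (let F = (\<lambda>d. CLINT v|M. of_real (G v) * iexp (v \<bullet> d))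
       in F (t *\<^sub>R e N) + (F (t *\<^sub>R e N + c) - F (t *\<^sub>R e N - c)) / (2 * \<i>))"
    if M: "prob_space M" "sets M = sets borel" for M :: "'h measure" and c t
  proof -
    have "of_real (G v * (1 + sin (v \<bullet> c))) * iexp (t * (v \<bullet> e N))
     = of_real (G v) * iexp (v \<bullet> (t *\<^sub>R e N)) +
       (of_real (G v) * iexp (v \<bullet> (t *\<^sub>R e N + c)) - of_real (G v) * iexp (v \<bullet> (t *\<^sub>R e N - c))) / (2 * \<i>)" for v
      unfolding pull iexp_sin_eq inner_add_right inner_diff_right inner_scaleR_right
      by (simp only: distrib_left right_diff_distrib times_divide_eq_right)
    then show ?thesis unfolding Let_def
      by (simp only: Bochner_Integration.integral_add Bochner_Integration.integral_diff
          Bochner_Integration.integrable_add Bochner_Integration.integrable_diff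
          integral_divide_zero integrable_divide i1[OF M] simp_thms)
  qed
  have nn: "0 \<le> 1 + cos x" "0 \<le> 1 + sin x" for x :: real
    using cos_ge_minus_one[of x] sin_ge_minus_one[of x] by linarith+
  have bd: "integrable M (\<lambda>v. G v * f v)"
    if "prob_space M" "sets M = sets borel" "f \<in> borel_measurable borel" "\<And>v. \<bar>f v\<bar> \<le> 2" for M :: "'h measure" and f
  proof -
    interpret prob_space M by fact
    note [measurable_cong] = that(2) and [measurable] = that(3)
    have "\<bar>G v * f v\<bar> \<le> 1 * 2" for v
      unfolding abs_mult by (intro mult_mono) (use Gb that(4) in auto)
    then show ?thesis by (intro integrable_const_bound[of _ 2]) auto
  qed
  have abs2: "\<bar>1 + cos x\<bar> \<le> 2" "\<bar>1 + sin x\<bar> \<le> 2" for x :: real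
    using nn[of x] cos_le_one[of x] sin_le_one[of x] by linarith+
  note bd2 = bd[OF \<open>prob_space \<mu>\<close> sets(1)] bd[OF \<open>prob_space \<nu>\<close> sets(2)]
  have W: "(\<integral>v. indicator (S N) (v \<bullet> e N) * (G v * (1 + cos (v \<bullet> c))) \<partial>\<mu>) =
           (\<integral>v. indicator (S N) (v \<bullet> e N) * (G v * (1 + cos (v \<bullet> c))) \<partial>\<nu>)"
          "(\<integral>v. indicator (S N) (v \<bullet> e N) * (G v * (1 + sin (v \<bullet> c))) \<partial>\<mu>) =
           (\<integral>v. indicator (S N) (v \<bullet> e N) * (G v * (1 + sin (v \<bullet> c))) \<partial>\<nu>)" for c
  proof (rule_tac [!] weighted_uniqueness)
    show "(CLINT v|\<mu>. of_real (G v * (1 + cos (v \<bullet> c))) * iexp (t * (v \<bullet> e N))) =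
          (CLINT v|\<nu>. of_real (G v * (1 + cos (v \<bullet> c))) * iexp (t * (v \<bullet> e N)))"
         "(CLINT v|\<mu>. of_real (G v * (1 + sin (v \<bullet> c))) * iexp (t * (v \<bullet> e N))) =
          (CLINT v|\<nu>. of_real (G v * (1 + sin (v \<bullet> c))) * iexp (t * (v \<bullet> e N)))" for t
      unfolding cosF[OF \<open>prob_space \<mu>\<close> sets(1)] cosF[OF \<open>prob_space \<nu>\<close> sets(2)]
        sinF[OF \<open>prob_space \<mu>\<close> sets(1)] sinF[OF \<open>prob_space \<nu>\<close> sets(2)] Let_def IH by simp_all
  qed (auto intro!: bd2 abs2 mult_nonneg_nonneg Gb nn)
  let ?I = "\<lambda>v. indicator (S N) (v \<bullet> e N) * G v :: real"
  have Ib: "0 \<le> ?I v" "?I v \<le> 1" for v using Gb[of v] by (auto simp: indicator_def)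
  have iI: "integrable M (\<lambda>v. ?I v * f v)"
    if "prob_space M" "sets M = sets borel" "f \<in> borel_measurable borel" "\<And>v. \<bar>f v\<bar> \<le> 1" for M :: "'h measure" and f
  proof -
    interpret prob_space M by fact
    note [measurable_cong] = that(2) and [measurable] = that(3)
    have "\<bar>?I v * f v\<bar> \<le> 1 * 1" for v
      unfolding abs_mult[of "?I v"] by (intro mult_mono) (use Ib that(4) in auto)
    then show ?thesis by (intro integrable_const_bound[of _ 1]) auto
  qed
  note iI2 = iI[OF \<open>prob_space \<mu>\<close> sets(1)] iI[OF \<open>prob_space \<nu>\<close> sets(2)]
  note iI1 = iI2(1)[of "\<lambda>_. 1", simplified] iI2(2)[of "\<lambda>_. 1", simplified]
  have one: "(\<integral>v. ?I v \<partial>\<mu>) = (\<integral>v. ?I v \<partial>\<nu>)"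
    using W(2)[of 0] by simp
  have cs: "(\<integral>v. ?I v * cos (v \<bullet> c) \<partial>\<mu>) = (\<integral>v. ?I v * cos (v \<bullet> c) \<partial>\<nu>)"
           "(\<integral>v. ?I v * sin (v \<bullet> c) \<partial>\<mu>) = (\<integral>v. ?I v * sin (v \<bullet> c) \<partial>\<nu>)"
  proof -
    have *: "indicator (S N) (v \<bullet> e N) * (G v * (1 + f v)) = ?I v + ?I v * f v" for f :: "'h \<Rightarrow> real" and v
      by (simp add: algebra_simps)
    show "(\<integral>v. ?I v * cos (v \<bullet> c) \<partial>\<mu>) = (\<integral>v. ?I v * cos (v \<bullet> c) \<partial>\<nu>)"
      using W(1)[of c] one unfolding *[of _ "\<lambda>v. cos (v \<bullet> c)"]
      by (simp add: iI1 iI2)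
    show "(\<integral>v. ?I v * sin (v \<bullet> c) \<partial>\<mu>) = (\<integral>v. ?I v * sin (v \<bullet> c) \<partial>\<nu>)"
      using W(2)[of c] one unfolding *[of _ "\<lambda>v. sin (v \<bullet> c)"]
      by (simp add: iI1 iI2)
  qed
  have split: "(CLINT v|M. of_real (\<Prod>k<Suc N. indicator (S k) (v \<bullet> e k)) * iexp (v \<bullet> c)) =
      of_real (\<integral>v. ?I v * cos (v \<bullet> c) \<partial>M) + \<i> * of_real (\<integral>v. ?I v * sin (v \<bullet> c) \<partial>M)"
    if M: "prob_space M" "sets M = sets borel" for M :: "'h measure"
  proof -
    have "of_real (\<Prod>k<Suc N. indicator (S k) (v \<bullet> e k)) * iexp (v \<bullet> c) =
       complex_of_real (?I v * cos (v \<bullet> c)) + \<i> * complex_of_real (?I v * sin (v \<bullet> c))" for v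
      by (simp add: G_def cis_conv_exp[symmetric] cis.ctr complex_eq_iff mult.commute)
    moreover have "integrable M (\<lambda>v. complex_of_real (?I v * cos (v \<bullet> c)))"
         "integrable M (\<lambda>v. \<i> * complex_of_real (?I v * sin (v \<bullet> c)))"
      by (intro integrable_of_real integrable_mult_right iI[OF M]; simp)+
    ultimately show ?thesis
      by (simp only: Bochner_Integration.integral_add integral_mult_right_zero integral_complex_of_real)
  qed
  show ?case unfolding split[OF \<open>prob_space \<mu>\<close> sets(1)] split[OF \<open>prob_space \<nu>\<close> sets(2)] cs ..
qed

text \<open>The identity map is the pointwise limit of the projections \<open>proj n\<close>, which are measurable with
  respect to the coordinates.\<close>

lemma borel_eq_sigma_boxes:
  "sets (borel :: 'h measure) =
     sigma_sets UNIV {{v. \<forall>k<N. v \<bullet> e k \<in> S k} | N S. \<forall>k. S k \<in> sets (borel :: real measure)}" (is "_ = sigma_sets UNIV ?B")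
proof
  let ?\<Sigma> = "sigma UNIV ?B"
  have s\<Sigma>: "sets ?\<Sigma> = sigma_sets UNIV ?B" "space ?\<Sigma> = UNIV" by auto
  have coord: "(\<lambda>v. v \<bullet> e k) \<in> borel_measurable ?\<Sigma>" for k
  proof (rule measurableI)
    fix A :: "real set" assume A: "A \<in> sets borel"
    have "(\<lambda>v. v \<bullet> e k) -` A = {v. \<forall>j<Suc k. v \<bullet> e j \<in> (if j = k then A else UNIV)}" by auto
    moreover have "\<dots> \<in> ?B" using A by (auto intro!: exI[of _ "Suc k"] exI[of _ "\<lambda>j. if j = k then A else UNIV"])
    ultimately show "(\<lambda>v. v \<bullet> e k) -` A \<inter> space ?\<Sigma> \<in> sets ?\<Sigma>" unfolding s\<Sigma> by auto
  qed simp
  have "(\<lambda>v. v) \<in> borel_measurable ?\<Sigma>"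
  proof (rule borel_measurable_LIMSEQ_metric[of "\<lambda>n v. proj n v"])
    show "(\<lambda>v. proj n v) \<in> borel_measurable ?\<Sigma>" for n
      unfolding proj_def using coord by (intro borel_measurable_sum borel_measurable_scaleR) auto
  qed (rule proj_tendsto)
  then show "sets (borel :: 'h measure) \<subseteq> sigma_sets UNIV ?B"
    using measurable_sets[of "\<lambda>v. v" ?\<Sigma> borel] s\<Sigma> by auto
  have "{v. \<forall>k<N. v \<bullet> e k \<in> S k} \<in> sets borel" if "\<And>k. S k \<in> sets (borel :: real measure)" for N and S
  proof -
    have [measurable]: "S k \<in> sets borel" for k by (rule that)
    show ?thesis by measurable
  qed
  then have "?B \<subseteq> sets (borel :: 'h measure)" by auto
  from sets.sigma_sets_subset[OF this] show "sigma_sets UNIV ?B \<subseteq> sets (borel :: 'h measure)" by simp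
qed

theorem char_fun_unique:
  fixes \<mu> \<nu> :: "'h measure"
  assumes \<mu>: "prob_space \<mu>" "sets \<mu> = sets borel" and \<nu>: "prob_space \<nu>" "sets \<nu> = sets borel"
    and eq: "\<And>c. char_fun \<mu> c = char_fun \<nu> c"
  shows "\<mu> = \<nu>"
proof -
  interpret \<mu>: prob_space \<mu> by fact
  interpret \<nu>: prob_space \<nu> by fact
  let ?B = "{{v. \<forall>k<N. v \<bullet> e k \<in> S k} | N S. \<forall>k. S k \<in> sets (borel :: real measure)} :: 'h set set"
  have int: "Int_stable ?B"
  proof (rule Int_stableI, clarify)
    fix N N' :: nat and S S' :: "nat \<Rightarrow> real set"
    assume S: "\<forall>k. S k \<in> sets borel" "\<forall>k. S' k \<in> sets borel"
    let ?T = "\<lambda>k. (if k < N then S k else UNIV) \<inter> (if k < N' then S' k else UNIV)"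
    have "{v :: 'h. \<forall>k<N. v \<bullet> e k \<in> S k} \<inter> {v. \<forall>k<N'. v \<bullet> e k \<in> S' k} = {v. \<forall>k<max N N'. v \<bullet> e k \<in> ?T k}"
    proof (rule set_eqI)
      fix v :: 'h
      have "v \<bullet> e k \<in> ?T k \<longleftrightarrow> (k < N \<longrightarrow> v \<bullet> e k \<in> S k) \<and> (k < N' \<longrightarrow> v \<bullet> e k \<in> S' k)" for k
        by simp
      then show "v \<in> {v. \<forall>k<N. v \<bullet> e k \<in> S k} \<inter> {v. \<forall>k<N'. v \<bullet> e k \<in> S' k} \<longleftrightarrow>
          v \<in> {v. \<forall>k<max N N'. v \<bullet> e k \<in> ?T k}"
        by (simp only: mem_Collect_eq Int_iff less_max_iff_disj) blast
    qed
    moreover have "?T k \<in> sets borel" for k using S by (intro sets.Int) (cases "k < N"; cases "k < N'"; simp)+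
    ultimately show "\<exists>N'' S''. {v :: 'h. \<forall>k<N. v \<bullet> e k \<in> S k} \<inter> {v. \<forall>k<N'. v \<bullet> e k \<in> S' k} =
        {v. \<forall>k<N''. v \<bullet> e k \<in> S'' k} \<and> (\<forall>k. S'' k \<in> sets borel)"
      by (intro exI[of _ "max N N'"] exI[of _ "?T"] conjI allI)
  qed
  have box: "emeasure \<mu> X = emeasure \<nu> X" if X_in: "X \<in> ?B" for X
  proof -
    obtain N S where X: "X = {v. \<forall>k<N. v \<bullet> e k \<in> S k}" and S': "\<forall>k. S k \<in> sets (borel :: real measure)"
      using X_in by blast
    note S = S'[rule_format]
    have ind: "(\<Prod>k<N. indicator (S k) (v \<bullet> e k)) = (indicator X v :: real)" for v
      unfolding X indicator_def by (cases "\<forall>k<N. v \<bullet> e k \<in> S k") auto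
    have XB: "X \<in> sets borel" unfolding borel_eq_sigma_boxes by (rule sigma_sets.Basic[OF X_in])
    have "complex_of_real (measure \<mu> X) = complex_of_real (measure \<nu> X)"
      using char_fun_box[where S = S and c = 0 and N = N, OF \<mu>(1) \<nu>(1) \<mu>(2) \<nu>(2) eq S, unfolded ind] XB
      by (simp add: \<mu>(2) \<nu>(2))
    then show ?thesis by (simp add: \<mu>.emeasure_eq_measure \<nu>.emeasure_eq_measure)
  qed
  show ?thesis
  proof (rule measure_eqI_generator_eq[OF int _ box, of UNIV "\<lambda>_. UNIV"])
    show "range (\<lambda>_::nat. UNIV) \<subseteq> ?B"
      by (auto intro!: exI[of _ "0::nat"] exI[of _ "\<lambda>_. UNIV"])
  qed (auto simp: \<mu>(2) \<nu>(2) borel_eq_sigma_boxes[symmetric] \<mu>.emeasure_finite)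
qed

end

section \<open>Gaussian series\<close>

lemma (in prob_space) distr_std_normal:
  "distributed M lborel X std_normal_density \<Longrightarrow> distr M borel X = std_normal_distribution"
proof -
  have "distr M borel X = distr M lborel X" by (rule distr_cong) auto
  then show "distributed M lborel X std_normal_density \<Longrightarrow> ?thesis" by (simp add: distributed_def)
qed

lemma (in prob_space) char_normal_scaled:
  assumes X: "distributed M lborel X (normal_density 0 s)" and s: "s > 0"
  shows "char (distr M borel (\<lambda>\<omega>. X \<omega> * a)) 1 = of_real (exp (- (s * a)\<^sup>2 / 2))"
proof -
  have [measurable]: "X \<in> borel_measurable M" using distributed_measurable[OF X] by simp
  have Y: "distributed M lborel (\<lambda>\<omega>. X \<omega> / s) std_normal_density"
    using X normal_standard_normal_convert[OF s, of X 0] by simp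
  have "char (distr M borel (\<lambda>\<omega>. X \<omega> * a)) 1 = char (distr M borel (\<lambda>\<omega>. X \<omega> / s)) (s * a)"
    using s by (simp add: char_def integral_distr mult.commute)
  then show ?thesis by (simp add: distr_std_normal[OF Y] char_std_normal_distribution)
qed

locale gaussian_sequence = prob_space M for M :: "'w measure" +
  fixes \<xi> :: "nat \<Rightarrow> 'w \<Rightarrow> real"
  assumes indep: "indep_vars (\<lambda>_. borel) \<xi> UNIV"
    and normal: "distributed M lborel (\<xi> p) std_normal_density"
begin

lemma rv[measurable]: "\<xi> p \<in> borel_measurable M"
  using distributed_measurable[OF normal[of p]] by simp

lemma distr_normal: "distr M borel (\<xi> p) = std_normal_distribution"
  by (rule distr_std_normal[OF normal])

lemma moments: "integrable M (\<xi> p)" "expectation (\<xi> p) = 0"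
    "integrable M (\<lambda>\<omega>. (\<xi> p \<omega>)\<^sup>2)" "expectation (\<lambda>\<omega>. (\<xi> p \<omega>)\<^sup>2) = 1"
proof -
  have i: "integrable (distr M borel (\<xi> p)) (\<lambda>x. x ^ k)" for k
    unfolding distr_normal by (rule integrable_std_normal_distribution_moment)
  show "integrable M (\<xi> p)" using i[of 1] by (simp add: integrable_distr_eq)
  show "integrable M (\<lambda>\<omega>. (\<xi> p \<omega>)\<^sup>2)" using i[of 2] by (simp add: integrable_distr_eq)
  have "integral\<^sup>L (distr M borel (\<xi> p)) (\<lambda>x. x ^ 1) = 0"
    unfolding distr_normal by (rule integral_std_normal_distribution_moment_odd) simp
  then show "expectation (\<xi> p) = 0" by (simp add: integral_distr)
  have "integral\<^sup>L (distr M borel (\<xi> p)) (\<lambda>x. x ^ (2 * 1)) = 1"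
    unfolding distr_normal std_normal_distribution_even_moments(1) by simp
  then show "expectation (\<lambda>\<omega>. (\<xi> p \<omega>)\<^sup>2) = 1" by (simp add: integral_distr)
qed

lemma char_scaled: "char (distr M borel (\<lambda>\<omega>. \<xi> p \<omega> * a)) 1 = of_real (exp (- a\<^sup>2 / 2))"
  using char_normal_scaled[of "\<xi> p" 1 a] normal by simp

lemma char_partial_sum:
  "(CLINT \<omega>|M. iexp (\<Sum>p<n. \<xi> p \<omega> * a p)) = of_real (exp (- (\<Sum>p<n. (a p)\<^sup>2) / 2))"
proof -
  have "indep_vars (\<lambda>_. borel) (\<lambda>p \<omega>. \<xi> p \<omega> * a p) {..<n}"
    by (rule indep_vars_compose2[OF indep_vars_subset[OF indep]]) auto
  from char_distr_sum[OF this, of 1]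
  have "(CLINT \<omega>|M. iexp (\<Sum>p<n. \<xi> p \<omega> * a p)) = (\<Prod>p<n. of_real (exp (- (a p)\<^sup>2 / 2)))"
    unfolding char_scaled by (simp add: char_def integral_distr)
  also have "\<dots> = of_real (exp (\<Sum>p<n. - (a p)\<^sup>2 / 2))" by (simp add: exp_sum)
  finally show ?thesis by (simp add: sum_negf sum_divide_distrib)
qed

end

text \<open>The partial sums of \<open>x j *\<^sub>R g j\<close> over \<open>m \<le> j < m + k\<close>, frozen from the moment at which their norm
  reaches \<open>\<epsilon>\<close>.\<close>

primrec stopped :: "real \<Rightarrow> (nat \<Rightarrow> 'h::real_inner) \<Rightarrow> nat \<Rightarrow> (nat \<Rightarrow> real) \<Rightarrow> nat \<Rightarrow> 'h" where
  "stopped \<epsilon> g m x 0 = 0"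
| "stopped \<epsilon> g m x (Suc k) =
     stopped \<epsilon> g m x k + (if norm (stopped \<epsilon> g m x k) < \<epsilon> then x (m + k) else 0) *\<^sub>R g (m + k)"

lemma stopped_cong: "(\<And>i. i < m + k \<Longrightarrow> x i = y i) \<Longrightarrow> stopped \<epsilon> g m x k = stopped \<epsilon> g m y k"
  by (induction k) auto

lemma stopped_eq_sum:
  "norm (stopped \<epsilon> g m x k) < \<epsilon> \<Longrightarrow> i \<le> k \<Longrightarrow>
     stopped \<epsilon> g m x i = (\<Sum>j=m..<m+i. x j *\<^sub>R g j) \<and> norm (stopped \<epsilon> g m x i) < \<epsilon>"
proof (induction k arbitrary: i)
  case (Suc k)
  have less: "norm (stopped \<epsilon> g m x k) < \<epsilon>"
    using Suc.prems(1) by (auto split: if_splits)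
  show ?case
  proof (cases "i = Suc k")
    case True
    then show ?thesis using Suc.IH[OF less order_refl] Suc.prems(1) less by simp
  next
    case False
    then show ?thesis using Suc.IH[OF less, of i] Suc.prems(2) by linarith
  qed
qed simp

lemma stopped_measurable:
  fixes g :: "nat \<Rightarrow> 'h::{real_inner, polish_space}"
  assumes "m + k \<le> n"
  shows "(\<lambda>x. stopped \<epsilon> g m x k) \<in> borel_measurable (PiM {..<n} (\<lambda>_. borel))"
  using assms
proof (induction k)
  case (Suc k)
  then have [measurable]: "(\<lambda>x. stopped \<epsilon> g m x k) \<in> borel_measurable (PiM {..<n} (\<lambda>_. borel))" by simp
  have [measurable]: "(\<lambda>x. x (m + k)) \<in> borel_measurable (PiM {..<n} (\<lambda>_. borel :: real measure))"
    using Suc.prems by (intro measurable_component_singleton) simp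
  show ?case by simp
qed simp

context gaussian_sequence
begin

lemma stopped_rv:
  fixes g :: "nat \<Rightarrow> 'h::{real_inner, polish_space}"
  shows "(\<lambda>\<omega>. stopped \<epsilon> g m (\<lambda>p. \<xi> p \<omega>) k) \<in> borel_measurable M"
  by (induction k) simp_all

text \<open>The stopped sum depends only on the variables before \<open>m + k\<close>, hence is independent of the centered
  variable \<open>\<xi> (m + k)\<close>.\<close>

lemma stopped_cross_term:
  fixes g :: "nat \<Rightarrow> 'h::{real_inner, polish_space}" and \<epsilon> :: real and m k :: nat
  assumes f[measurable]: "f \<in> borel_measurable borel" and b: "\<And>y. \<bar>f y\<bar> \<le> C"
  defines "Y \<equiv> \<lambda>\<omega>. stopped \<epsilon> g m (\<lambda>p. \<xi> p \<omega>) k"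
  shows "integrable M (\<lambda>\<omega>. f (Y \<omega>) * \<xi> (m + k) \<omega>)" "expectation (\<lambda>\<omega>. f (Y \<omega>) * \<xi> (m + k) \<omega>) = 0"
proof -
  have Y: "Y \<omega> = stopped \<epsilon> g m (restrict (\<lambda>p. \<xi> p \<omega>) {..<m+k}) k" for \<omega>
    unfolding Y_def by (rule stopped_cong) simp
  have [measurable]: "Y \<in> borel_measurable M" unfolding Y_def by (rule stopped_rv)
  have "indep_var borel ((\<lambda>x. f (stopped \<epsilon> g m x k)) \<circ> (\<lambda>\<omega>. restrict (\<lambda>p. \<xi> p \<omega>) {..<m+k}))
      borel ((\<lambda>x. x (m + k)) \<circ> (\<lambda>\<omega>. restrict (\<lambda>p. \<xi> p \<omega>) {m+k}))"
    by (rule indep_var_compose[OF indep_var_restrict[OF indep]])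
       (auto intro!: measurable_compose[OF stopped_measurable f] measurable_component_singleton)
  then have ind: "indep_var borel (\<lambda>\<omega>. f (Y \<omega>)) borel (\<xi> (m + k))"
    by (simp add: comp_def Y cong: if_cong)
  have int: "integrable M (\<lambda>\<omega>. f (Y \<omega>))"
    by (rule integrable_const_bound[of _ C]) (use b in auto)
  show "integrable M (\<lambda>\<omega>. f (Y \<omega>) * \<xi> (m + k) \<omega>)" "expectation (\<lambda>\<omega>. f (Y \<omega>) * \<xi> (m + k) \<omega>) = 0"
    using indep_var_integrable[OF ind int moments(1)] indep_var_lebesgue_integral[OF ind int moments(1)]
    by (simp_all add: moments(2))
qed

lemma stopped_second_moment:
  fixes g :: "nat \<Rightarrow> 'h::{real_inner, polish_space}" and \<epsilon> :: real and m k :: nat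
  assumes eps: "\<epsilon> > 0"
  defines "Y \<equiv> \<lambda>k \<omega>. stopped \<epsilon> g m (\<lambda>p. \<xi> p \<omega>) k"
  shows "integrable M (\<lambda>\<omega>. (norm (Y k \<omega>))\<^sup>2) \<and>
         expectation (\<lambda>\<omega>. (norm (Y k \<omega>))\<^sup>2) \<le> (\<Sum>j=m..<m+k. (norm (g j))\<^sup>2)"
proof (induction k)
  case 0
  then show ?case by (simp add: Y_def)
next
  case (Suc k)
  define f where "f y = (if norm y < \<epsilon> then y \<bullet> g (m + k) else 0)" for y :: 'h
  have [measurable]: "f \<in> borel_measurable borel" unfolding f_def by measurable
  have fb: "\<bar>f y\<bar> \<le> \<epsilon> * norm (g (m + k))" for y
  proof (cases "norm y < \<epsilon>")
    case True
    have "\<bar>f y\<bar> \<le> norm y * norm (g (m + k))" using True Cauchy_Schwarz_ineq2 by (simp add: f_def)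
    also have "\<dots> \<le> \<epsilon> * norm (g (m + k))" using True by (intro mult_right_mono) auto
    finally show ?thesis .
  qed (use eps in \<open>simp add: f_def\<close>)
  have [measurable]: "Y k \<in> borel_measurable M" for k unfolding Y_def by (rule stopped_rv)
  have cross: "integrable M (\<lambda>\<omega>. f (Y k \<omega>) * \<xi> (m + k) \<omega>)" "expectation (\<lambda>\<omega>. f (Y k \<omega>) * \<xi> (m + k) \<omega>) = 0"
    unfolding Y_def by (rule stopped_cross_term[OF _ fb], measurable)+
  define I where "I \<omega> = (if norm (Y k \<omega>) < \<epsilon> then (\<xi> (m + k) \<omega>)\<^sup>2 else 0)" for \<omega>
  have I: "integrable M I" unfolding I_def
    by (rule Bochner_Integration.integrable_bound[OF moments(3)[of "m + k"]]) auto
  have "expectation I \<le> expectation (\<lambda>\<omega>. (\<xi> (m + k) \<omega>)\<^sup>2)"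
    by (rule integral_mono[OF I moments(3)]) (auto simp: I_def)
  then have I1: "expectation I \<le> 1" by (simp add: moments(4))
  have eq: "(norm (Y (Suc k) \<omega>))\<^sup>2 =
      (norm (Y k \<omega>))\<^sup>2 + 2 * (f (Y k \<omega>) * \<xi> (m + k) \<omega>) + I \<omega> * (norm (g (m + k)))\<^sup>2" for \<omega>
    unfolding power2_norm_eq_inner Y_def stopped.simps f_def I_def
    by (auto simp: inner_add_left inner_add_right inner_commute power2_eq_square algebra_simps)
  have int: "integrable M (\<lambda>\<omega>. (norm (Y k \<omega>))\<^sup>2)" using Suc by simp
  note ints = int cross(1) I
  have "expectation (\<lambda>\<omega>. (norm (Y (Suc k) \<omega>))\<^sup>2) =
      expectation (\<lambda>\<omega>. (norm (Y k \<omega>))\<^sup>2) + expectation I * (norm (g (m + k)))\<^sup>2"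
    unfolding eq using ints cross(2) by simp
  also have "\<dots> \<le> (\<Sum>j=m..<m+k. (norm (g j))\<^sup>2) + 1 * (norm (g (m + k)))\<^sup>2"
    using Suc I1 by (intro add_mono mult_right_mono) auto
  finally have "expectation (\<lambda>\<omega>. (norm (Y (Suc k) \<omega>))\<^sup>2) \<le> (\<Sum>j=m..<m+Suc k. (norm (g j))\<^sup>2)" by simp
  moreover have "integrable M (\<lambda>\<omega>. (norm (Y (Suc k) \<omega>))\<^sup>2)"
    unfolding eq using ints by simp
  ultimately show ?case by simp
qed

text \<open>If the partial sums ever leave the ball of radius \<open>\<epsilon>\<close>, then the stopped sum stays outside from
  then on. So the Markov inequality for the last stopped sum bounds the whole maximum.\<close>

lemma maximal_inequality:
  fixes g :: "nat \<Rightarrow> 'h::{real_inner, polish_space}"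
  assumes eps: "\<epsilon> > 0" and g: "summable (\<lambda>p. (norm (g p))\<^sup>2)"
  shows "prob {\<omega>\<in>space M. \<exists>i. \<epsilon> \<le> norm (\<Sum>j=m..<m+i. \<xi> j \<omega> *\<^sub>R g j)} \<le> (\<Sum>j. (norm (g (m + j)))\<^sup>2) / \<epsilon>\<^sup>2"
proof -
  define E where "E k = {\<omega>\<in>space M. \<exists>i\<le>k. \<epsilon> \<le> norm (\<Sum>j=m..<m+i. \<xi> j \<omega> *\<^sub>R g j)}" for k
  have [measurable]: "E k \<in> sets M" for k unfolding E_def by measurable
  let ?Y = "\<lambda>k \<omega>. stopped \<epsilon> g m (\<lambda>p. \<xi> p \<omega>) k"
  have [measurable]: "?Y k \<in> borel_measurable M" for k by (rule stopped_rv)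
  have E: "prob (E k) \<le> (\<Sum>j. (norm (g (m + j)))\<^sup>2) / \<epsilon>\<^sup>2" for k
  proof -
    have sm: "summable (\<lambda>j. (norm (g (m + j)))\<^sup>2)" using summable_ignore_initial_segment[OF g, of m] by (simp add: add.commute)
    have "E k \<subseteq> {\<omega>\<in>space M. \<epsilon>\<^sup>2 \<le> (norm (?Y k \<omega>))\<^sup>2}"
    proof
      fix \<omega> assume "\<omega> \<in> E k"
      then obtain i where i: "i \<le> k" "\<epsilon> \<le> norm (\<Sum>j=m..<m+i. \<xi> j \<omega> *\<^sub>R g j)" and \<omega>: "\<omega> \<in> space M" by (auto simp: E_def)
      have "\<not> norm (?Y k \<omega>) < \<epsilon>"
        using stopped_eq_sum[OF _ i(1), of \<epsilon> g m "\<lambda>p. \<xi> p \<omega>"] i(2) by auto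
      then show "\<omega> \<in> {\<omega>\<in>space M. \<epsilon>\<^sup>2 \<le> (norm (?Y k \<omega>))\<^sup>2}" using \<omega> eps by simp
    qed
    then have "prob (E k) \<le> prob {\<omega>\<in>space M. \<epsilon>\<^sup>2 \<le> (norm (?Y k \<omega>))\<^sup>2}"
      by (intro finite_measure_mono) auto
    also have "\<dots> \<le> expectation (\<lambda>\<omega>. (norm (?Y k \<omega>))\<^sup>2) / \<epsilon>\<^sup>2"
      by (rule integral_Markov_inequality_measure[where A="{}"]) (use stopped_second_moment[OF eps, of g m k] eps in auto)
    also have "\<dots> \<le> (\<Sum>j=m..<m+k. (norm (g j))\<^sup>2) / \<epsilon>\<^sup>2"
      using stopped_second_moment[OF eps, of g m k] by (simp add: divide_right_mono)
    also have "(\<Sum>j=m..<m+k. (norm (g j))\<^sup>2) = (\<Sum>j<k. (norm (g (m + j)))\<^sup>2)"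
      using sum.shift_bounds_nat_ivl[of "\<lambda>j. (norm (g j))\<^sup>2" 0 m k] by (simp add: add.commute lessThan_atLeast0)
    also have "\<dots> / \<epsilon>\<^sup>2 \<le> (\<Sum>j. (norm (g (m + j)))\<^sup>2) / \<epsilon>\<^sup>2"
      by (intro divide_right_mono sum_le_suminf sm) auto
    finally show ?thesis .
  qed
  have "incseq E" unfolding E_def incseq_def by (auto intro: order_trans)
  from finite_Lim_measure_incseq[OF _ this]
  have "(\<lambda>k. prob (E k)) \<longlonglongrightarrow> prob (\<Union>k. E k)"
    using \<open>\<And>k. E k \<in> sets M\<close> by blast
  from LIMSEQ_le_const2[OF this] E
  have "prob (\<Union>k. E k) \<le> (\<Sum>j. (norm (g (m + j)))\<^sup>2) / \<epsilon>\<^sup>2" by auto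
  also have "(\<Union>k. E k) = {\<omega>\<in>space M. \<exists>i. \<epsilon> \<le> norm (\<Sum>j=m..<m+i. \<xi> j \<omega> *\<^sub>R g j)}"
    by (auto simp: E_def)
  finally show ?thesis .
qed

theorem series_converges_AE:
  fixes g :: "nat \<Rightarrow> 'h::{real_inner, polish_space}"
  assumes g: "summable (\<lambda>p. (norm (g p))\<^sup>2)"
  shows "AE \<omega> in M. summable (\<lambda>p. \<xi> p \<omega> *\<^sub>R g p)"
proof -
  have tail: "(\<lambda>m. (\<Sum>j. (norm (g (m + j)))\<^sup>2) / \<epsilon>\<^sup>2) \<longlonglongrightarrow> 0" for \<epsilon>
    using tendsto_divide[OF suminf_exist_split2[OF g] tendsto_const[of "\<epsilon>\<^sup>2"]]
    by (cases "\<epsilon> = 0") (auto simp: add.commute)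
  have ae: "AE \<omega> in M. \<exists>m. \<forall>i. norm (\<Sum>j=m..<m+i. \<xi> j \<omega> *\<^sub>R g j) < \<epsilon>" if "\<epsilon> > 0" for \<epsilon> :: real
  proof -
    let ?N = "{\<omega>\<in>space M. \<forall>m. \<exists>i. \<epsilon> \<le> norm (\<Sum>j=m..<m+i. \<xi> j \<omega> *\<^sub>R g j)}"
    have "prob ?N \<le> (\<Sum>j. (norm (g (m + j)))\<^sup>2) / \<epsilon>\<^sup>2" for m
      by (rule order_trans[OF finite_measure_mono maximal_inequality[OF that g, of m]]) auto
    from LIMSEQ_le_const[OF tail] this have "prob ?N \<le> 0" by auto
    then have "prob ?N = 0" using measure_nonneg[of M ?N] by linarith
    then have "emeasure M ?N = 0" by (simp add: emeasure_eq_measure)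
    moreover have "?N \<in> sets M" by measurable
    ultimately show ?thesis by (intro AE_I[of _ _ ?N]) (auto simp: not_less)
  qed
  have "AE \<omega> in M. \<forall>n. \<exists>m. \<forall>i. norm (\<Sum>j=m..<m+i. \<xi> j \<omega> *\<^sub>R g j) < inverse (real (Suc n))"
    unfolding AE_all_countable by (intro allI ae) simp
  then show ?thesis
  proof (eventually_elim)
    fix \<omega> assume *: "\<forall>n. \<exists>m. \<forall>i. norm (\<Sum>j=m..<m+i. \<xi> j \<omega> *\<^sub>R g j) < inverse (real (Suc n))"
    let ?S = "\<lambda>n. \<Sum>j<n. \<xi> j \<omega> *\<^sub>R g j"
    have "Cauchy ?S"
    proof (rule metric_CauchyI)
      fix r :: real assume "r > 0"
      then obtain n where n: "inverse (real (Suc n)) < r / 2" using reals_Archimedean half_gt_zero by blast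
      obtain m where m: "\<And>i. norm (\<Sum>j=m..<m+i. \<xi> j \<omega> *\<^sub>R g j) < inverse (real (Suc n))" using * by blast
      have d: "dist (?S k) (?S m) < r / 2" if "k \<ge> m" for k
      proof -
        have "?S k - ?S m = (\<Sum>j=m..<m+(k-m). \<xi> j \<omega> *\<^sub>R g j)"
          using that by (simp add: sum_diff_nat_ivl lessThan_atLeast0)
        then show ?thesis using m[of "k - m"] n unfolding dist_norm by (simp only:)
      qed
      show "\<exists>N. \<forall>k\<ge>N. \<forall>l\<ge>N. dist (?S k) (?S l) < r"
        by (intro exI[of _ m] allI impI) (rule dist_triangle_half_l[OF d d])
    qed
    then show "summable (\<lambda>p. \<xi> p \<omega> *\<^sub>R g p)"
      unfolding summable_iff_convergent by (rule Cauchy_convergent)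
  qed
qed

text \<open>Where the series diverges its value is an unspecified constant, which is harmless for
  measurability.\<close>

lemma series_measurable:
  fixes g :: "nat \<Rightarrow> 'h::{real_inner, polish_space}"
  shows "(\<lambda>\<omega>. \<Sum>p. \<xi> p \<omega> *\<^sub>R g p) \<in> borel_measurable M"
proof -
  let ?S = "\<lambda>\<omega> n. \<Sum>p<n. \<xi> p \<omega> *\<^sub>R g p"
  define u where "u \<omega> = lim (\<lambda>n. if Cauchy (?S \<omega>) then ?S \<omega> n else 0)" for \<omega>
  have eq: "(\<Sum>p. \<xi> p \<omega> *\<^sub>R g p) = (if Cauchy (?S \<omega>) then u \<omega> else (THE x. False))" for \<omega>
  proof (cases "Cauchy (?S \<omega>)")
    case True
    then show ?thesis by (simp add: u_def suminf_eq_lim)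
  next
    case False
    then have "\<not> convergent (?S \<omega>)" using convergent_Cauchy by blast
    then show ?thesis using False by (simp add: suminf_eq_lim lim_def convergent_def)
  qed
  have "u \<in> borel_measurable M"
  proof (rule borel_measurable_LIMSEQ_metric)
    fix \<omega>
    have "convergent (\<lambda>n. if Cauchy (?S \<omega>) then ?S \<omega> n else 0)"
      by (cases "Cauchy (?S \<omega>)") (auto intro: Cauchy_convergent convergent_const)
    then show "(\<lambda>n. if Cauchy (?S \<omega>) then ?S \<omega> n else 0) \<longlonglongrightarrow> u \<omega>"
      unfolding u_def by (rule convergent_LIMSEQ_iff[THEN iffD1])
  qed measurable
  then show ?thesis unfolding eq by measurable
qed

theorem series_char_fun:
  fixes g :: "nat \<Rightarrow> 'h::{real_inner, polish_space}"
  assumes g: "summable (\<lambda>p. (norm (g p))\<^sup>2)" and V: "(\<lambda>p. (g p \<bullet> c)\<^sup>2) sums V"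
  shows "(CLINT \<omega>|M. iexp ((\<Sum>p. \<xi> p \<omega> *\<^sub>R g p) \<bullet> c)) = of_real (exp (- V / 2))"
proof (rule LIMSEQ_unique)
  note [measurable] = series_measurable[of g]
  show "(\<lambda>n. CLINT \<omega>|M. iexp (\<Sum>p<n. \<xi> p \<omega> * (g p \<bullet> c))) \<longlonglongrightarrow> (CLINT \<omega>|M. iexp ((\<Sum>p. \<xi> p \<omega> *\<^sub>R g p) \<bullet> c))"
  proof (rule integral_dominated_convergence[where w = "\<lambda>_. 1"])
    show "AE \<omega> in M. (\<lambda>n. iexp (\<Sum>p<n. \<xi> p \<omega> * (g p \<bullet> c))) \<longlonglongrightarrow> iexp ((\<Sum>p. \<xi> p \<omega> *\<^sub>R g p) \<bullet> c)"
      using series_converges_AE[OF g]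
    proof eventually_elim
      fix \<omega> assume "summable (\<lambda>p. \<xi> p \<omega> *\<^sub>R g p)"
      from bounded_linear.sums[OF bounded_linear_inner_left summable_sums[OF this], of c]
      have "(\<lambda>n. \<Sum>p<n. \<xi> p \<omega> * (g p \<bullet> c)) \<longlonglongrightarrow> (\<Sum>p. \<xi> p \<omega> *\<^sub>R g p) \<bullet> c" by (simp add: sums_def)
      then show "(\<lambda>n. iexp (\<Sum>p<n. \<xi> p \<omega> * (g p \<bullet> c))) \<longlonglongrightarrow> iexp ((\<Sum>p. \<xi> p \<omega> *\<^sub>R g p) \<bullet> c)"
        by (intro tendsto_intros)
    qed
  qed auto
  show "(\<lambda>n. CLINT \<omega>|M. iexp (\<Sum>p<n. \<xi> p \<omega> * (g p \<bullet> c))) \<longlonglongrightarrow> of_real (exp (- V / 2))"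
    unfolding char_partial_sum using V unfolding sums_def by (intro tendsto_intros) auto
qed

end

section \<open>Invariant distributions of autoregressions\<close>

text \<open>Invariance in terms of random variables: the law of \<open>\<Phi> x\<close> is \<open>\<mu>\<close> again when \<open>x\<close> is drawn from \<open>\<mu>\<close>
  independently of the noise.\<close>

lemma invariant_distribution_eq_distr:
  fixes \<mu> :: "'x::topological_space measure"
  assumes M: "prob_space M" and inv: "invariant_distribution K \<mu>" and K: "\<And>x. K x = distr M borel (\<Phi> x)"
    and \<Phi>[measurable]: "(\<lambda>(x, \<omega>). \<Phi> x \<omega>) \<in> borel \<Otimes>\<^sub>M M \<rightarrow>\<^sub>M borel"
  shows "\<mu> = distr (\<mu> \<Otimes>\<^sub>M M) borel (\<lambda>(x, \<omega>). \<Phi> x \<omega>)"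
proof (rule measure_eqI)
  interpret M: prob_space M by fact
  have sets[measurable_cong]: "sets \<mu> = sets borel" using inv by (simp add: invariant_distribution_def)
  show "sets \<mu> = sets (distr (\<mu> \<Otimes>\<^sub>M M) borel (\<lambda>(x, \<omega>). \<Phi> x \<omega>))" by (simp add: sets)
  fix S assume "S \<in> sets \<mu>"
  then have S[measurable]: "S \<in> sets borel" by (simp add: sets)
  have space: "space \<mu> = UNIV" using sets_eq_imp_space_eq[OF sets] by simp
  have \<Phi>x[measurable]: "\<Phi> x \<in> M \<rightarrow>\<^sub>M borel" for x
    using measurable_compose[OF measurable_Pair1' \<Phi>, of x] by simp
  have "emeasure \<mu> S = (\<integral>\<^sup>+x. emeasure (K x) S \<partial>\<mu>)"
    using inv S by (auto simp: invariant_distribution_def)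
  also have "\<dots> = (\<integral>\<^sup>+x. emeasure M (Pair x -` ((\<lambda>(x, \<omega>). \<Phi> x \<omega>) -` S \<inter> space (\<mu> \<Otimes>\<^sub>M M))) \<partial>\<mu>)"
    by (intro nn_integral_cong) (auto simp: K emeasure_distr space_pair_measure space intro!: arg_cong[where f = "emeasure M"])
  also have "\<dots> = emeasure (\<mu> \<Otimes>\<^sub>M M) ((\<lambda>(x, \<omega>). \<Phi> x \<omega>) -` S \<inter> space (\<mu> \<Otimes>\<^sub>M M))"
    by (rule M.emeasure_pair_measure_alt[symmetric]) measurable
  also have "\<dots> = emeasure (distr (\<mu> \<Otimes>\<^sub>M M) borel (\<lambda>(x, \<omega>). \<Phi> x \<omega>)) S"
    by (simp add: emeasure_distr)
  finally show "emeasure \<mu> S = emeasure (distr (\<mu> \<Otimes>\<^sub>M M) borel (\<lambda>(x, \<omega>). \<Phi> x \<omega>)) S" .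
qed

lemma char_fun_sum_indep:
  fixes F :: "'x \<Rightarrow> 'h::{real_inner, polish_space}"
  assumes "prob_space \<mu>" "prob_space M"
    and [measurable]: "F \<in> borel_measurable \<mu>" "Z \<in> borel_measurable M"
  shows "(CLINT (x, \<omega>)|\<mu> \<Otimes>\<^sub>M M. iexp ((F x + Z \<omega>) \<bullet> c)) =
    (CLINT x|\<mu>. iexp (F x \<bullet> c)) * (CLINT \<omega>|M. iexp (Z \<omega> \<bullet> c))"
proof -
  interpret \<mu>: prob_space \<mu> by fact
  interpret M: prob_space M by fact
  interpret pair_prob_space \<mu> M ..
  have "integrable (\<mu> \<Otimes>\<^sub>M M) (\<lambda>(x, \<omega>). iexp ((F x + Z \<omega>) \<bullet> c))"
    by (rule integrable_const_bound[of _ 1]) auto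
  from integral_fst[OF this]
  have "(CLINT (x, \<omega>)|\<mu> \<Otimes>\<^sub>M M. iexp ((F x + Z \<omega>) \<bullet> c)) = (CLINT x|\<mu>. CLINT \<omega>|M. iexp ((F x + Z \<omega>) \<bullet> c))" ..
  also have "\<dots> = (CLINT x|\<mu>. iexp (F x \<bullet> c) * (CLINT \<omega>|M. iexp (Z \<omega> \<bullet> c)))"
    by (simp add: inner_add_left distrib_left exp_add)
  finally show ?thesis by simp
qed

lemma char_fun_distr:
  fixes f :: "'x \<Rightarrow> 'h::{real_inner, polish_space}"
  assumes [measurable]: "f \<in> borel_measurable M"
  shows "char_fun (distr M borel f) c = (CLINT x|M. iexp (f x \<bullet> c))"
  unfolding char_fun_def by (subst integral_distr) auto

lemma char_fun_tendsto:
  fixes \<nu> :: "'h::{real_inner, polish_space} measure"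
  assumes "prob_space \<nu>" and [measurable_cong]: "sets \<nu> = sets borel" and c: "c \<longlonglongrightarrow> d"
  shows "(\<lambda>n. char_fun \<nu> (c n)) \<longlonglongrightarrow> char_fun \<nu> d"
proof -
  interpret prob_space \<nu> by fact
  show ?thesis unfolding char_fun_def
    by (rule integral_dominated_convergence[where w = "\<lambda>_. 1"]) (auto intro!: tendsto_intros c)
qed

context hilbert_basis
begin

definition quad :: "(nat \<Rightarrow> real) \<Rightarrow> 'h \<Rightarrow> real" where
  "quad V c = (\<Sum>p. V p * (c \<bullet> e p)\<^sup>2)"

lemma quad_sums:
  assumes "\<And>p. \<bar>V p\<bar> \<le> K"
  shows "(\<lambda>p. V p * (c \<bullet> e p)\<^sup>2) sums quad V c"
proof -
  have "summable (\<lambda>p. V p * (c \<bullet> e p)\<^sup>2)"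
  proof (rule summable_comparison_test'[of "\<lambda>p. K * (c \<bullet> e p)\<^sup>2" 0])
    show "summable (\<lambda>p. K * (c \<bullet> e p)\<^sup>2)" using sums_summable[OF parseval_norm] by (rule summable_mult)
    show "norm (V p * (c \<bullet> e p)\<^sup>2) \<le> K * (c \<bullet> e p)\<^sup>2" for p
      using assms[of p] by (simp add: abs_mult mult_right_mono)
  qed
  then show ?thesis unfolding quad_def by (rule summable_sums)
qed

lemma quad_le:
  assumes V: "\<And>p. \<bar>V p\<bar> \<le> K"
  shows "\<bar>quad V c\<bar> \<le> K * (norm c)\<^sup>2"
proof -
  have s: "(\<lambda>p. K * (c \<bullet> e p)\<^sup>2) sums (K * (norm c)\<^sup>2)" by (intro sums_mult parseval_norm)
  have b: "V p * (c \<bullet> e p)\<^sup>2 \<le> K * (c \<bullet> e p)\<^sup>2" "- (K * (c \<bullet> e p)\<^sup>2) \<le> V p * (c \<bullet> e p)\<^sup>2" for p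
    using V[of p] mult_right_mono[of "V p" K "(c \<bullet> e p)\<^sup>2"] mult_right_mono[of "- K" "V p" "(c \<bullet> e p)\<^sup>2"]
    by (simp_all add: abs_le_iff)
  have "quad V c \<le> K * (norm c)\<^sup>2" by (rule sums_le[OF b(1) quad_sums[OF V] s])
  moreover have "- (K * (norm c)\<^sup>2) \<le> quad V c" by (rule sums_le[OF b(2) sums_minus[OF s] quad_sums[OF V]])
  ultimately show ?thesis by simp
qed

text \<open>The centered Gaussian measure with covariance operator \<open>diag V\<close>.\<close>

definition diag_gaussian :: "'h measure \<Rightarrow> (nat \<Rightarrow> real) \<Rightarrow> bool" where
  "diag_gaussian \<nu> V \<longleftrightarrow> prob_space \<nu> \<and> sets \<nu> = sets borel \<and>
     (\<forall>c. char_fun \<nu> c = of_real (exp (- quad V c / 2)))"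

lemma diag_gaussian_unique: "diag_gaussian \<mu> V \<Longrightarrow> diag_gaussian \<nu> V \<Longrightarrow> \<mu> = \<nu>"
  unfolding diag_gaussian_def by (intro char_fun_unique) auto

lemma stationary_variance_le:
  fixes R V :: "nat \<Rightarrow> real"
  assumes R: "\<And>p. \<bar>R p\<bar> \<le> r" "r < 1" and V: "\<And>p. \<bar>V p\<bar> \<le> K"
  shows "\<bar>V p / (1 - (R p)\<^sup>2)\<bar> \<le> K / (1 - r\<^sup>2)"
proof -
  have r0: "0 \<le> r" using R(1)[of 0] by linarith
  have r2: "0 < 1 - r\<^sup>2" using r0 R(2) by (simp add: power_less_one_iff abs_square_less_1)
  have Rr: "1 - r\<^sup>2 \<le> 1 - (R p)\<^sup>2"
    using R(1)[of p] r0 by (simp add: abs_le_square_iff[symmetric])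
  then have "0 < 1 - (R p)\<^sup>2" using r2 by linarith
  then have "\<bar>V p / (1 - (R p)\<^sup>2)\<bar> = \<bar>V p\<bar> / (1 - (R p)\<^sup>2)" by simp
  also have "\<dots> \<le> K / (1 - r\<^sup>2)" using V[of p] Rr r2 by (intro frac_le) auto
  finally show ?thesis .
qed

text \<open>The Gaussian functional with variances \<open>V p / (1 - (R p)\<^sup>2)\<close> solves the same functional equation and
  has no zeros. The quotient \<open>F\<close> of the two solutions is invariant under \<open>c \<mapsto> diag R c\<close> and continuous
  at \<open>0\<close>, so it equals its value \<open>1\<close> at \<open>0\<close>.\<close>

theorem autoregression_gaussian:
  assumes \<nu>: "prob_space \<nu>" "sets \<nu> = sets borel"
    and R: "\<And>p. \<bar>R p\<bar> \<le> r" "r < 1" and V: "\<And>p. \<bar>V p\<bar> \<le> K"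
    and step: "\<And>c. char_fun \<nu> c = char_fun \<nu> (diag R c) * of_real (exp (- quad V c / 2))"
  shows "diag_gaussian \<nu> (\<lambda>p. V p / (1 - (R p)\<^sup>2))"
proof -
  let ?W = "\<lambda>p. V p / (1 - (R p)\<^sup>2)"
  have Rn: "1 - (R p)\<^sup>2 \<noteq> 0" for p
    using R(1)[of p] R(2) by (simp add: power2_eq_1_iff abs_if split: if_splits)
  have r0: "0 \<le> r" using R(1)[of 0] by linarith
  note W = stationary_variance_le[of R r V K, OF R V]
  have quad_step: "quad ?W c = quad ?W (diag R c) + quad V c" for c
  proof -
    have "?W p * (diag R c \<bullet> e p)\<^sup>2 + V p * (c \<bullet> e p)\<^sup>2 = ?W p * (c \<bullet> e p)\<^sup>2" for p
    proof -
      have "?W p * (R p)\<^sup>2 + V p = ?W p" using Rn[of p] by (simp add: field_simps)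
      then show ?thesis
        unfolding diag_coord[of R r, OF R(1)] power_mult_distrib mult.assoc[symmetric] distrib_right[symmetric] by simp
    qed
    then have "(\<lambda>p. ?W p * (c \<bullet> e p)\<^sup>2) sums (quad ?W (diag R c) + quad V c)"
      using sums_add[OF quad_sums[of ?W, OF W, of "diag R c"] quad_sums[of V, OF V, of c]] by simp
    then show ?thesis unfolding quad_def[of ?W c] by (rule sums_unique[symmetric])
  qed
  define F where "F c = of_real (exp (quad ?W c / 2)) * char_fun \<nu> c" for c
  have F_step: "F (diag R c) = F c" for c
  proof -
    have "exp (quad ?W c / 2) * exp (- quad V c / 2) = exp (quad ?W (diag R c) / 2)"
      unfolding quad_step[of c] exp_add[symmetric] by (simp add: field_simps)
    from arg_cong[OF this, of complex_of_real]
    have "of_real (exp (quad ?W c / 2)) * of_real (exp (- quad V c / 2)) = complex_of_real (exp (quad ?W (diag R c) / 2))"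
      by (simp only: of_real_mult)
    then show ?thesis unfolding F_def step[of c] by (simp only: ac_simps)
  qed
  have F1: "F c = 1" for c
  proof -
    let ?c = "\<lambda>n. (diag R ^^ n) c"
    have "norm (?c n) \<le> r ^ n * norm c" for n
    proof (induction n)
      case (Suc n)
      have "norm (?c (Suc n)) \<le> r * norm (?c n)" using diag_norm_le[of R r, OF R(1)] by simp
      also have "\<dots> \<le> r * (r ^ n * norm c)" using Suc r0 by (rule mult_left_mono)
      finally show ?case by simp
    qed simp
    moreover have "(\<lambda>n. r ^ n * norm c) \<longlonglongrightarrow> 0 * norm c"
      using r0 R(2) by (intro tendsto_mult LIMSEQ_realpow_zero tendsto_const) auto
    ultimately have c0: "?c \<longlonglongrightarrow> 0" by (intro Lim_null_comparison[of ?c "\<lambda>n. r ^ n * norm c"]) auto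
    have "(\<lambda>n. K / (1 - r\<^sup>2) * (norm (?c n))\<^sup>2) \<longlonglongrightarrow> K / (1 - r\<^sup>2) * (norm (0::'h))\<^sup>2"
      by (intro tendsto_intros c0)
    then have "(\<lambda>n. quad ?W (?c n)) \<longlonglongrightarrow> 0"
      by (intro Lim_null_comparison[of "\<lambda>n. quad ?W (?c n)"]) (use quad_le[of ?W, OF W] in auto)
    then have "(\<lambda>n. F (?c n)) \<longlonglongrightarrow> of_real (exp (0 / 2)) * char_fun \<nu> 0"
      unfolding F_def by (intro tendsto_intros char_fun_tendsto[OF \<nu>] c0) auto
    moreover have "F (?c n) = F c" for n by (induction n) (simp_all add: F_step)
    moreover have "char_fun \<nu> 0 = 1"
      using prob_space.prob_space[OF \<nu>(1)] by (simp add: char_fun_def)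
    ultimately show ?thesis by (simp add: LIMSEQ_const_iff)
  qed
  have "char_fun \<nu> c = of_real (exp (- quad ?W c / 2))" for c
  proof -
    have "of_real (exp (- quad ?W c / 2)) * F c = char_fun \<nu> c"
      unfolding F_def mult.assoc[symmetric] of_real_mult[symmetric] exp_add[symmetric] by simp
    then show ?thesis using F1 by simp
  qed
  then show ?thesis unfolding diag_gaussian_def using \<nu> by blast
qed

end

section \<open>The linear equation, one mode at a time\<close>

text \<open>Riemann sum, with right end points, for the Stieltjes integral of \<open>exp (- a (1 - t))\<close> against \<open>f\<close>
  over the unit interval.\<close>

definition exp_sum :: "real \<Rightarrow> nat \<Rightarrow> (real \<Rightarrow> real) \<Rightarrow> real" where
  "exp_sum a n f = (\<Sum>i<n. exp (- a * (1 - real (Suc i) / n)) * (f (real (Suc i) / n) - f (real i / n)))"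

lemma integral_equation_continuous:
  fixes y :: "real \<Rightarrow> real"
  assumes cont: "continuous_on {0..} \<beta>"
    and int: "\<And>t. t \<ge> 0 \<Longrightarrow> set_integrable lborel {0..t} (\<lambda>r. - a * y r)"
    and eq: "\<And>t. t \<ge> 0 \<Longrightarrow> y t = x + (LINT r:{0..t}|lborel. - a * y r) + k * \<beta> t"
  shows "continuous_on {0..1} y"
    and "t \<in> {0..1} \<Longrightarrow> ((\<lambda>t. y t - k * \<beta> t) has_real_derivative - a * y t) (at t within {0..1})"
proof -
  have I: "(LINT r:{0..t}|lborel. - a * y r) = integral {0..t} (\<lambda>r. - a * y r)" if "t \<ge> 0" for t
    by (rule set_borel_integral_eq_integral(2)[OF int[OF that]])
  have yt: "y t - k * \<beta> t = x + integral {0..t} (\<lambda>r. - a * y r)" if "t \<in> {0..1}" for t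
    using eq[of t] I[of t] that by simp
  have "(\<lambda>r. - a * y r) integrable_on {0..1}" by (rule set_borel_integral_eq_integral(1)[OF int]) simp
  then have "continuous_on {0..1} (\<lambda>t. integral {0..t} (\<lambda>r. - a * y r))"
    by (rule indefinite_integral_continuous_1)
  then have "continuous_on {0..1} (\<lambda>t. (x + integral {0..t} (\<lambda>r. - a * y r)) + k * \<beta> t)"
    by (intro continuous_intros continuous_on_subset[OF cont]) auto
  then show y: "continuous_on {0..1} y"
    by (rule continuous_on_cong[THEN iffD1, rotated -1]) (use yt in \<open>auto simp: algebra_simps\<close>)
  assume t: "t \<in> {0..1}"
  have "((\<lambda>t. integral {0..t} (\<lambda>r. - a * y r)) has_real_derivative - a * y t) (at t within {0..1})"
    by (rule integral_has_real_derivative[OF _ t]) (intro continuous_intros y)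
  then have "((\<lambda>t. x + integral {0..t} (\<lambda>r. - a * y r)) has_real_derivative - a * y t) (at t within {0..1})"
    by (rule DERIV_cong[OF DERIV_add[OF DERIV_const]]) simp
  then show "((\<lambda>t. y t - k * \<beta> t) has_real_derivative - a * y t) (at t within {0..1})"
    by (rule has_field_derivative_transform_within[of _ _ _ _ 1]) (use yt t in auto)
qed

text \<open>For \<open>y' = - a y + k \<beta>'\<close> the function \<open>exp (- a (1 - t)) y t\<close> has the derivative
  \<open>k exp (- a (1 - t)) \<beta>'\<close>. The noise \<open>\<beta>\<close> is only continuous, so the increments of this function are
  compared with those of the Riemann sum interval by interval: the defect involves only the
  differentiable part \<open>w = y - k \<beta>\<close> and is of order \<open>\<epsilon> / n\<close> by uniform continuity of \<open>y\<close>. This avoids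
  stochastic integration.\<close>

lemma exp_sum_tendsto:
  fixes y :: "real \<Rightarrow> real"
  assumes a: "a > 0" and y: "continuous_on {0..1} y"
    and der: "\<And>t. t \<in> {0..1} \<Longrightarrow> ((\<lambda>t. y t - k * \<beta> t) has_real_derivative - a * y t) (at t within {0..1})"
  shows "(\<lambda>n. k * exp_sum a n \<beta>) \<longlonglongrightarrow> y 1 - exp (- a) * y 0"
proof -
  let ?E = "\<lambda>t. exp (- a * (1 - t))"
  define w where "w t = y t - k * \<beta> t" for t
  have E: "continuous_on {0..1} ?E" by (intro continuous_intros)
  obtain Y where Y': "\<forall>t\<in>{0..1}. \<bar>y t\<bar> \<le> Y" "Y > 0"
    using compact_imp_bounded[OF compact_continuous_image[OF y compact_Icc]] unfolding bounded_pos by auto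
  note Y = Y'(1)[rule_format] Y'(2)
  show ?thesis
  proof (rule metric_LIMSEQ_I)
    fix r :: real assume r: "r > 0"
    (* with this choice the n interval defects below add up to r / 2 *)
    define \<epsilon> where "\<epsilon> = r / (2 * a * (Y + 1))"
    have \<epsilon>: "\<epsilon> > 0" unfolding \<epsilon>_def using r a Y(2) by simp
    obtain d1 where d1: "d1 > 0" "\<And>s t. s \<in> {0..1} \<Longrightarrow> t \<in> {0..1} \<Longrightarrow> \<bar>t - s\<bar> < d1 \<Longrightarrow> \<bar>y t - y s\<bar> < \<epsilon>"
      using compact_uniformly_continuous[OF y compact_Icc] \<epsilon>
      unfolding uniformly_continuous_on_def dist_real_def by meson
    obtain d2 where d2: "d2 > 0" "\<And>s t. s \<in> {0..1} \<Longrightarrow> t \<in> {0..1} \<Longrightarrow> \<bar>t - s\<bar> < d2 \<Longrightarrow> \<bar>?E t - ?E s\<bar> < \<epsilon>"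
      using compact_uniformly_continuous[OF E compact_Icc] \<epsilon>
      unfolding uniformly_continuous_on_def dist_real_def by meson
    obtain N where N: "real N > 1 / min d1 d2" using reals_Archimedean2 by blast
    have Np: "real N > 0" using N d1(1) d2(1) by (smt (verit) min_def zero_less_divide_1_iff)
    have "dist (k * exp_sum a n \<beta>) (y 1 - exp (- a) * y 0) < r" if n: "n \<ge> N" for n
    proof -
      have np: "real n > 0" using n Np by linarith
      have "1 / min d1 d2 < real n" using N n by linarith
      moreover have "0 < min d1 d2" using d1(1) d2(1) by simp
      ultimately have "1 / real n < min d1 d2" using np by (simp only: divide_less_eq mult.commute split: if_split) simp
      then have inv: "1 / real n < d1" "1 / real n < d2" by simp_all
      let ?t = "\<lambda>i. real i / real n"
      have t01: "?t i \<in> {0..1}" if "i \<le> n" for i using that np by simp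
      have tS: "?t (Suc i) - ?t i = 1 / real n" for i by (simp add: diff_divide_distrib[symmetric])
      define \<Delta> where "\<Delta> i = ?E (?t (Suc i)) * (w (?t (Suc i)) - w (?t i)) + (?E (?t (Suc i)) - ?E (?t i)) * y (?t i)" for i
      have tele: "(\<Sum>i<n. ?E (?t (Suc i)) * y (?t (Suc i)) - ?E (?t i) * y (?t i)) = y 1 - exp (- a) * y 0"
        using sum_lessThan_telescope[of "\<lambda>i. ?E (?t i) * y (?t i)" n] np by simp
      have "\<Delta> i = (?E (?t (Suc i)) * y (?t (Suc i)) - ?E (?t i) * y (?t i))
          - k * (?E (?t (Suc i)) * (\<beta> (?t (Suc i)) - \<beta> (?t i)))" for i
        unfolding \<Delta>_def w_def by (simp add: algebra_simps)
      then have sum: "(\<Sum>i<n. \<Delta> i) = (y 1 - exp (- a) * y 0) - k * exp_sum a n \<beta>"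
        unfolding exp_sum_def tele[symmetric] sum_distrib_left sum_subtractf[symmetric] by simp
      have \<Delta>: "\<bar>\<Delta> i\<bar> \<le> (a * (Y + 1) * \<epsilon>) * (1 / n)" if i: "i < n" for i
      proof -
        let ?s = "?t i" and ?u = "?t (Suc i)"
        let ?f = "\<lambda>t. ?E ?u * w t + ?E t * y ?s"
        have su: "?s \<le> ?u" "?s \<in> {0..1}" "?u \<in> {0..1}" using i t01[of i] t01[of "Suc i"] np by (auto simp: divide_right_mono)
        have "norm (?f ?u - ?f ?s) \<le> (a * (Y + 1) * \<epsilon>) * norm (?u - ?s)"
        proof (rule field_differentiable_bound)
          fix t assume t: "t \<in> {?s..?u}"
          then have tt: "t \<in> {0..1}" "\<bar>t - ?s\<bar> < d1" "\<bar>?u - t\<bar> < d2" using su inv tS[of i] order_trans[of 0 ?s t] by auto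
          have "(w has_real_derivative - a * y t) (at t within {?s..?u})"
            unfolding w_def by (rule has_field_derivative_subset[OF der[OF tt(1)]]) (use su in auto)
          then show "(?f has_real_derivative (?E ?u * (- a * y t) + a * ?E t * y ?s)) (at t within {?s..?u})"
            by (auto intro!: derivative_eq_intros)
          have E1: "\<bar>?E t\<bar> \<le> 1" using a tt(1) by simp
          have "?E ?u * (- a * y t) + a * ?E t * y ?s = a * ((?E t - ?E ?u) * y t - ?E t * (y t - y ?s))"
            by (simp add: algebra_simps)
          also have "\<bar>\<dots>\<bar> \<le> a * (\<bar>?E t - ?E ?u\<bar> * \<bar>y t\<bar> + \<bar>?E t\<bar> * \<bar>y t - y ?s\<bar>)"
            using a by (auto simp: abs_mult intro!: mult_left_mono order_trans[OF abs_triangle_ineq4])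
          also have "\<dots> \<le> a * (\<epsilon> * Y + 1 * \<epsilon>)"
            using a d1(2)[OF su(2) tt(1)] d2(2)[OF tt(1) su(3)] tt Y(1)[OF tt(1)] E1 \<epsilon>
            by (intro mult_left_mono add_mono mult_mono) (auto simp: abs_minus_commute)
          finally show "norm (?E ?u * (- a * y t) + a * ?E t * y ?s) \<le> a * (Y + 1) * \<epsilon>"
            by (simp add: algebra_simps)
        qed (use su in auto)
        moreover have "E * (w1 - w0) + (E - F) * z = (E * w1 + E * z) - (E * w0 + F * z)" for E F w0 w1 z :: real
          by (simp add: algebra_simps)
        moreover have "norm (?u - ?s) = 1 / n" unfolding tS using np by simp
        ultimately show ?thesis unfolding \<Delta>_def by (simp only: real_norm_def)
      qed
      have "\<bar>\<Sum>i<n. \<Delta> i\<bar> \<le> (\<Sum>i<n. (a * (Y + 1) * \<epsilon>) * (1 / n))"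
        using \<Delta> by (intro order_trans[OF sum_abs] sum_mono) auto
      also have "\<dots> = a * (Y + 1) * \<epsilon>" using np by simp
      also have "\<dots> = r / 2"
      proof -
        have "a * (Y + 1) \<noteq> 0" using a Y(2) by simp
        moreover have "2 * a * (Y + 1) = 2 * (a * (Y + 1))" by simp
        ultimately show ?thesis unfolding \<epsilon>_def by (simp only: times_divide_eq_right) (simp del: mult_eq_0_iff)
      qed
      also have "\<dots> < r" using r by simp
      finally show ?thesis unfolding sum dist_real_def by (simp add: abs_minus_commute)
    qed
    then show "\<exists>N. \<forall>n\<ge>N. dist (k * exp_sum a n \<beta>) (y 1 - exp (- a) * y 0) < r" by blast
  qed
qed

text \<open>The squares form a geometric sum with ratio \<open>\<rho> = exp (- 2 a / n)\<close>. The limit is the variance of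
  the stochastic convolution at time 1.\<close>

lemma exp_sum_variance_tendsto:
  assumes a: "a > 0"
  shows "(\<lambda>n. \<Sum>i<n. (exp (- a * (1 - real (Suc i) / n)))\<^sup>2 / n) \<longlonglongrightarrow> (1 - exp (- 2 * a)) / (2 * a)"
proof (rule Lim_transform_eventually)
  show "(\<lambda>n. (1 - exp (- 2 * a)) / (real n * (1 - exp (- 2 * a / real n)))) \<longlonglongrightarrow> (1 - exp (- 2 * a)) / (2 * a)"
  proof -
    have "(\<lambda>n. (1 - exp (- (2 * a))) / (real n * (1 - exp (- (2 * a) / real n)))) \<longlonglongrightarrow> (1 - exp (- (2 * a))) * inverse a / 2"
      using a by real_asymp
    then show ?thesis by (simp add: field_simps)
  qed
  show "\<forall>\<^sub>F n in sequentially. (1 - exp (- 2 * a)) / (real n * (1 - exp (- 2 * a / real n))) =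
      (\<Sum>i<n. (exp (- a * (1 - real (Suc i) / n)))\<^sup>2 / n)"
    using eventually_gt_at_top[of 0]
  proof eventually_elim
    fix n :: nat assume n: "n > 0"
    define \<rho> where "\<rho> = exp (- 2 * a / real n)"
    have \<rho>: "\<rho> \<noteq> 1" "\<rho> ^ n = exp (- 2 * a)" unfolding \<rho>_def using n a by (simp_all flip: exp_of_nat_mult)
    have "(\<Sum>i<n. (exp (- a * (1 - real (Suc i) / n)))\<^sup>2) = (\<Sum>i<n. \<rho> ^ (n - Suc i))"
    proof (rule sum.cong)
      fix i assume i: "i \<in> {..<n}"
      have "(exp (- a * (1 - real (Suc i) / n)))\<^sup>2 = exp (real (n - Suc i) * (- 2 * a / real n))"
        using i n by (simp add: exp_double[symmetric] field_simps of_nat_diff)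
      then show "(exp (- a * (1 - real (Suc i) / n)))\<^sup>2 = \<rho> ^ (n - Suc i)"
        unfolding \<rho>_def by (simp only: exp_of_nat_mult)
    qed simp
    also have "\<dots> = (\<Sum>i<n. \<rho> ^ i)" by (rule sum.nat_diff_reindex)
    also have "\<dots> = (1 - exp (- 2 * a)) / (1 - \<rho>)" using \<rho> by (simp add: sum_gp_strict)
    finally show "(1 - exp (- 2 * a)) / (real n * (1 - exp (- 2 * a / real n))) =
      (\<Sum>i<n. (exp (- a * (1 - real (Suc i) / n)))\<^sup>2 / n)"
      by (simp add: sum_divide_distrib[symmetric] \<rho>_def mult.commute)
  qed
qed

lemma exp_sum_char:
  assumes W: "standard_wiener M \<beta>" and n: "n > 0"
  shows "char (distr M borel (\<lambda>\<omega>. exp_sum a n (\<lambda>t. \<beta> t \<omega>) * d)) 1 =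
    of_real (exp (- (d\<^sup>2 * (\<Sum>i<n. (exp (- a * (1 - real (Suc i) / n)))\<^sup>2 / n)) / 2))"
proof -
  interpret prob_space M using W by (simp add: standard_wiener_def)
  let ?X = "\<lambda>i \<omega>. \<beta> (real (Suc i) / n) \<omega> - \<beta> (real i / n) \<omega>"
  let ?c = "\<lambda>i. exp (- a * (1 - real (Suc i) / n)) * d"
  have "mono (\<lambda>i. real i / real n)" by (auto intro!: monoI divide_right_mono)
  then have ind: "indep_vars (\<lambda>_. borel) ?X {..<n}"
  proof -
    have "\<forall>n (t :: nat \<Rightarrow> real). 0 \<le> t 0 \<longrightarrow> mono t \<longrightarrow>
        indep_vars (\<lambda>_. borel) (\<lambda>i \<omega>. \<beta> (t (Suc i)) \<omega> - \<beta> (t i) \<omega>) {..<n}"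
      using W unfolding standard_wiener_def by blast
    from this[rule_format, of "\<lambda>i. real i / real n" n] \<open>mono _\<close> show ?thesis by simp
  qed
  have ind': "indep_vars (\<lambda>_. borel) (\<lambda>i \<omega>. ?X i \<omega> * ?c i) {..<n}"
    by (rule indep_vars_compose2[OF ind]) auto
  have normal: "distributed M lborel (?X i) (normal_density 0 (sqrt (1 / n)))" for i
  proof -
    have "real (Suc i) / n - real i / n = 1 / n" by (simp add: diff_divide_distrib[symmetric])
    moreover have "0 \<le> real i / n" "real i / n < real (Suc i) / n" using n by (auto intro: divide_strict_right_mono)
    ultimately show ?thesis using W unfolding standard_wiener_def by metis
  qed
  have "(\<lambda>\<omega>. exp_sum a n (\<lambda>t. \<beta> t \<omega>) * d) = (\<lambda>\<omega>. \<Sum>i<n. ?X i \<omega> * ?c i)"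
    unfolding exp_sum_def sum_distrib_right by (intro ext sum.cong refl) (simp only: mult_ac)
  then have "char (distr M borel (\<lambda>\<omega>. exp_sum a n (\<lambda>t. \<beta> t \<omega>) * d)) 1
      = (\<Prod>i<n. char (distr M borel (\<lambda>\<omega>. ?X i \<omega> * ?c i)) 1)"
    using char_distr_sum[OF ind', of 1] by simp
  also have "\<dots> = (\<Prod>i<n. of_real (exp (- (sqrt (1 / n) * ?c i)\<^sup>2 / 2)))"
    using n by (intro prod.cong char_normal_scaled normal) auto
  also have "\<dots> = of_real (exp (\<Sum>i<n. - (sqrt (1 / n) * ?c i)\<^sup>2 / 2))" by (simp add: exp_sum)
  also have "(\<Sum>i<n. - (sqrt (1 / n) * ?c i)\<^sup>2 / 2)
      = - (d\<^sup>2 * (\<Sum>i<n. (exp (- a * (1 - real (Suc i) / n)))\<^sup>2 / n)) / 2"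
    unfolding sum_distrib_left sum_negf[symmetric] sum_divide_distrib
    by (intro sum.cong refl) (simp add: power_mult_distrib field_simps)
  finally show ?thesis .
qed

lemma exp_sum_family_char:
  assumes W: "indep_wiener_family M \<beta>" and n: "n > 0"
  shows "(CLINT \<omega>|M. iexp (\<Sum>p<N. exp_sum (a p) n (\<lambda>t. \<beta> p t \<omega>) * d p)) =
    of_real (exp (- (\<Sum>p<N. (d p)\<^sup>2 * (\<Sum>i<n. (exp (- a p * (1 - real (Suc i) / n)))\<^sup>2 / n)) / 2))"
proof -
  have Wp: "standard_wiener M (\<beta> p)" for p using W by (simp add: indep_wiener_family_def)
  interpret prob_space M using Wp[of 0] by (simp add: standard_wiener_def)
  let ?X = "\<lambda>p \<omega>. exp_sum (a p) n (\<lambda>t. \<beta> p t \<omega>) * d p"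
  have ind: "indep_vars (\<lambda>_. PiM {0..} (\<lambda>_. borel)) (\<lambda>p \<omega>. \<lambda>t\<in>{0..}. \<beta> p t \<omega>) {..<N}"
    using W indep_vars_subset unfolding indep_wiener_family_def by blast
  have meas: "(\<lambda>f. exp_sum (a p) n f * d p) \<in> borel_measurable (PiM {0..} (\<lambda>_. borel))" for p
    unfolding exp_sum_def
    by (intro borel_measurable_times borel_measurable_sum borel_measurable_diff borel_measurable_const
        measurable_component_singleton) auto
  have "indep_vars (\<lambda>_. borel) (\<lambda>p \<omega>. exp_sum (a p) n (\<lambda>t\<in>{0..}. \<beta> p t \<omega>) * d p) {..<N}"
    by (rule indep_vars_compose2[OF ind]) (rule meas)
  then have ind': "indep_vars (\<lambda>_. borel) ?X {..<N}"
    by (simp add: exp_sum_def)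
  have [measurable]: "?X p \<in> borel_measurable M" if "p < N" for p
    using ind' that unfolding indep_vars_def by auto
  have "(CLINT \<omega>|M. iexp (\<Sum>p<N. ?X p \<omega>)) = char (distr M borel (\<lambda>\<omega>. \<Sum>p<N. ?X p \<omega>)) 1"
    unfolding char_def by (subst integral_distr) auto
  also have "\<dots> = (\<Prod>p<N. of_real (exp (- ((d p)\<^sup>2 * (\<Sum>i<n. (exp (- a p * (1 - real (Suc i) / n)))\<^sup>2 / n)) / 2)))"
    unfolding char_distr_sum[OF ind'] by (intro prod.cong refl exp_sum_char Wp n)
  also have "\<dots> = of_real (exp (\<Sum>p<N. - ((d p)\<^sup>2 * (\<Sum>i<n. (exp (- a p * (1 - real (Suc i) / n)))\<^sup>2 / n)) / 2))"
    by (simp add: exp_sum)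
  finally show ?thesis by (simp only: sum_negf sum_divide_distrib minus_divide_left[symmetric])
qed

text \<open>Finitely many modes of the solution are limits of sums of independent normal increments:
  different processes are independent, and so are the increments of each of them.\<close>

lemma modes_char:
  assumes W: "indep_wiener_family M \<beta>" and a: "\<And>p. a p > 0"
    and Z[measurable]: "\<And>p. Z p \<in> borel_measurable M"
    and lim: "\<And>p. AE \<omega> in M. (\<lambda>n. d p * exp_sum (a p) n (\<lambda>t. \<beta> p t \<omega>)) \<longlonglongrightarrow> Z p \<omega>"
  shows "(CLINT \<omega>|M. iexp (\<Sum>p<N. Z p \<omega>)) =
    of_real (exp (- (\<Sum>p<N. (d p)\<^sup>2 * ((1 - exp (- 2 * a p)) / (2 * a p))) / 2))"
proof (rule LIMSEQ_unique)
  have Wp: "standard_wiener M (\<beta> p)" for p using W by (simp add: indep_wiener_family_def)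
  interpret prob_space M using Wp[of 0] by (simp add: standard_wiener_def)
  have [measurable]: "\<beta> p t \<in> borel_measurable M" if "t \<ge> 0" for p t
    using Wp[of p] that by (simp add: standard_wiener_def)
  have [measurable]: "(\<lambda>\<omega>. exp_sum (a p) n (\<lambda>t. \<beta> p t \<omega>)) \<in> borel_measurable M" for p n
    unfolding exp_sum_def by measurable
  have "AE \<omega> in M. \<forall>p. (\<lambda>n. d p * exp_sum (a p) n (\<lambda>t. \<beta> p t \<omega>)) \<longlonglongrightarrow> Z p \<omega>"
    unfolding AE_all_countable by (intro allI lim)
  then have "AE \<omega> in M. (\<lambda>n. iexp (\<Sum>p<N. exp_sum (a p) n (\<lambda>t. \<beta> p t \<omega>) * d p)) \<longlonglongrightarrow> iexp (\<Sum>p<N. Z p \<omega>)"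
  proof eventually_elim
    case (elim \<omega>)
    then have "(\<lambda>n. \<Sum>p<N. exp_sum (a p) n (\<lambda>t. \<beta> p t \<omega>) * d p) \<longlonglongrightarrow> (\<Sum>p<N. Z p \<omega>)"
      by (intro tendsto_sum) (simp add: mult.commute)
    then show ?case by (intro tendsto_exp tendsto_mult tendsto_const tendsto_of_real)
  qed
  then show "(\<lambda>n. CLINT \<omega>|M. iexp (\<Sum>p<N. exp_sum (a p) n (\<lambda>t. \<beta> p t \<omega>) * d p)) \<longlonglongrightarrow> (CLINT \<omega>|M. iexp (\<Sum>p<N. Z p \<omega>))"
    by (intro integral_dominated_convergence[where w = "\<lambda>_. 1"]) auto
  have "(\<lambda>n. complex_of_real (exp (- (\<Sum>p<N. (d p)\<^sup>2 * (\<Sum>i<n. (exp (- a p * (1 - real (Suc i) / n)))\<^sup>2 / n)) / 2)))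
      \<longlonglongrightarrow> of_real (exp (- (\<Sum>p<N. (d p)\<^sup>2 * ((1 - exp (- 2 * a p)) / (2 * a p))) / 2))"
    by (intro tendsto_intros exp_sum_variance_tendsto a) auto
  then show "(\<lambda>n. CLINT \<omega>|M. iexp (\<Sum>p<N. exp_sum (a p) n (\<lambda>t. \<beta> p t \<omega>) * d p)) \<longlonglongrightarrow>
      of_real (exp (- (\<Sum>p<N. (d p)\<^sup>2 * ((1 - exp (- 2 * a p)) / (2 * a p))) / 2))"
    by (rule Lim_transform_eventually)
       (auto intro!: eventually_mono[OF eventually_gt_at_top[of 0]] simp only: exp_sum_family_char[OF W])
qed

sublocale spde_setting \<subseteq> hilbert_basis e
  by unfold_locales (rule orthonormal, rule complete)

context spde_setting
begin

lemma lam_ge: "lam 0 \<le> lam p"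
  using lam_mono by (simp add: monoD)

text \<open>Testing the weak formulation with the eigenvector \<open>e p\<close> gives a scalar linear equation driven by
  \<open>\<beta> p\<close> alone.\<close>

lemma mode_limit:
  assumes W: "indep_wiener_family M \<beta>"
    and B: "bounded_linear B" "\<And>p. B (e p) = - (b p *\<^sub>R e p)" and a: "lam p + b p > 0"
    and sol: "weak_solution M D A B \<sigma> (wiener_pairing q e \<beta>) x u"
  shows "AE \<omega> in M. (\<lambda>n. (\<sigma> * sqrt (q p)) * exp_sum (lam p + b p) n (\<lambda>t. \<beta> p t \<omega>))
    \<longlonglongrightarrow> u 1 \<omega> \<bullet> e p - exp (- (lam p + b p)) * (x \<bullet> e p)"
proof -
  let ?a = "lam p + b p"
  have B_coord: "B v \<bullet> e p = - b p * (v \<bullet> e p)" for v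
    by (rule eigen_coord[OF B(1)]) (simp add: B(2))
  have drift: "u r \<omega> \<bullet> A (e p) + B (u r \<omega>) \<bullet> e p = - ?a * (u r \<omega> \<bullet> e p)" for r \<omega>
    by (simp add: A_eigen B_coord algebra_simps)
  have pairing: "wiener_pairing q e \<beta> t (e p) \<omega> = sqrt (q p) * \<beta> p t \<omega>" for t \<omega>
    unfolding wiener_pairing_def orthonormal
    using sums_unique[OF sums_single[of p "\<lambda>p. sqrt (q p) * \<beta> p t \<omega>"]]
    by (simp add: if_distrib[of "\<lambda>x. _ * x"] cong: if_cong)
  have "AE \<omega> in M. \<forall>t\<ge>0. set_integrable lborel {0..t} (\<lambda>r. u r \<omega> \<bullet> A (e p) + B (u r \<omega>) \<bullet> e p) \<and>
      u t \<omega> \<bullet> e p = x \<bullet> e p + (LINT r:{0..t}|lborel. u r \<omega> \<bullet> A (e p) + B (u r \<omega>) \<bullet> e p)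
        + \<sigma> * wiener_pairing q e \<beta> t (e p) \<omega>"
    using sol e_in_dom[of p] unfolding weak_solution_def by blast
  moreover have "AE \<omega> in M. \<beta> p 0 \<omega> = 0" "AE \<omega> in M. continuous_on {0..} (\<lambda>t. \<beta> p t \<omega>)"
    using W unfolding indep_wiener_family_def standard_wiener_def by blast+
  ultimately show ?thesis
  proof eventually_elim
    case (elim \<omega>)
    let ?y = "\<lambda>t. u t \<omega> \<bullet> e p" and ?k = "\<sigma> * sqrt (q p)"
    note eq = elim(1)[unfolded drift pairing mult.assoc[symmetric, of \<sigma>], rule_format]
    note y = integral_equation_continuous[of "\<lambda>t. \<beta> p t \<omega>" ?a ?y "x \<bullet> e p" ?k, OF elim(3)]
    have "?y 0 = x \<bullet> e p"
    proof -
      have "(LINT r:{0..0}|lborel. - ?a * ?y r) = 0"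
        unfolding set_lebesgue_integral_def
        by (rule integral_eq_zero_AE) (use AE_lborel_singleton[of 0] in eventually_elim, simp)
      then show ?thesis using eq[of 0] elim(2) by simp
    qed
    moreover have "(\<lambda>n. ?k * exp_sum ?a n (\<lambda>t. \<beta> p t \<omega>)) \<longlonglongrightarrow> ?y 1 - exp (- ?a) * ?y 0"
      using eq by (intro exp_sum_tendsto a y) auto
    ultimately show ?case by simp
  qed
qed

end

context spde_setting
begin

lemma q_bdd: "\<exists>K. \<forall>p. \<bar>q p\<bar> \<le> K"
  using q_bounded unfolding bounded_iff by auto

lemma solution_char_fun:
  assumes W: "indep_wiener_family M \<beta>"
    and B: "bounded_linear B" "\<And>p. B (e p) = - (b p *\<^sub>R e p)" and a: "\<And>p. lam p + b p > 0"
    and sol: "weak_solution M D A B \<sigma> (wiener_pairing q e \<beta>) x u"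
    and V: "\<And>p. \<bar>\<sigma>\<^sup>2 * q p * ((1 - exp (- 2 * (lam p + b p))) / (2 * (lam p + b p)))\<bar> \<le> K"
  shows "(CLINT \<omega>|M. iexp (u 1 \<omega> \<bullet> c)) = iexp (diag (\<lambda>p. exp (- (lam p + b p))) x \<bullet> c) *
    of_real (exp (- quad (\<lambda>p. \<sigma>\<^sup>2 * q p * ((1 - exp (- 2 * (lam p + b p))) / (2 * (lam p + b p)))) c / 2))"
proof -
  let ?a = "\<lambda>p. lam p + b p"
  let ?S = "\<lambda>p. exp (- ?a p)"
  let ?V = "\<lambda>p. \<sigma>\<^sup>2 * q p * ((1 - exp (- 2 * ?a p)) / (2 * ?a p))"
  interpret prob_space M using W by (auto simp: indep_wiener_family_def standard_wiener_def)
  have u[measurable]: "u 1 \<in> borel_measurable M" using sol by (simp add: weak_solution_def)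
  define Z where "Z p \<omega> = (c \<bullet> e p) * (u 1 \<omega> \<bullet> e p - ?S p * (x \<bullet> e p))" for p \<omega>
  have [measurable]: "Z p \<in> borel_measurable M" for p unfolding Z_def by measurable
  have S1: "\<bar>?S p\<bar> \<le> 1" for p using a[of p] by simp
  have Zlim: "AE \<omega> in M. (\<lambda>n. ((c \<bullet> e p) * (\<sigma> * sqrt (q p))) * exp_sum (?a p) n (\<lambda>t. \<beta> p t \<omega>)) \<longlonglongrightarrow> Z p \<omega>" for p
    using mode_limit[OF W B a sol, of p]
  proof eventually_elim
    case (elim \<omega>)
    from tendsto_mult[OF tendsto_const[of "c \<bullet> e p"] elim] show ?case by (simp only: Z_def mult.assoc)
  qed
  have fin: "(CLINT \<omega>|M. iexp (\<Sum>p<N. Z p \<omega>)) = of_real (exp (- (\<Sum>p<N. ?V p * (c \<bullet> e p)\<^sup>2) / 2))" for N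
  proof -
    have "((c \<bullet> e p) * (\<sigma> * sqrt (q p)))\<^sup>2 * ((1 - exp (- 2 * ?a p)) / (2 * ?a p)) = ?V p * (c \<bullet> e p)\<^sup>2" for p
      using q_nonneg[of p] by (simp only: power_mult_distrib real_sqrt_pow2 ac_simps)
    moreover have "(CLINT \<omega>|M. iexp (\<Sum>p<N. Z p \<omega>)) = of_real (exp (- (\<Sum>p<N.
        ((c \<bullet> e p) * (\<sigma> * sqrt (q p)))\<^sup>2 * ((1 - exp (- 2 * ?a p)) / (2 * ?a p))) / 2))"
      by (rule modes_char[OF W a _ Zlim]) measurable
    ultimately show ?thesis by (simp only:)
  qed
  have "(CLINT \<omega>|M. iexp ((u 1 \<omega> - diag ?S x) \<bullet> c)) = of_real (exp (- quad ?V c / 2))"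
  proof (rule LIMSEQ_unique)
    show "(\<lambda>N. CLINT \<omega>|M. iexp (\<Sum>p<N. Z p \<omega>)) \<longlonglongrightarrow> (CLINT \<omega>|M. iexp ((u 1 \<omega> - diag ?S x) \<bullet> c))"
    proof (rule integral_dominated_convergence[where w = "\<lambda>_. 1"])
      have "(\<lambda>p. Z p \<omega>) sums ((u 1 \<omega> - diag ?S x) \<bullet> c)" for \<omega>
        using parseval[of "u 1 \<omega> - diag ?S x" c] diag_coord[of ?S 1 x, OF S1]
        by (simp add: Z_def inner_diff_left mult.commute)
      then show "AE \<omega> in M. (\<lambda>N. iexp (\<Sum>p<N. Z p \<omega>)) \<longlonglongrightarrow> iexp ((u 1 \<omega> - diag ?S x) \<bullet> c)"
        unfolding sums_def by (intro AE_I2 tendsto_exp tendsto_mult tendsto_const tendsto_of_real) simp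
    qed auto
    show "(\<lambda>N. CLINT \<omega>|M. iexp (\<Sum>p<N. Z p \<omega>)) \<longlonglongrightarrow> of_real (exp (- quad ?V c / 2))"
      unfolding fin using quad_sums[of ?V, OF V, of c] unfolding sums_def
      by (intro tendsto_of_real tendsto_exp tendsto_divide tendsto_minus tendsto_const) auto
  qed
  moreover have "iexp (u 1 \<omega> \<bullet> c) = iexp (diag ?S x \<bullet> c) * iexp ((u 1 \<omega> - diag ?S x) \<bullet> c)" for \<omega>
    unfolding exp_add[symmetric] distrib_left[symmetric] of_real_add[symmetric] inner_add_left[symmetric] by simp
  ultimately show ?thesis by simp
qed

text \<open>Invariance is used at time 1 only. The given solutions for different initial values are not
  assumed to depend measurably on \<open>x\<close>; but their laws agree with those of \<open>S x + u 0 1\<close>, which is jointly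
  measurable.\<close>

theorem spde_invariant_gaussian:
  assumes W: "indep_wiener_family M \<beta>"
    and B: "bounded_linear B" "\<And>p. B (e p) = - (b p *\<^sub>R e p)" and b: "\<And>p. \<bar>b p\<bar> \<le> L" "L < lam 0"
    and sol: "\<And>x. weak_solution M D A B \<sigma> (wiener_pairing q e \<beta>) x (u x)"
    and inv: "spde_invariant M u \<mu>"
  shows "diag_gaussian \<mu> (\<lambda>p. \<sigma>\<^sup>2 * q p / (2 * (lam p + b p)))"
proof -
  let ?a = "\<lambda>p. lam p + b p"
  let ?S = "\<lambda>p. exp (- ?a p)"
  let ?V = "\<lambda>p. \<sigma>\<^sup>2 * q p * ((1 - exp (- 2 * ?a p)) / (2 * ?a p))"
  interpret prob_space M using W by (auto simp: indep_wiener_family_def standard_wiener_def)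
  define \<delta> where "\<delta> = lam 0 - L"
  have \<delta>: "\<delta> > 0" "?a p \<ge> \<delta>" for p using b(1)[of p] b(2) lam_ge[of p] unfolding \<delta>_def by auto
  have a: "?a p > 0" for p using \<delta>(1) \<delta>(2)[of p] by linarith
  obtain Kq where Kq: "\<And>p. \<bar>q p\<bar> \<le> Kq" using q_bdd by blast
  have V: "\<bar>?V p\<bar> \<le> \<sigma>\<^sup>2 * Kq * (1 / (2 * \<delta>))" for p
  proof -
    have "0 \<le> (1 - exp (- 2 * ?a p)) / (2 * ?a p)" using a[of p] by (intro divide_nonneg_pos) auto
    moreover have "(1 - exp (- 2 * ?a p)) / (2 * ?a p) \<le> 1 / (2 * \<delta>)"
      using a[of p] \<delta>(1) \<delta>(2)[of p] by (intro frac_le mult_left_mono) auto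
    ultimately have T: "\<bar>(1 - exp (- 2 * ?a p)) / (2 * ?a p)\<bar> \<le> 1 / (2 * \<delta>)" by (simp only: abs_of_nonneg)
    have "0 \<le> Kq" using Kq[of p] by linarith
    then show ?thesis unfolding abs_mult using T Kq[of p] by (intro mult_mono) auto
  qed
  have S1: "\<bar>?S p\<bar> \<le> 1" for p using a[of p] by simp
  note S_linear = bounded_linear_diag[of ?S 1, OF S1]
  have S0: "diag ?S 0 = 0" by (rule linear_0[OF bounded_linear.linear[OF S_linear]])
  have S_meas[measurable]: "diag ?S \<in> borel_measurable borel"
    by (intro borel_measurable_continuous_onI linear_continuous_on S_linear)
  have u[measurable]: "u x 1 \<in> borel_measurable M" for x using sol[of x] by (simp add: weak_solution_def)
  note law = solution_char_fun[OF W B a sol V]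
  have K: "distr M borel (u x 1) = distr M borel (\<lambda>\<omega>. diag ?S x + u 0 1 \<omega>)" for x
  proof (rule char_fun_unique)
    fix c
    have "char_fun (distr M borel (\<lambda>\<omega>. diag ?S x + u 0 1 \<omega>)) c = (CLINT \<omega>|M. iexp (diag ?S x \<bullet> c) * iexp (u 0 1 \<omega> \<bullet> c))"
      by (simp add: char_fun_distr inner_add_left distrib_left exp_add)
    also have "\<dots> = char_fun (distr M borel (u x 1)) c"
      unfolding char_fun_distr[OF u] integral_mult_right_zero law S0 by simp
    finally show "char_fun (distr M borel (u x 1)) c = char_fun (distr M borel (\<lambda>\<omega>. diag ?S x + u 0 1 \<omega>)) c" ..
  qed (auto intro!: prob_space_distr)
  have inv1: "invariant_distribution (\<lambda>x. distr M borel (u x 1)) \<mu>"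
    using inv by (simp add: spde_invariant_def)
  then have \<mu>: "prob_space \<mu>" "sets \<mu> = sets borel" by (auto simp: invariant_distribution_def)
  note [measurable_cong] = \<mu>(2)
  have eq: "\<mu> = distr (\<mu> \<Otimes>\<^sub>M M) borel (\<lambda>(x, \<omega>). diag ?S x + u 0 1 \<omega>)"
    by (rule invariant_distribution_eq_distr[OF prob_space_axioms inv1 K]) measurable
  have "diag_gaussian \<mu> (\<lambda>p. ?V p / (1 - (?S p)\<^sup>2))"
  proof (rule autoregression_gaussian[OF \<mu> _ _ V])
    show "\<bar>?S p\<bar> \<le> exp (- \<delta>)" for p using \<delta>(2)[of p] by simp
    show "exp (- \<delta>) < 1" using \<delta>(1) by simp
    fix c
    have "char_fun \<mu> c = char_fun (distr (\<mu> \<Otimes>\<^sub>M M) borel (\<lambda>(x, \<omega>). diag ?S x + u 0 1 \<omega>)) c"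
      using arg_cong[OF eq, of "\<lambda>\<nu>. char_fun \<nu> c"] .
    also have "\<dots> = (CLINT z|\<mu> \<Otimes>\<^sub>M M. iexp ((case z of (x, \<omega>) \<Rightarrow> diag ?S x + u 0 1 \<omega>) \<bullet> c))"
      by (rule char_fun_distr) measurable
    also have "\<dots> = (CLINT (x, \<omega>)|\<mu> \<Otimes>\<^sub>M M. iexp ((diag ?S x + u 0 1 \<omega>) \<bullet> c))"
      by (simp only: split_beta')
    also have "\<dots> = (CLINT x|\<mu>. iexp (diag ?S x \<bullet> c)) * (CLINT \<omega>|M. iexp (u 0 1 \<omega> \<bullet> c))"
      by (rule char_fun_sum_indep[OF \<mu>(1) prob_space_axioms]) measurable
    also have "(CLINT x|\<mu>. iexp (diag ?S x \<bullet> c)) = char_fun \<mu> (diag ?S c)"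
      unfolding char_fun_def diag_inner_commute[of ?S 1, OF S1] ..
    also have "(CLINT \<omega>|M. iexp (u 0 1 \<omega> \<bullet> c)) = of_real (exp (- quad ?V c / 2))"
      unfolding law S0 by simp
    finally show "char_fun \<mu> c = char_fun \<mu> (diag ?S c) * of_real (exp (- quad ?V c / 2))" .
  qed
  moreover have "?V p / (1 - (?S p)\<^sup>2) = \<sigma>\<^sup>2 * q p / (2 * ?a p)" for p
  proof -
    have "(?S p)\<^sup>2 = exp (- 2 * ?a p)" by (simp add: exp_double[symmetric])
    moreover have "exp (- 2 * ?a p) \<noteq> 1" using a[of p] by simp
    ultimately show ?thesis by simp
  qed
  ultimately show ?thesis by simp
qed

text \<open>The exponent \<open>s\<close> may be nonpositive, whereas the supremum is over exponents in \<open>(0, 1)\<close>. Working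
  with a larger exponent from that set also spares a proof that the set is an interval.\<close>

lemma trace_summable:
  assumes "ereal s < s_bar lam e Q"
  shows "\<exists>s'. s < s' \<and> 0 < s' \<and> s' < 1 \<and> summable (\<lambda>p. lam p powr (- 1 + s') * q p)"
proof -
  obtain s' where s': "s < s'" "0 < s'" "s' < 1"
      and tr: "nonneg_trace e (neg_power lam e (-1 + s') \<circ> Q) < \<infinity>"
    using assms unfolding s_bar_def less_Sup_iff by auto
  have "(neg_power lam e (-1 + s') \<circ> Q) (e p) \<bullet> e p = lam p powr (-1 + s') * q p" for p
  proof -
    let ?f = "\<lambda>k. (lam k powr (-1 + s') * (q p *\<^sub>R e p \<bullet> e k)) *\<^sub>R e k"
    have "?f = (\<lambda>k. if k = p then (lam k powr (-1 + s') * q p) *\<^sub>R e k else 0)"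
      by (auto simp: orthonormal)
    then have "suminf ?f = (lam p powr (-1 + s') * q p) *\<^sub>R e p"
      using sums_unique[OF sums_single[of p "\<lambda>k. (lam k powr (-1 + s') * q p) *\<^sub>R e k"]] by simp
    then show ?thesis by (simp add: neg_power_def Q_eigen orthonormal)
  qed
  with tr have "(\<Sum>p. ennreal (lam p powr (-1 + s') * q p)) \<noteq> top"
    by (simp add: nonneg_trace_def)
  then have "summable (\<lambda>p. lam p powr (- 1 + s') * q p)"
    using q_nonneg by (intro summable_suminf_not_top) auto
  with s' show ?thesis by blast
qed

lemma lam_gt0: "0 < lam p"
  using lam_pos lam_ge[of p] by linarith

lemma q_div_lam_summable: "summable (\<lambda>p. q p / lam p)"
proof -
  obtain s where s: "0 < s" "s < 1" and sm: "summable (\<lambda>p. lam p powr (- 1 + s) * q p)"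
    using trace_summable[of 0] trace_condition by (auto simp: zero_ereal_def)
  show ?thesis
  proof (rule summable_comparison_test'[OF summable_mult[OF sm, of "lam 0 powr (- s)"], of 0])
    fix p
    have "1 / lam p = lam p powr (- 1 + s) * lam p powr (- s)"
      unfolding powr_add[symmetric] using lam_gt0[of p] by (simp add: powr_minus_divide)
    also have "\<dots> \<le> lam p powr (- 1 + s) * lam 0 powr (- s)"
      using lam_pos lam_ge[of p] s by (intro mult_left_mono powr_mono2') auto
    finally have "q p * (1 / lam p) \<le> q p * (lam p powr (- 1 + s) * lam 0 powr (- s))"
      using q_nonneg by (intro mult_left_mono)
    then show "norm (q p / lam p) \<le> lam 0 powr (- s) * (lam p powr (- 1 + s) * q p)"
      using q_nonneg[of p] lam_gt0[of p] by (simp add: mult_ac)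
  qed
qed

lemma q_resolvent_summable:
  assumes "\<tau> > 0"
  shows "summable (\<lambda>p. q p / (1 + \<tau> * lam p))"
proof (rule summable_comparison_test'[OF summable_mult[OF q_div_lam_summable, of "1 / \<tau>"], of 0])
  fix p
  have "0 < 1 + \<tau> * lam p" using assms lam_gt0[of p] by (simp add: add_pos_pos)
  moreover have "q p / (1 + \<tau> * lam p) \<le> q p / (\<tau> * lam p)"
    using assms lam_gt0[of p] q_nonneg[of p] by (intro divide_left_mono) (auto intro!: mult_pos_pos add_pos_pos)
  ultimately show "norm (q p / (1 + \<tau> * lam p)) \<le> 1 / \<tau> * (q p / lam p)"
    using q_nonneg[of p] by simp
qed

lemma resolvent_diag: "\<tau> > 0 \<Longrightarrow> resolvent D A \<tau> = diag (\<lambda>p. 1 / (1 + \<tau> * lam p))"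
  using resolvent_eq_diag[OF A_self_adjoint e_in_dom A_eigen lam_gt0] by blast

lemma resolvent_coef_le:
  assumes "\<tau> > 0"
  shows "\<bar>1 / (1 + \<tau> * lam p)\<bar> \<le> 1"
  using assms lam_gt0[of p] by (simp add: add_pos_pos divide_le_eq)

end

section \<open>The postprocessed scheme\<close>

lemma wiener_increments_gaussian:
  assumes W: "indep_wiener_family M \<beta>" and h: "h > 0"
  shows "gaussian_sequence M (\<lambda>p \<omega>. (\<beta> p h \<omega> - \<beta> p 0 \<omega>) / sqrt h)"
proof -
  have Wp: "standard_wiener M (\<beta> p)" for p using W by (simp add: indep_wiener_family_def)
  interpret prob_space M using Wp[of 0] by (simp add: standard_wiener_def)
  have "distributed M lborel (\<lambda>\<omega>. \<beta> p h \<omega> - \<beta> p 0 \<omega>) (normal_density 0 (sqrt (h - 0)))" for p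
    using Wp[of p] h unfolding standard_wiener_def by blast
  then have 1: "distributed M lborel (\<lambda>\<omega>. (\<beta> p h \<omega> - \<beta> p 0 \<omega>) / sqrt h) std_normal_density" for p
    using normal_standard_normal_convert[of "sqrt h" _ 0] h by simp
  have ind: "indep_vars (\<lambda>_. PiM {0..} (\<lambda>_. borel)) (\<lambda>p \<omega>. \<lambda>t\<in>{0..}. \<beta> p t \<omega>) UNIV"
    using W unfolding indep_wiener_family_def by blast
  have meas: "(\<lambda>f. (f h - f 0) / sqrt h) \<in> borel_measurable (PiM {0..} (\<lambda>_. borel))"
    using h by (intro borel_measurable_divide borel_measurable_diff borel_measurable_const measurable_component_singleton) auto
  have "indep_vars (\<lambda>_. borel) (\<lambda>p \<omega>. ((\<lambda>t\<in>{0..}. \<beta> p t \<omega>) h - (\<lambda>t\<in>{0..}. \<beta> p t \<omega>) 0) / sqrt h) UNIV"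
    by (rule indep_vars_compose2[OF ind]) (rule meas)
  then have 2: "indep_vars (\<lambda>_. borel) (\<lambda>p \<omega>. (\<beta> p h \<omega> - \<beta> p 0 \<omega>) / sqrt h) UNIV" using h by simp
  show ?thesis by unfold_locales (rule 2, rule 1)
qed

context spde_setting
begin

lemma noise_law:
  assumes W: "indep_wiener_family M \<beta>" and h: "h > 0" and sm: "summable (\<lambda>p. q p * (norm (J (e p)))\<^sup>2)"
  shows "noise_image q e \<beta> h J 0 \<in> borel_measurable M"
    and "(\<lambda>p. q p * (J (e p) \<bullet> c)\<^sup>2) sums V \<Longrightarrow>
      (CLINT \<omega>|M. iexp (noise_image q e \<beta> h J 0 \<omega> \<bullet> c)) = of_real (exp (- V / 2))"
proof -
  let ?\<xi> = "\<lambda>p \<omega>. (\<beta> p h \<omega> - \<beta> p 0 \<omega>) / sqrt h"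
  let ?g = "\<lambda>p. sqrt (q p) *\<^sub>R J (e p)"
  interpret gaussian_sequence M ?\<xi> by (rule wiener_increments_gaussian[OF W h])
  have N: "noise_image q e \<beta> h J 0 = (\<lambda>\<omega>. \<Sum>p. ?\<xi> p \<omega> *\<^sub>R ?g p)"
    unfolding noise_image_def by (simp add: mult.commute)
  have g2: "(norm (?g p))\<^sup>2 = q p * (norm (J (e p)))\<^sup>2" "(?g p \<bullet> c)\<^sup>2 = q p * (J (e p) \<bullet> c)\<^sup>2" for p c
    using q_nonneg[of p] by (simp_all add: power_mult_distrib)
  show "noise_image q e \<beta> h J 0 \<in> borel_measurable M" unfolding N by (rule series_measurable)
  assume "(\<lambda>p. q p * (J (e p) \<bullet> c)\<^sup>2) sums V"
  then show "(CLINT \<omega>|M. iexp (noise_image q e \<beta> h J 0 \<omega> \<bullet> c)) = of_real (exp (- V / 2))"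
    unfolding N by (intro series_char_fun) (simp_all only: g2 sm)
qed

lemma scheme_step_diag:
  fixes \<sigma> h L :: real and b :: "nat \<Rightarrow> real"
  assumes h: "h > 0" and B: "bounded_linear B" "\<And>p. B (e p) = - (b p *\<^sub>R e p)" and b: "\<And>p. \<bar>b p\<bar> \<le> L"
  defines "R \<equiv> \<lambda>p. (1 - h * b p) / (1 + h * lam p)"
    and "G \<equiv> \<lambda>p. \<sigma> * sqrt h * (((sqrt 2 - 1) / 2 - h * b p / 2) / (1 + h * lam p) + (3 - sqrt 2) / 2)"
  shows "\<bar>R p\<bar> \<le> 1 + h * L" and "\<bar>G p\<bar> \<le> \<bar>\<sigma> * sqrt h\<bar> * (2 + h * L)"
    and "scheme_step D A B \<sigma> h u y = diag R u + diag G y"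
proof -
  have pos: "0 < 1 + h * lam p" "1 \<le> 1 + h * lam p" for p using h lam_gt0[of p] by (simp_all add: add_pos_pos)
  have hb: "\<bar>h * b p\<bar> \<le> h * L" for p using b[of p] h by (simp add: abs_mult)
  have div: "\<bar>x / (1 + h * lam p)\<bar> \<le> \<bar>x\<bar>" for x p
    using mult_left_mono[OF pos(2)[of p] abs_ge_zero[of x]] pos[of p] by (simp add: abs_divide divide_le_eq)
  show Rb: "\<bar>R p\<bar> \<le> 1 + h * L" for p
    unfolding R_def using div[of "1 - h * b p" p] hb[of p] by linarith
  have s2: "1 \<le> sqrt 2" "sqrt 2 \<le> 3/2" by (simp, rule real_le_lsqrt, simp_all add: power2_eq_square)
  show Gb: "\<bar>G p\<bar> \<le> \<bar>\<sigma> * sqrt h\<bar> * (2 + h * L)" for p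
  proof -
    have "\<bar>d + (3 - s) / 2\<bar> \<le> 2 + m"
      if "\<bar>d\<bar> \<le> \<bar>(s - 1) / 2 - y / 2\<bar>" "\<bar>y\<bar> \<le> m" "1 \<le> s" "s \<le> 3/2" for d s y m :: real
    proof -
      have "\<bar>(s - 1) / 2 - y / 2\<bar> \<le> \<bar>(s - 1) / 2\<bar> + \<bar>y / 2\<bar>" by (rule abs_triangle_ineq4)
      moreover have "\<bar>d + (3 - s) / 2\<bar> \<le> \<bar>d\<bar> + \<bar>(3 - s) / 2\<bar>" by (rule abs_triangle_ineq)
      moreover have "\<bar>(s - 1) / 2\<bar> = (s - 1) / 2" "\<bar>(3 - s) / 2\<bar> = (3 - s) / 2" "\<bar>y / 2\<bar> \<le> m / 2" "0 \<le> m"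
        using that by simp_all
      ultimately show ?thesis using that(1,3,4) by argo
    qed
    from this[OF div hb s2] show ?thesis unfolding G_def abs_mult[of "\<sigma> * sqrt h"]
      by (intro mult_left_mono) auto
  qed
  have B_coord: "B v \<bullet> e p = - b p * (v \<bullet> e p)" for v p
    by (rule eigen_coord[OF B(1)]) (simp add: B(2))
  show "scheme_step D A B \<sigma> h u y = diag R u + diag G y"
  proof (rule coord_eqI)
    fix p
    have "scheme_step D A B \<sigma> h u y \<bullet> e p = 1 / (1 + h * lam p) *
        (u \<bullet> e p + h * (- b p * (u \<bullet> e p + 1 / 2 * \<sigma> * sqrt h * (y \<bullet> e p))) + (sqrt 2 - 1) / 2 * \<sigma> * sqrt h * (y \<bullet> e p))
        + (3 - sqrt 2) / 2 * \<sigma> * sqrt h * (y \<bullet> e p)"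
      unfolding scheme_step_def resolvent_diag[OF h] inner_add_left diag_coord[of _ 1, OF resolvent_coef_le[OF h]]
        inner_scaleR_left B_coord by simp
    also have "\<dots> = R p * (u \<bullet> e p) + G p * (y \<bullet> e p)"
      unfolding R_def G_def using pos[of p] by (simp add: divide_simps) (simp add: algebra_simps)
    also have "\<dots> = (diag R u + diag G y) \<bullet> e p"
      unfolding inner_add_left diag_coord[of R, OF Rb] diag_coord[of G, OF Gb] ..
    finally show "scheme_step D A B \<sigma> h u y \<bullet> e p = (diag R u + diag G y) \<bullet> e p" .
  qed
qed

text \<open>Only the identity for \<open>J\<^sub>3 Q J\<^sub>3\<^sup>*\<close> is available. It determines the law of \<open>J\<^sub>3 \<xi>\<close>, and its trace
  bounds the squared norms of the terms of the series.\<close>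

lemma postprocessing_noise:
  assumes h: "h > 0" and J3: "admissible_J3 D A Q h J3"
  shows "summable (\<lambda>p. q p * (norm (J3 (e p)))\<^sup>2)"
    and "(\<lambda>p. q p * (J3 (e p) \<bullet> c)\<^sup>2) sums quad (\<lambda>p. q p / (1 + h / 2 * lam p)) c"
proof -
  let ?T = "resolvent D A (h / 2) \<circ> Q"
  have h2: "h / 2 > 0" using h by simp
  have cov: "(\<lambda>p. q p * (J3 (e p) \<bullet> c)\<^sup>2) sums (?T c \<bullet> c)" for c
    using J3 unfolding admissible_J3_def by (intro covariance_sums[OF _ Q_bounded Q_eigen]) auto
  have T_coord: "?T c \<bullet> e p = q p / (1 + h / 2 * lam p) * (c \<bullet> e p)" for c p
    unfolding comp_def resolvent_diag[OF h2] diag_coord[of _ 1, OF resolvent_coef_le[OF h2]]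
      eigen_coord[OF Q_bounded Q_eigen] by simp
  have "?T c \<bullet> c = quad (\<lambda>p. q p / (1 + h / 2 * lam p)) c" for c
    unfolding quad_def using sums_unique[OF parseval[of "?T c" c]]
    by (simp add: T_coord power2_eq_square mult.assoc del: comp_apply)
  with cov show "(\<lambda>p. q p * (J3 (e p) \<bullet> c)\<^sup>2) sums quad (\<lambda>p. q p / (1 + h / 2 * lam p)) c" by metis
  show "summable (\<lambda>p. q p * (norm (J3 (e p)))\<^sup>2)"
    using q_resolvent_summable[OF h2]
    by (intro norm_image_summable[OF cov q_nonneg]) (simp add: T_coord orthonormal del: comp_apply)
qed

lemma internal_noise:
  assumes \<tau>: "\<tau> > 0"
  shows "summable (\<lambda>p. q p * (norm (resolvent D A \<tau> (e p)))\<^sup>2)"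
    and "resolvent D A \<tau> (e p) \<bullet> c = 1 / (1 + \<tau> * lam p) * (c \<bullet> e p)"
proof -
  show coord: "resolvent D A \<tau> (e p) \<bullet> c = 1 / (1 + \<tau> * lam p) * (c \<bullet> e p)" for p c
    using diag_coord[of "\<lambda>p. 1 / (1 + \<tau> * lam p)" 1 c p, OF resolvent_coef_le[OF \<tau>]]
      diag_inner_commute[of "\<lambda>p. 1 / (1 + \<tau> * lam p)" 1 "e p" c, OF resolvent_coef_le[OF \<tau>]]
    by (simp add: resolvent_diag[OF \<tau>] inner_commute)
  show "summable (\<lambda>p. q p * (norm (resolvent D A \<tau> (e p)))\<^sup>2)"
  proof (rule summable_comparison_test'[OF q_resolvent_summable[OF \<tau>], of 0])
    fix p
    have n: "(norm (resolvent D A \<tau> (e p)))\<^sup>2 = 1 / (1 + \<tau> * lam p) * (1 / (1 + \<tau> * lam p))"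
      unfolding power2_norm_eq_inner coord inner_commute[of "resolvent D A \<tau> (e p)" "e p"]
      using coord[of p "e p"] by (simp add: inner_commute orthonormal)
    have p: "0 < 1 + \<tau> * lam p" using \<tau> lam_gt0[of p] by (simp add: add_pos_pos)
    have "1 / (1 + \<tau> * lam p) * (1 / (1 + \<tau> * lam p)) \<le> 1 / (1 + \<tau> * lam p) * 1"
      using resolvent_coef_le[OF \<tau>, of p] p by (intro mult_left_mono) auto
    from mult_left_mono[OF this q_nonneg[of p]]
    show "norm (q p * (norm (resolvent D A \<tau> (e p)))\<^sup>2) \<le> q p / (1 + \<tau> * lam p)"
      unfolding n[symmetric] using q_nonneg[of p] by simp
  qed
qed

text \<open>The first component is an autoregression with contraction \<open>diag R\<close> and noise \<open>diag G (J\<^sub>2 \<xi>)\<close>; the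
  second is the first plus the independent term from \<open>J\<^sub>3 \<xi>\<close>. The same \<open>\<xi>\<close> drives both components, but
  the postprocessed value only involves the state before the step, so the correlation does not
  matter for the marginals. From \<open>h L < 1\<close> and \<open>L < lam 0\<close> follows the uniform bound
  \<open>\<bar>R p\<bar> \<le> (1 + h L) / (1 + h lam 0) < 1\<close>.\<close>

theorem scheme_invariant_gaussian:
  fixes \<sigma> h L :: real and b :: "nat \<Rightarrow> real" and M :: "'w measure"
  assumes W: "indep_wiener_family M \<beta>"
    and B: "bounded_linear B" "\<And>p. B (e p) = - (b p *\<^sub>R e p)" and b: "\<And>p. \<bar>b p\<bar> \<le> L" "L < lam 0"
    and h: "h > 0" "h * L < 1" and J3: "admissible_J3 D A Q h J3"
    and inv: "scheme_invariant M D A B e q \<beta> \<sigma> J3 h \<pi>"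
  defines "R \<equiv> \<lambda>p. (1 - h * b p) / (1 + h * lam p)"
    and "G \<equiv> \<lambda>p. \<sigma> * sqrt h * (((sqrt 2 - 1) / 2 - h * b p / 2) / (1 + h * lam p) + (3 - sqrt 2) / 2)"
    and "j \<equiv> \<lambda>p. 1 / (1 + (3 - sqrt 2) / 2 * h * lam p)"
  shows "diag_gaussian (distr \<pi> borel snd)
    (\<lambda>p. q p * (G p * j p)\<^sup>2 / (1 - (R p)\<^sup>2) + (1 / 2 * \<sigma> * sqrt h)\<^sup>2 * (q p / (1 + h / 2 * lam p)))"
proof -
  interpret prob_space M using W by (auto simp: indep_wiener_family_def standard_wiener_def)
  define \<kappa> where "\<kappa> = (3 - sqrt 2) / 2"
  have "sqrt 2 < 3" by (rule real_less_lsqrt) auto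
  then have \<kappa>: "\<kappa> > 0" by (simp add: \<kappa>_def)
  then have \<tau>: "\<kappa> * h > 0" using h by simp
  let ?N2 = "noise_image q e \<beta> h (resolvent D A (\<kappa> * h)) 0"
  let ?N3 = "noise_image q e \<beta> h J3 0"
  let ?V = "\<lambda>p. q p * (G p * j p)\<^sup>2"
  let ?c3 = "1 / 2 * \<sigma> * sqrt h"
  let ?P = "\<lambda>p. q p / (1 + h / 2 * lam p)"
  note N2[measurable] = noise_law(1)[OF W h(1) internal_noise(1)[OF \<tau>]]
  note N3[measurable] = noise_law(1)[OF W h(1) postprocessing_noise(1)[OF h(1) J3]]
  have diag_step: "\<bar>R p\<bar> \<le> 1 + h * L" "\<bar>G p\<bar> \<le> \<bar>\<sigma> * sqrt h\<bar> * (2 + h * L)"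
    "scheme_step D A B \<sigma> h u y = diag R u + diag G y" for p u y
    unfolding R_def G_def by (rule scheme_step_diag[OF h(1) B b(1)])+
  have L0: "0 \<le> L" using b(1)[of 0] by linarith
  have R_lin: "bounded_linear (diag R)" by (rule bounded_linear_diag[OF diag_step(1)])
  have G_lin: "bounded_linear (diag G)" by (rule bounded_linear_diag[OF diag_step(2)])
  have [measurable]: "diag R \<in> borel_measurable borel" "diag G \<in> borel_measurable borel"
    by (intro borel_measurable_continuous_onI linear_continuous_on R_lin G_lin)+
  have [measurable]: "fst \<in> borel_measurable (borel :: ('h \<times> 'h) measure)" "snd \<in> borel_measurable (borel :: ('h \<times> 'h) measure)"
    by (intro borel_measurable_continuous_onI continuous_intros)+
  define \<Phi> :: "'h \<times> 'h \<Rightarrow> 'w \<Rightarrow> 'h \<times> 'h"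
    where "\<Phi> = (\<lambda>x \<omega>. (diag R (fst x) + diag G (?N2 \<omega>), fst x + ?c3 *\<^sub>R ?N3 \<omega>))"
  have kernel: "scheme_kernel M D A B e q \<beta> \<sigma> J3 h 0 x = distr M borel (\<Phi> x)" for x
    by (simp add: scheme_kernel_def \<Phi>_def postprocess_def case_prod_beta diag_step(3) \<kappa>_def)
  have inv0: "invariant_distribution (scheme_kernel M D A B e q \<beta> \<sigma> J3 h 0) \<pi>"
    using inv by (simp add: scheme_invariant_def)
  then have \<pi>: "prob_space \<pi>" "sets \<pi> = sets borel" by (auto simp: invariant_distribution_def)
  note [measurable_cong] = \<pi>(2)
  have \<Phi>m[measurable]: "(\<lambda>(x, \<omega>). \<Phi> x \<omega>) \<in> borel \<Otimes>\<^sub>M M \<rightarrow>\<^sub>M borel"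
    unfolding \<Phi>_def case_prod_beta borel_prod[symmetric] by measurable
  have eq: "\<pi> = distr (\<pi> \<Otimes>\<^sub>M M) borel (\<lambda>(x, \<omega>). \<Phi> x \<omega>)"
    by (rule invariant_distribution_eq_distr[OF prob_space_axioms inv0 kernel \<Phi>m])
  have through: "(CLINT x|\<pi>. iexp (f x \<bullet> c)) = (CLINT (x, \<omega>)|\<pi> \<Otimes>\<^sub>M M. iexp (f (\<Phi> x \<omega>) \<bullet> c))"
    if [measurable]: "f \<in> borel_measurable borel" for f :: "'h \<times> 'h \<Rightarrow> 'h" and c
  proof -
    have "(CLINT x|\<pi>. iexp (f x \<bullet> c)) = (CLINT x|distr (\<pi> \<Otimes>\<^sub>M M) borel (\<lambda>(x, \<omega>). \<Phi> x \<omega>). iexp (f x \<bullet> c))"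
      using arg_cong[OF eq, of "\<lambda>\<nu>. CLINT x|\<nu>. iexp (f x \<bullet> c)"] .
    also have "\<dots> = (CLINT z|\<pi> \<Otimes>\<^sub>M M. iexp (f (case z of (x, \<omega>) \<Rightarrow> \<Phi> x \<omega>) \<bullet> c))"
      by (rule integral_distr) measurable
    finally show ?thesis by (simp only: split_beta')
  qed
  let ?\<nu> = "distr \<pi> borel fst"
  have \<nu>: "prob_space ?\<nu>" "sets ?\<nu> = sets borel"
    by (auto intro!: prob_space.prob_space_distr[OF \<pi>(1)])
  have \<nu>_char: "char_fun ?\<nu> c = (CLINT x|\<pi>. iexp (fst x \<bullet> c))" for c
    by (rule char_fun_distr) measurable
  have R_less: "\<bar>R p\<bar> \<le> (1 + h * L) / (1 + h * lam 0)" for p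
  proof -
    have "\<bar>h * b p\<bar> \<le> h * L" using b(1)[of p] h(1) by (simp add: abs_mult)
    moreover have "h * lam 0 \<le> h * lam p" "0 < h * lam 0" using h(1) lam_ge[of p] lam_pos by auto
    ultimately show ?thesis unfolding R_def abs_divide using h(2) by (intro frac_le) auto
  qed
  have R1: "(1 + h * L) / (1 + h * lam 0) < 1"
  proof -
    have "h * L < h * lam 0" using b(2) h(1) by simp
    moreover have "0 < h * lam 0" using h(1) lam_pos by simp
    ultimately show ?thesis by (simp add: divide_less_eq)
  qed
  obtain Kq where Kq: "\<And>p. \<bar>q p\<bar> \<le> Kq" using q_bdd by blast
  have jb: "\<bar>j p\<bar> \<le> 1" for p
    using resolvent_coef_le[OF \<tau>, of p] unfolding j_def \<kappa>_def .
  have Vb: "\<bar>?V p\<bar> \<le> Kq * (\<bar>\<sigma> * sqrt h\<bar> * (2 + h * L))\<^sup>2" for p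
  proof -
    have "\<bar>G p * j p\<bar> \<le> \<bar>\<sigma> * sqrt h\<bar> * (2 + h * L) * 1"
      unfolding abs_mult[of "G p"] using diag_step(2)[of p] jb[of p]
      by (intro mult_mono) (auto intro: order_trans[OF abs_ge_zero])
    then have "(G p * j p)\<^sup>2 \<le> (\<bar>\<sigma> * sqrt h\<bar> * (2 + h * L))\<^sup>2"
      unfolding mult_1_right by (metis abs_ge_zero power2_abs power_mono)
    then show ?thesis unfolding abs_mult[of "q p"] using Kq[of p]
      by (intro mult_mono) (auto intro: order_trans[OF abs_ge_zero])
  qed
  have N2_char: "(CLINT \<omega>|M. iexp (diag G (?N2 \<omega>) \<bullet> c)) = of_real (exp (- quad ?V c / 2))" for c
    unfolding diag_inner_commute[of G, OF diag_step(2)]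
  proof (rule noise_law(2)[OF W h(1) internal_noise(1)[OF \<tau>]])
    have "q p * (resolvent D A (\<kappa> * h) (e p) \<bullet> diag G c)\<^sup>2 = ?V p * (c \<bullet> e p)\<^sup>2" for p
      unfolding internal_noise(2)[OF \<tau>] diag_coord[of G, OF diag_step(2)] unfolding j_def \<kappa>_def
      by (simp add: power_mult_distrib power_divide)
    then show "(\<lambda>p. q p * (resolvent D A (\<kappa> * h) (e p) \<bullet> diag G c)\<^sup>2) sums quad ?V c"
      by (simp only: quad_sums[of ?V, OF Vb])
  qed
  have \<nu>_gauss: "diag_gaussian ?\<nu> (\<lambda>p. ?V p / (1 - (R p)\<^sup>2))"
  proof (rule autoregression_gaussian[OF \<nu> R_less R1 Vb])
    fix c
    have "char_fun ?\<nu> c = (CLINT (x, \<omega>)|\<pi> \<Otimes>\<^sub>M M. iexp ((diag R (fst x) + diag G (?N2 \<omega>)) \<bullet> c))"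
      unfolding \<nu>_char by (subst through) (simp_all add: \<Phi>_def)
    also have "\<dots> = (CLINT x|\<pi>. iexp (diag R (fst x) \<bullet> c)) * (CLINT \<omega>|M. iexp (diag G (?N2 \<omega>) \<bullet> c))"
      by (rule char_fun_sum_indep[OF \<pi>(1) prob_space_axioms]) measurable
    also have "(CLINT x|\<pi>. iexp (diag R (fst x) \<bullet> c)) = char_fun ?\<nu> (diag R c)"
      unfolding \<nu>_char diag_inner_commute[of R, OF diag_step(1)] ..
    finally show "char_fun ?\<nu> c = char_fun ?\<nu> (diag R c) * of_real (exp (- quad ?V c / 2))"
      unfolding N2_char .
  qed
  have Wb: "\<bar>?V p / (1 - (R p)\<^sup>2)\<bar> \<le> Kq * (\<bar>\<sigma> * sqrt h\<bar> * (2 + h * L))\<^sup>2 / (1 - ((1 + h * L) / (1 + h * lam 0))\<^sup>2)" for p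
    by (rule stationary_variance_le[OF R_less R1 Vb])
  have Pb: "\<bar>?P p\<bar> \<le> Kq" for p
  proof -
    have "\<bar>1 / (1 + h / 2 * lam p)\<bar> \<le> 1" using h(1) by (intro resolvent_coef_le) simp
    then have "\<bar>q p * (1 / (1 + h / 2 * lam p))\<bar> \<le> Kq * 1"
      unfolding abs_mult[of "q p"] using Kq[of p] by (intro mult_mono) (auto intro: order_trans[OF abs_ge_zero])
    then show ?thesis by simp
  qed
  have "char_fun (distr \<pi> borel snd) c =
      of_real (exp (- quad (\<lambda>p. ?V p / (1 - (R p)\<^sup>2) + ?c3\<^sup>2 * ?P p) c / 2))" for c
  proof -
    have "char_fun (distr \<pi> borel snd) c = (CLINT x|\<pi>. iexp (snd x \<bullet> c))"
      by (rule char_fun_distr) measurable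
    also have "\<dots> = (CLINT (x, \<omega>)|\<pi> \<Otimes>\<^sub>M M. iexp ((fst x + ?c3 *\<^sub>R ?N3 \<omega>) \<bullet> c))"
      by (subst through) (simp_all add: \<Phi>_def)
    also have "\<dots> = (CLINT x|\<pi>. iexp (fst x \<bullet> c)) * (CLINT \<omega>|M. iexp ((?c3 *\<^sub>R ?N3 \<omega>) \<bullet> c))"
      by (rule char_fun_sum_indep[OF \<pi>(1) prob_space_axioms]) measurable
    also have "(\<lambda>\<omega>. iexp ((?c3 *\<^sub>R ?N3 \<omega>) \<bullet> c)) = (\<lambda>\<omega>. iexp (?N3 \<omega> \<bullet> (?c3 *\<^sub>R c)))"
      unfolding inner_scaleR_left inner_scaleR_right ..
    also have "(CLINT \<omega>|M. iexp (?N3 \<omega> \<bullet> (?c3 *\<^sub>R c))) = of_real (exp (- quad ?P (?c3 *\<^sub>R c) / 2))"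
      by (rule noise_law(2)[OF W h(1) postprocessing_noise[OF h(1) J3]])
    also have "(CLINT x|\<pi>. iexp (fst x \<bullet> c)) = of_real (exp (- quad (\<lambda>p. ?V p / (1 - (R p)\<^sup>2)) c / 2))"
      using \<nu>_gauss unfolding \<nu>_char[symmetric] diag_gaussian_def by blast
    also have "of_real (exp (- quad (\<lambda>p. ?V p / (1 - (R p)\<^sup>2)) c / 2)) * complex_of_real (exp (- quad ?P (?c3 *\<^sub>R c) / 2))
        = of_real (exp (- (quad (\<lambda>p. ?V p / (1 - (R p)\<^sup>2)) c + quad ?P (?c3 *\<^sub>R c)) / 2))"
      unfolding of_real_mult[symmetric] exp_add[symmetric] by (simp add: field_simps)
    also have "quad (\<lambda>p. ?V p / (1 - (R p)\<^sup>2)) c + quad ?P (?c3 *\<^sub>R c) = quad (\<lambda>p. ?V p / (1 - (R p)\<^sup>2) + ?c3\<^sup>2 * ?P p) c"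
    proof -
      have "?V p / (1 - (R p)\<^sup>2) * (c \<bullet> e p)\<^sup>2 + ?P p * (?c3 *\<^sub>R c \<bullet> e p)\<^sup>2 = (?V p / (1 - (R p)\<^sup>2) + ?c3\<^sup>2 * ?P p) * (c \<bullet> e p)\<^sup>2" for p
        unfolding inner_scaleR_left power_mult_distrib[of ?c3 "c \<bullet> e p"] distrib_right by (simp only: ac_simps)
      then show ?thesis
        using sums_unique[OF sums_add[OF quad_sums[of "\<lambda>p. ?V p / (1 - (R p)\<^sup>2)", OF Wb, of c] quad_sums[of ?P, OF Pb, of "?c3 *\<^sub>R c"]]]
        unfolding quad_def[of "\<lambda>p. ?V p / (1 - (R p)\<^sup>2) + ?c3\<^sup>2 * ?P p"] by (simp only:)
    qed
    finally show ?thesis .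
  qed
  then show ?thesis unfolding diag_gaussian_def
    by (auto intro!: prob_space.prob_space_distr[OF \<pi>(1)])
qed

end

section \<open>Comparing Gaussian measures on smooth functions\<close>

lemma second_order_taylor:
  fixes \<phi> :: "'h::real_inner \<Rightarrow> real"
  assumes C2: "C2_function \<phi> \<phi>' \<phi>''" and K: "\<And>v. norm (\<phi>'' v) \<le> K"
  shows "\<bar>\<phi> (z + y) - \<phi> z - \<phi>' z y\<bar> \<le> K / 2 * (norm y)\<^sup>2"
proof -
  define d where "d m t = (if m = 0 then \<phi> (z + t *\<^sub>R y) else if m = 1 then \<phi>' (z + t *\<^sub>R y) y
    else \<phi>'' (z + t *\<^sub>R y) y y)" for m :: nat and t :: real
  have line: "((\<lambda>t. z + t *\<^sub>R y) has_derivative (\<lambda>s. s *\<^sub>R y)) (at t)" for t :: real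
    by (auto intro!: derivative_eq_intros)
  have d_simps: "d 0 = (\<lambda>t. \<phi> (z + t *\<^sub>R y))" "d (Suc 0) = (\<lambda>t. \<phi>' (z + t *\<^sub>R y) y)"
      "d (Suc (Suc 0)) = (\<lambda>t. \<phi>'' (z + t *\<^sub>R y) y y)"
    by (auto simp: d_def)
  have d0: "DERIV (d 0) t :> d (Suc 0) t" for t
  proof -
    have "(\<phi> has_derivative blinfun_apply (\<phi>' (z + t *\<^sub>R y))) (at (z + t *\<^sub>R y))"
      using C2 unfolding C2_function_def by blast
    from has_derivative_compose[OF line this]
    have "((\<lambda>t. \<phi> (z + t *\<^sub>R y)) has_derivative (\<lambda>s. \<phi>' (z + t *\<^sub>R y) (s *\<^sub>R y))) (at t)" .
    moreover have "(\<lambda>s. \<phi>' (z + t *\<^sub>R y) (s *\<^sub>R y)) = (*) (\<phi>' (z + t *\<^sub>R y) y)"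
      by (rule ext) (simp add: blinfun.scaleR_right)
    ultimately show ?thesis unfolding d_simps has_field_derivative_def by simp
  qed
  have d1: "DERIV (d (Suc 0)) t :> d (Suc (Suc 0)) t" for t
  proof -
    have "(\<phi>' has_derivative blinfun_apply (\<phi>'' (z + t *\<^sub>R y))) (at (z + t *\<^sub>R y))"
      using C2 unfolding C2_function_def by blast
    from bounded_linear.has_derivative[OF blinfun.bounded_linear_left[of y] has_derivative_compose[OF line this]]
    have "((\<lambda>t. \<phi>' (z + t *\<^sub>R y) y) has_derivative (\<lambda>s. \<phi>'' (z + t *\<^sub>R y) (s *\<^sub>R y) y)) (at t)" .
    moreover have "(\<lambda>s. \<phi>'' (z + t *\<^sub>R y) (s *\<^sub>R y) y) = (*) (\<phi>'' (z + t *\<^sub>R y) y y)"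
      by (rule ext) (simp add: blinfun.scaleR_right blinfun.scaleR_left)
    ultimately show ?thesis unfolding d_simps has_field_derivative_def by simp
  qed
  have "DERIV (d m) t :> d (Suc m) t" if "m < 2" for m t
    using that d0[of t] d1[of t] by (cases m) auto
  then obtain t where "0 < t" "t < 1"
      and t: "d 0 1 = (\<Sum>m<2. (d m 0 / fact m) * (1 - 0) ^ m) + (d 2 t / fact 2) * (1 - 0)\<^sup>2"
    using Taylor_up[of 2 d "d 0" 0 1 0] by auto
  then have "\<phi> (z + y) - \<phi> z - \<phi>' z y = \<phi>'' (z + t *\<^sub>R y) y y / 2"
    by (simp add: d_def numeral_2_eq_2)
  moreover have "\<bar>\<phi>'' (z + t *\<^sub>R y) y y\<bar> \<le> K * (norm y)\<^sup>2"
  proof -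
    have "\<bar>\<phi>'' (z + t *\<^sub>R y) y y\<bar> \<le> norm (\<phi>'' (z + t *\<^sub>R y) y) * norm y"
      using norm_blinfun[of "\<phi>'' (z + t *\<^sub>R y) y" y] by simp
    also have "\<dots> \<le> (norm (\<phi>'' (z + t *\<^sub>R y)) * norm y) * norm y"
      by (intro mult_right_mono norm_blinfun) simp
    also have "\<dots> \<le> (K * norm y) * norm y" by (intro mult_right_mono K) auto
    finally show ?thesis by (simp add: power2_eq_square)
  qed
  ultimately show ?thesis by (simp only: abs_divide)
qed

context hilbert_basis
begin

lemma diag_gaussian_series:
  assumes G: "gaussian_sequence M \<xi>" and V: "\<And>p. V p \<ge> 0" "summable V"
  defines "X \<equiv> \<lambda>\<omega>. \<Sum>p. \<xi> p \<omega> *\<^sub>R sqrt (V p) *\<^sub>R e p"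
  shows "X \<in> borel_measurable M" and "diag_gaussian (distr M borel X) V"
    and "(\<integral>\<^sup>+\<omega>. ennreal ((norm (X \<omega>))\<^sup>2) \<partial>M) = ennreal (suminf V)"
proof -
  interpret gaussian_sequence M \<xi> by (rule G)
  let ?g = "\<lambda>p. sqrt (V p) *\<^sub>R e p"
  have e1: "norm (e p) = 1" for p using orthonormal[of p p] by (simp add: norm_eq_sqrt_inner)
  have sm: "summable (\<lambda>p. (norm (?g p))\<^sup>2)" using V by (simp add: e1)
  have "Bseq V" by (rule convergent_imp_Bseq[OF convergentI[OF summable_LIMSEQ_zero[OF V(2)]]])
  then obtain K where K: "\<And>p. \<bar>V p\<bar> \<le> K" unfolding Bseq_def by auto
  show X[measurable]: "X \<in> borel_measurable M" unfolding X_def by (rule series_measurable)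
  have "char_fun (distr M borel X) c = of_real (exp (- quad V c / 2))" for c
  proof -
    have "(?g p \<bullet> c)\<^sup>2 = V p * (c \<bullet> e p)\<^sup>2" for p
      using V(1)[of p] by (simp add: power_mult_distrib inner_commute)
    then have "(\<lambda>p. (?g p \<bullet> c)\<^sup>2) sums quad V c" using quad_sums[of V, OF K] by simp
    from series_char_fun[OF sm this] show ?thesis unfolding char_fun_distr[OF X] unfolding X_def .
  qed
  then show "diag_gaussian (distr M borel X) V"
    unfolding diag_gaussian_def by (auto intro!: prob_space_distr)
  have "AE \<omega> in M. ennreal ((norm (X \<omega>))\<^sup>2) = (\<Sum>p. ennreal (V p * (\<xi> p \<omega>)\<^sup>2))"
    using series_converges_AE[OF sm]
  proof eventually_elim
    fix \<omega> assume s: "summable (\<lambda>p. \<xi> p \<omega> *\<^sub>R ?g p)"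
    have "X \<omega> \<bullet> e k = \<xi> k \<omega> * sqrt (V k)" for k
    proof -
      have "(\<lambda>p. (\<xi> p \<omega> *\<^sub>R ?g p) \<bullet> e k) sums (X \<omega> \<bullet> e k)"
        unfolding X_def by (rule bounded_linear.sums[OF bounded_linear_inner_left summable_sums[OF s]])
      moreover have "(\<lambda>p. (\<xi> p \<omega> *\<^sub>R ?g p) \<bullet> e k) = (\<lambda>p. if p = k then \<xi> p \<omega> * sqrt (V p) else 0)"
        by (auto simp: orthonormal)
      ultimately show ?thesis using sums_single[of k "\<lambda>p. \<xi> p \<omega> * sqrt (V p)"] sums_unique2 by simp
    qed
    then have "(\<lambda>p. V p * (\<xi> p \<omega>)\<^sup>2) sums (norm (X \<omega>))\<^sup>2"
      using parseval_norm[of "X \<omega>"] V(1) by (simp add: power_mult_distrib mult.commute)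
    then show "ennreal ((norm (X \<omega>))\<^sup>2) = (\<Sum>p. ennreal (V p * (\<xi> p \<omega>)\<^sup>2))"
      using V(1) by (intro suminf_ennreal_eq[symmetric]) auto
  qed
  then have "(\<integral>\<^sup>+\<omega>. ennreal ((norm (X \<omega>))\<^sup>2) \<partial>M) = (\<integral>\<^sup>+\<omega>. (\<Sum>p. ennreal (V p * (\<xi> p \<omega>)\<^sup>2)) \<partial>M)"
    by (rule nn_integral_cong_AE)
  also have "\<dots> = (\<Sum>p. \<integral>\<^sup>+\<omega>. ennreal (V p * (\<xi> p \<omega>)\<^sup>2) \<partial>M)" by (rule nn_integral_suminf) measurable
  also have "\<dots> = (\<Sum>p. ennreal (V p))"
  proof (rule suminf_cong)
    fix p
    have "(\<integral>\<^sup>+\<omega>. ennreal (V p * (\<xi> p \<omega>)\<^sup>2) \<partial>M) = ennreal (\<integral>\<omega>. V p * (\<xi> p \<omega>)\<^sup>2 \<partial>M)"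
      using V(1) moments(3) by (intro nn_integral_eq_integral) auto
    then show "(\<integral>\<^sup>+\<omega>. ennreal (V p * (\<xi> p \<omega>)\<^sup>2) \<partial>M) = ennreal (V p)" using moments(4) by simp
  qed
  also have "\<dots> = ennreal (suminf V)" using V by (intro suminf_ennreal_eq summable_sums) auto
  finally show "(\<integral>\<^sup>+\<omega>. ennreal ((norm (X \<omega>))\<^sup>2) \<partial>M) = ennreal (suminf V)" .
qed

lemma diag_gaussian_second_moment:
  assumes G: "gaussian_sequence M \<xi>" and \<nu>: "diag_gaussian \<nu> V" and V: "\<And>p. V p \<ge> 0" "summable V"
  shows "integrable \<nu> (\<lambda>v. (norm v)\<^sup>2)" and "(\<integral>v. (norm v)\<^sup>2 \<partial>\<nu>) = suminf V"
proof -
  define X where "X = (\<lambda>\<omega>. \<Sum>p. \<xi> p \<omega> *\<^sub>R sqrt (V p) *\<^sub>R e p)"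
  note S = diag_gaussian_series(1,2)[OF G V, folded X_def]
  have S3: "(\<integral>\<^sup>+\<omega>. ennreal ((norm (X \<omega>))\<^sup>2) \<partial>M) = ennreal (suminf V)"
    using diag_gaussian_series(3)[OF G V] by (simp only: X_def)
  note [measurable] = S(1)
  have \<nu>_eq: "\<nu> = distr M borel X" by (rule diag_gaussian_unique[OF \<nu> S(2)])
  have "(\<integral>\<^sup>+v. ennreal ((norm v)\<^sup>2) \<partial>\<nu>) = ennreal (suminf V)"
    unfolding \<nu>_eq by (subst nn_integral_distr) (auto simp: S3)
  moreover have "(\<lambda>v. (norm v)\<^sup>2) \<in> borel_measurable \<nu>" unfolding \<nu>_eq by measurable
  ultimately have "has_bochner_integral \<nu> (\<lambda>v. (norm v)\<^sup>2) (suminf V)"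
    using V by (intro has_bochner_integral_nn_integral suminf_nonneg) auto
  then show "integrable \<nu> (\<lambda>v. (norm v)\<^sup>2)" "(\<integral>v. (norm v)\<^sup>2 \<partial>\<nu>) = suminf V"
    by (auto simp: has_bochner_integral_iff)
qed

lemma C2_integrable:
  fixes \<phi> :: "'h \<Rightarrow> real"
  assumes \<nu>: "prob_space \<nu>" "sets \<nu> = sets borel" and i2: "integrable \<nu> (\<lambda>v. (norm v)\<^sup>2)"
    and C2: "C2_function \<phi> \<phi>' \<phi>''" and K: "\<And>v. norm (\<phi>'' v) \<le> K"
  shows "integrable \<nu> \<phi>"
proof -
  interpret prob_space \<nu> by fact
  note [measurable_cong] = \<nu>(2)
  have "continuous_on UNIV \<phi>"
    using C2 unfolding C2_function_def by (meson continuous_at_imp_continuous_on has_derivative_continuous)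
  then have [measurable]: "\<phi> \<in> borel_measurable borel" by (rule borel_measurable_continuous_onI)
  let ?n = "norm (\<phi>' 0)"
  have bound: "\<bar>\<phi> v\<bar> \<le> (\<bar>\<phi> 0\<bar> + ?n) + (?n + K / 2) * (norm v)\<^sup>2" for v
  proof -
    have "\<bar>\<phi> v - \<phi> 0 - \<phi>' 0 v\<bar> \<le> K / 2 * (norm v)\<^sup>2" using second_order_taylor[OF C2 K, of 0 v] by simp
    moreover have "\<bar>\<phi>' 0 v\<bar> \<le> ?n * norm v" using norm_blinfun[of "\<phi>' 0" v] by simp
    moreover have "?n * norm v \<le> ?n * (1 + (norm v)\<^sup>2)"
    proof (rule mult_left_mono)
      have "0 \<le> (norm v - 1 / 2)\<^sup>2" by simp
      then show "norm v \<le> 1 + (norm v)\<^sup>2" by (simp add: power2_diff power_divide)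
    qed simp
    ultimately have "\<bar>\<phi> v\<bar> \<le> \<bar>\<phi> 0\<bar> + ?n * (1 + (norm v)\<^sup>2) + K / 2 * (norm v)\<^sup>2" by linarith
    then show ?thesis by (simp add: algebra_simps)
  qed
  show ?thesis
  proof (rule Bochner_Integration.integrable_bound)
    show "integrable \<nu> (\<lambda>v. (\<bar>\<phi> 0\<bar> + ?n) + (?n + K / 2) * (norm v)\<^sup>2)" using i2 by simp
    show "AE v in \<nu>. norm (\<phi> v) \<le> norm ((\<bar>\<phi> 0\<bar> + ?n) + (?n + K / 2) * (norm v)\<^sup>2)"
      using bound by (auto intro!: order_trans[OF bound abs_ge_self])
  qed simp
qed

text \<open>Both signs give the same law because the second summand is symmetric; this is what makes second
  differences appear.\<close>

lemma diag_gaussian_add: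
  assumes \<mu>: "diag_gaussian \<mu> V" and Z: "diag_gaussian Z m" and Y: "diag_gaussian Y (\<lambda>p. V p - m p)"
    and b: "\<And>p. \<bar>m p\<bar> \<le> K" "\<And>p. \<bar>V p - m p\<bar> \<le> K" and s: "s = 1 \<or> s = - 1"
  shows "\<mu> = distr (Z \<Otimes>\<^sub>M Y) borel (\<lambda>(z, y). z + s *\<^sub>R y)"
proof (rule diag_gaussian_unique[OF \<mu>])
  have ps: "prob_space Z" "prob_space Y" and sets[measurable_cong]: "sets Z = sets borel" "sets Y = sets borel"
    using Z Y by (auto simp: diag_gaussian_def)
  interpret Z: prob_space Z by fact
  interpret Y: prob_space Y by fact
  interpret pair_prob_space Z Y ..
  have "char_fun (distr (Z \<Otimes>\<^sub>M Y) borel (\<lambda>(z, y). z + s *\<^sub>R y)) c = of_real (exp (- quad V c / 2))" for c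
  proof -
    have "char_fun (distr (Z \<Otimes>\<^sub>M Y) borel (\<lambda>(z, y). z + s *\<^sub>R y)) c
        = (CLINT x|Z \<Otimes>\<^sub>M Y. iexp ((case x of (z, y) \<Rightarrow> z + s *\<^sub>R y) \<bullet> c))"
      by (rule char_fun_distr) measurable
    also have "\<dots> = (CLINT (z, y)|Z \<Otimes>\<^sub>M Y. iexp ((z + s *\<^sub>R y) \<bullet> c))" by (simp only: split_beta')
    also have "\<dots> = (CLINT z|Z. iexp (z \<bullet> c)) * (CLINT y|Y. iexp ((s *\<^sub>R y) \<bullet> c))"
      by (rule char_fun_sum_indep[OF ps]) measurable
    also have "(CLINT y|Y. iexp ((s *\<^sub>R y) \<bullet> c)) = char_fun Y (s *\<^sub>R c)"
      by (simp add: char_fun_def)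
    also have "\<dots> = of_real (exp (- quad (\<lambda>p. V p - m p) c / 2))"
    proof -
      have "quad W (s *\<^sub>R c) = quad W c" for W using s by (auto simp: quad_def)
      then show ?thesis using Y by (simp add: diag_gaussian_def)
    qed
    also have "(CLINT z|Z. iexp (z \<bullet> c)) = of_real (exp (- quad m c / 2))"
      using Z by (simp add: diag_gaussian_def char_fun_def)
    also have "of_real (exp (- quad m c / 2)) * complex_of_real (exp (- quad (\<lambda>p. V p - m p) c / 2))
        = of_real (exp (- (quad m c + quad (\<lambda>p. V p - m p) c) / 2))"
      unfolding of_real_mult[symmetric] exp_add[symmetric] by (simp add: field_simps)
    also have "quad m c + quad (\<lambda>p. V p - m p) c = quad V c"
      using sums_unique[OF sums_add[OF quad_sums[of m, OF b(1), of c] quad_sums[of "\<lambda>p. V p - m p", OF b(2), of c]]]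
      unfolding quad_def[of V] by (simp add: left_diff_distrib)
    finally show ?thesis .
  qed
  then show "diag_gaussian (distr (Z \<Otimes>\<^sub>M Y) borel (\<lambda>(z, y). z + s *\<^sub>R y)) V"
    unfolding diag_gaussian_def by (auto intro!: prob_space_distr)
qed

text \<open>With \<open>Y\<close> the independent increment from \<open>Z\<close> to \<open>\<mu>\<close>, the difference of the integrals is the
  expectation of \<open>(\<phi> (Z + Y) + \<phi> (Z - Y)) / 2 - \<phi> Z\<close>, in which the first-order term cancels
  pointwise.\<close>

lemma gaussian_smaller_variance:
  fixes \<phi> :: "'h \<Rightarrow> real"
  assumes G: "gaussian_sequence M \<xi>" and \<mu>: "diag_gaussian \<mu> V" and Z: "diag_gaussian Z m"
    and m: "\<And>p. 0 \<le> m p" "\<And>p. m p \<le> V p" and V: "summable V"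
    and C2: "C2_function \<phi> \<phi>' \<phi>''" and K: "\<And>v. norm (\<phi>'' v) \<le> K"
  shows "\<bar>(\<integral>v. \<phi> v \<partial>\<mu>) - (\<integral>v. \<phi> v \<partial>Z)\<bar> \<le> K / 2 * (\<Sum>p. V p - m p)"
proof -
  let ?W = "\<lambda>p. V p - m p"
  have V0: "0 \<le> V p" for p using m[of p] by linarith
  have sm: "summable m" by (rule summable_comparison_test'[OF V, of 0]) (use m in auto)
  have W: "\<And>p. 0 \<le> ?W p" "summable ?W" using m(2) summable_diff[OF V sm] by auto
  define Y where "Y = distr M borel (\<lambda>\<omega>. \<Sum>p. \<xi> p \<omega> *\<^sub>R sqrt (?W p) *\<^sub>R e p)"
  have Y: "diag_gaussian Y ?W" unfolding Y_def by (rule diag_gaussian_series(2)[OF G W])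
  have ps: "prob_space Z" "prob_space Y" "prob_space \<mu>"
    and sets[measurable_cong]: "sets Z = sets borel" "sets Y = sets borel" "sets \<mu> = sets borel"
    using Z Y \<mu> by (auto simp: diag_gaussian_def)
  interpret Z: prob_space Z by fact
  interpret Y: prob_space Y by fact
  interpret P: pair_prob_space Z Y ..
  let ?P = "Z \<Otimes>\<^sub>M Y"
  have "Bseq V" by (rule convergent_imp_Bseq[OF convergentI[OF summable_LIMSEQ_zero[OF V]]])
  then obtain K0 where K0: "\<And>p. \<bar>V p\<bar> \<le> K0" unfolding Bseq_def by auto
  have b: "\<bar>m p\<bar> \<le> K0" "\<bar>?W p\<bar> \<le> K0" for p using K0[of p] m[of p] by auto
  have dec: "\<mu> = distr ?P borel (\<lambda>(z, y). z + s *\<^sub>R y)" if "s = 1 \<or> s = - 1" for s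
    by (rule diag_gaussian_add[OF \<mu> Z Y b that])
  have i\<mu>: "integrable \<mu> \<phi>"
    by (rule C2_integrable[OF ps(3) sets(3) diag_gaussian_second_moment(1)[OF G \<mu> V0 V] C2 K])
  have iZ: "integrable Z \<phi>"
    by (rule C2_integrable[OF ps(1) sets(1) diag_gaussian_second_moment(1)[OF G Z m(1) sm] C2 K])
  have "continuous_on UNIV \<phi>"
    using C2 unfolding C2_function_def by (meson continuous_at_imp_continuous_on has_derivative_continuous)
  then have [measurable]: "\<phi> \<in> borel_measurable borel" by (rule borel_measurable_continuous_onI)
  have shift: "integrable ?P (\<lambda>x. \<phi> (fst x + s *\<^sub>R snd x))" "(\<integral>x. \<phi> (fst x + s *\<^sub>R snd x) \<partial>?P) = (\<integral>v. \<phi> v \<partial>\<mu>)"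
    if "s = 1 \<or> s = - 1" for s
  proof -
    have "integrable (distr ?P borel (\<lambda>(z, y). z + s *\<^sub>R y)) \<phi>" using i\<mu> dec[OF that] by simp
    then show "integrable ?P (\<lambda>x. \<phi> (fst x + s *\<^sub>R snd x))"
      by (subst (asm) integrable_distr_eq) (auto simp: split_beta')
    have "(\<integral>v. \<phi> v \<partial>\<mu>) = (\<integral>v. \<phi> v \<partial>distr ?P borel (\<lambda>(z, y). z + s *\<^sub>R y))" using arg_cong[OF dec[OF that]] .
    also have "\<dots> = (\<integral>x. \<phi> (fst x + s *\<^sub>R snd x) \<partial>?P)"
      by (subst integral_distr) (auto simp: split_beta')
    finally show "(\<integral>x. \<phi> (fst x + s *\<^sub>R snd x) \<partial>?P) = (\<integral>v. \<phi> v \<partial>\<mu>)" ..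
  qed
  have fst: "distr ?P Z fst = Z" by (rule Y.distr_pair_fst)
  have snd: "distr ?P Y snd = Y"
  proof -
    interpret Q: pair_prob_space Y Z ..
    have "distr ?P Y snd = distr (distr (Y \<Otimes>\<^sub>M Z) ?P (\<lambda>(x, y). (y, x))) Y snd"
      using P.distr_pair_swap by simp
    also have "\<dots> = distr (Y \<Otimes>\<^sub>M Z) Y fst"
      by (subst distr_distr) (auto simp: comp_def split_beta' intro!: distr_cong)
    finally show ?thesis by (simp add: Z.distr_pair_fst)
  qed
  have marg: "integrable ?P (\<lambda>x. \<phi> (fst x))" "(\<integral>x. \<phi> (fst x) \<partial>?P) = (\<integral>v. \<phi> v \<partial>Z)"
    using integrable_distr[OF measurable_fst, of Z Y \<phi>] integral_distr[OF measurable_fst, of \<phi> Z Y] iZ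
    by (simp_all add: fst)
  note Y2 = diag_gaussian_second_moment[OF G Y W]
  have margY: "integrable ?P (\<lambda>x. (norm (snd x))\<^sup>2)" "(\<integral>x. (norm (snd x))\<^sup>2 \<partial>?P) = suminf ?W"
    using integrable_distr[OF measurable_snd, of Z Y "\<lambda>y. (norm y)\<^sup>2"]
      integral_distr[OF measurable_snd, of "\<lambda>y. (norm y)\<^sup>2" Y Z] Y2
    by (simp_all add: snd)
  let ?D = "\<lambda>x. (\<phi> (fst x + 1 *\<^sub>R snd x) + \<phi> (fst x + (- 1) *\<^sub>R snd x)) / 2 - \<phi> (fst x)"
  have D: "\<bar>?D x\<bar> \<le> K / 2 * (norm (snd x))\<^sup>2" for x
  proof -
    have 1: "\<bar>\<phi> (fst x + snd x) - \<phi> (fst x) - \<phi>' (fst x) (snd x)\<bar> \<le> K / 2 * (norm (snd x))\<^sup>2"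
      by (rule second_order_taylor[OF C2 K])
    have "\<bar>\<phi> (fst x + - snd x) - \<phi> (fst x) - \<phi>' (fst x) (- snd x)\<bar> \<le> K / 2 * (norm (- snd x))\<^sup>2"
      by (rule second_order_taylor[OF C2 K])
    then have 2: "\<bar>\<phi> (fst x + - snd x) - \<phi> (fst x) + \<phi>' (fst x) (snd x)\<bar> \<le> K / 2 * (norm (snd x))\<^sup>2"
      by (simp add: blinfun.minus_right)
    have "?D x = ((\<phi> (fst x + snd x) - \<phi> (fst x) - \<phi>' (fst x) (snd x)) +
        (\<phi> (fst x + - snd x) - \<phi> (fst x) + \<phi>' (fst x) (snd x))) / 2"
      by (simp add: field_simps)
    moreover have "\<bar>(a + b) / 2\<bar> \<le> c" if "\<bar>a\<bar> \<le> c" "\<bar>b\<bar> \<le> c" for a b c :: real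
      using that by (auto simp: abs_le_iff field_simps)
    ultimately show ?thesis using 1 2 by (simp only:)
  qed
  have "(\<integral>v. \<phi> v \<partial>\<mu>) - (\<integral>v. \<phi> v \<partial>Z) = (\<integral>x. ?D x \<partial>?P)"
    using shift[of 1] shift[of "- 1"] marg by simp
  also have "\<bar>\<dots>\<bar> \<le> (\<integral>x. K / 2 * (norm (snd x))\<^sup>2 \<partial>?P)"
    by (rule order_trans[OF integral_abs_bound integral_mono])
      (use D shift[of 1] shift[of "- 1"] marg margY in auto)
  also have "\<dots> = K / 2 * (\<Sum>p. V p - m p)" using margY by simp
  finally show ?thesis .
qed

text \<open>The common part \<open>min (V p) (W p)\<close> has smaller variances than both, and the two gaps add up to
  \<open>\<bar>V p - W p\<bar>\<close>.\<close>

theorem gaussian_comparison: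
  fixes \<phi> :: "'h \<Rightarrow> real"
  assumes G: "gaussian_sequence M \<xi>" and \<mu>: "diag_gaussian \<mu> V" and \<nu>: "diag_gaussian \<nu> W"
    and V: "\<And>p. 0 \<le> V p" "summable V" and W: "\<And>p. 0 \<le> W p" "summable W"
    and C2: "C2_function \<phi> \<phi>' \<phi>''" and K: "\<And>v. norm (\<phi>'' v) \<le> K"
  shows "\<bar>(\<integral>v. \<phi> v \<partial>\<mu>) - (\<integral>v. \<phi> v \<partial>\<nu>)\<bar> \<le> K / 2 * (\<Sum>p. \<bar>V p - W p\<bar>)"
proof -
  define m where "m p = min (V p) (W p)" for p
  have m: "0 \<le> m p" "m p \<le> V p" "m p \<le> W p" for p using V(1) W(1) by (auto simp: m_def)
  have sm: "summable m" by (rule summable_comparison_test'[OF V(2), of 0]) (use m in auto)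
  note Z = diag_gaussian_series(2)[OF G m(1) sm]
  let ?Z = "distr M borel (\<lambda>\<omega>. \<Sum>p. \<xi> p \<omega> *\<^sub>R sqrt (m p) *\<^sub>R e p)"
  have "\<bar>(\<integral>v. \<phi> v \<partial>\<mu>) - (\<integral>v. \<phi> v \<partial>\<nu>)\<bar> \<le>
      \<bar>(\<integral>v. \<phi> v \<partial>\<mu>) - (\<integral>v. \<phi> v \<partial>?Z)\<bar> + \<bar>(\<integral>v. \<phi> v \<partial>\<nu>) - (\<integral>v. \<phi> v \<partial>?Z)\<bar>" by linarith
  also have "\<dots> \<le> K / 2 * (\<Sum>p. V p - m p) + K / 2 * (\<Sum>p. W p - m p)"
    by (intro add_mono gaussian_smaller_variance[OF G \<mu> Z m(1,2) V(2) C2 K]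
        gaussian_smaller_variance[OF G \<nu> Z m(1,3) W(2) C2 K])
  also have "\<dots> = K / 2 * (\<Sum>p. (V p - m p) + (W p - m p))"
    unfolding distrib_left[symmetric]
    by (subst suminf_add[OF summable_diff[OF V(2) sm] summable_diff[OF W(2) sm]]) (rule refl)
  also have "(\<lambda>p. (V p - m p) + (W p - m p)) = (\<lambda>p. \<bar>V p - W p\<bar>)" by (auto simp: m_def)
  finally show ?thesis .
qed

end

section \<open>The variance defect of the scheme\<close>

text \<open>With \<open>\<kappa> = (3 - sqrt 2) / 2\<close>, the first two summands are the stationary variance of the
  scheme and the variance added by postprocessing, the third is the exact variance, all divided by
  \<open>\<sigma>\<^sup>2 h q p\<close>. The numerator is divisible by \<open>y\<close> whatever \<open>j\<close> is. The factor \<open>x\<close> appears because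
  \<open>j + \<kappa> x j = 1\<close>: in the cofactor of \<open>y\<close>, the part \<open>4 + x\<close> is multiplied by this sum and the part \<open>- y\<close> by its
  square, after which all terms free of \<open>x\<close> cancel.\<close>

lemma variance_defect_eq:
  fixes x y \<kappa> :: real
  assumes x: "x > 0" and \<kappa>: "\<kappa> > 0" and y: "y < 1" and xy: "x + y > 0"
  defines "j \<equiv> 1 / (1 + \<kappa> * x)"
  shows "(1 - y * j / 2)\<^sup>2 / ((x + y) * (2 + x - y)) + 1 / (2 * (2 + x)) - 1 / (2 * (x + y)) =
    y * x * ((4 * \<kappa> - 1 + \<kappa> * x) * j - y * (2 * \<kappa> - 1/2 + \<kappa>\<^sup>2 * x) * j\<^sup>2) / (2 * (x + y) * (2 + x - y) * (2 + x))"
proof -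
  have nz: "x + y \<noteq> 0" "2 + x - y \<noteq> 0" "2 + x \<noteq> 0" using assms by auto
  have "1 + \<kappa> * x > 0" using x \<kappa> by (simp add: add_pos_pos)
  then have j: "j + \<kappa> * x * j = 1" unfolding j_def by (simp add: field_simps)
  have "2 * (2 + x) * (1 - y * j / 2)\<^sup>2 + (x + y) * (2 + x - y) - (2 + x) * (2 + x - y)
      = y * (4 + x - y - 2 * (2 + x) * j + (2 + x) * y * j\<^sup>2 / 2)"
    by (simp add: field_simps power2_eq_square)
  also have "4 + x - y - 2 * (2 + x) * j + (2 + x) * y * j\<^sup>2 / 2
      = x * ((4 * \<kappa> - 1 + \<kappa> * x) * j - y * (2 * \<kappa> - 1/2 + \<kappa>\<^sup>2 * x) * j\<^sup>2)"
  proof -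
    have "(4 + x) * (j + \<kappa> * x * j) - y * (j + \<kappa> * x * j)\<^sup>2 - 2 * (2 + x) * j + (2 + x) * y * j\<^sup>2 / 2
      = x * ((4 * \<kappa> - 1 + \<kappa> * x) * j - y * (2 * \<kappa> - 1/2 + \<kappa>\<^sup>2 * x) * j\<^sup>2)"
      by (simp add: field_simps power2_eq_square)
    then show ?thesis unfolding j by (simp add: algebra_simps)
  qed
  finally have N: "2 * (2 + x) * (1 - y * j / 2)\<^sup>2 + (x + y) * (2 + x - y) - (2 + x) * (2 + x - y)
    = y * x * ((4 * \<kappa> - 1 + \<kappa> * x) * j - y * (2 * \<kappa> - 1/2 + \<kappa>\<^sup>2 * x) * j\<^sup>2)" by (simp add: mult.assoc)
  have "a / (s * t) + 1 / (2 * r) - 1 / (2 * s) = (2 * r * a + s * t - r * t) / (2 * s * t * r)"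
    if "s \<noteq> 0" "t \<noteq> 0" "r \<noteq> 0" for a s t r :: real
    using that by (simp add: field_simps)
  from this[OF nz, of "(1 - y * j / 2)\<^sup>2"] show ?thesis unfolding N .
qed

lemma variance_defect_le:
  fixes x y \<kappa> c :: real
  assumes x: "x > 0" and \<kappa>: "1/4 \<le> \<kappa>" "\<kappa> \<le> 1" and y: "\<bar>y\<bar> < 1" and xy: "x + y > 0" and c: "x / (x + y) \<le> c"
  defines "j \<equiv> 1 / (1 + \<kappa> * x)"
  shows "\<bar>(1 - y * j / 2)\<^sup>2 / ((x + y) * (2 + x - y)) + 1 / (2 * (2 + x)) - 1 / (2 * (x + y))\<bar> \<le> 4 * c * \<bar>y\<bar> / (1 + x)\<^sup>2"
proof -
  have kx: "\<kappa> * x > 0" "1 + \<kappa> * x > 0" using x \<kappa> by (auto simp: add_pos_pos)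
  have j: "0 < j" "j \<le> 1" "\<kappa> * x * j \<le> 1" unfolding j_def using kx by (auto simp: field_simps)
  have j2: "0 \<le> j\<^sup>2" "j\<^sup>2 \<le> 1" "\<kappa>\<^sup>2 * x * j\<^sup>2 \<le> 1"
  proof -
    show "j\<^sup>2 \<le> 1" using j by (simp add: power_le_one)
    have "\<kappa>\<^sup>2 * x * j\<^sup>2 = \<kappa> * (\<kappa> * x * j) * j" by (simp add: power2_eq_square)
    also have "\<dots> \<le> 1 * 1 * 1" using j \<kappa> kx by (intro mult_mono) auto
    finally show "\<kappa>\<^sup>2 * x * j\<^sup>2 \<le> 1" by simp
  qed simp
  let ?a = "(4 * \<kappa> - 1 + \<kappa> * x) * j" and ?b = "(2 * \<kappa> - 1/2 + \<kappa>\<^sup>2 * x) * j\<^sup>2"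
  have a: "0 \<le> ?a" "?a \<le> 4"
  proof -
    have "(4 * \<kappa> - 1) * j \<le> 3 * 1" using \<kappa> j by (intro mult_mono) auto
    then show "?a \<le> 4" using j(3) by (simp add: distrib_right)
    show "0 \<le> ?a" using \<kappa> kx j by (intro mult_nonneg_nonneg) auto
  qed
  have b: "0 \<le> ?b" "?b \<le> 3"
  proof -
    have "(2 * \<kappa> - 1/2) * j\<^sup>2 \<le> 2 * 1" using \<kappa> j2 by (intro mult_mono) auto
    then show "?b \<le> 3" using j2(3) by (simp add: distrib_right)
    show "0 \<le> ?b" using \<kappa> x by (intro mult_nonneg_nonneg add_nonneg_nonneg) auto
  qed
  have "\<bar>y * ?b\<bar> \<le> 1 * 3" unfolding abs_mult[of y] using y b by (intro mult_mono) auto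
  then have M: "\<bar>?a - y * ?b\<bar> \<le> 7" using a by linarith
  have "\<bar>(1 - y * j / 2)\<^sup>2 / ((x + y) * (2 + x - y)) + 1 / (2 * (2 + x)) - 1 / (2 * (x + y))\<bar> =
      \<bar>y\<bar> / 2 * \<bar>?a - y * ?b\<bar> * (x / (x + y)) * (1 / (2 + x - y)) * (1 / (2 + x))"
    unfolding j_def using x y xy \<kappa>
    by (subst variance_defect_eq) (auto simp: abs_mult abs_divide mult.assoc)
  also have "\<dots> \<le> \<bar>y\<bar> / 2 * 7 * c * (1 / (1 + x)) * (1 / (1 + x))"
    using x y xy c M by (intro mult_mono frac_le mult_nonneg_nonneg) (auto intro: order_trans[of 0 "x / (x + y)"])
  also have "\<dots> \<le> \<bar>y\<bar> / 2 * 8 * c * (1 / (1 + x)) * (1 / (1 + x))"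
    using x xy c by (intro mult_right_mono mult_left_mono) (auto intro: order_trans[of 0 "x / (x + y)"])
  also have "\<dots> = 4 * c * \<bar>y\<bar> / (1 + x)\<^sup>2" by (simp add: power2_eq_square)
  finally show ?thesis .
qed

context spde_setting
begin

text \<open>The constant \<open>lam 0 / (lam 0 - L)\<close> bounds \<open>x / (x + y)\<close>, and one factor \<open>h L\<close> comes from \<open>y\<close>. In
  particular the bound is zero for \<open>L = 0\<close>.\<close>

lemma variance_difference:
  fixes \<sigma> h L s :: real and b :: "nat \<Rightarrow> real"
  assumes b: "\<And>p. \<bar>b p\<bar> \<le> L" "L < lam 0" and h: "h > 0" "h * L < 1" and s: "0 < s" "s < 1"
  defines "R \<equiv> \<lambda>p. (1 - h * b p) / (1 + h * lam p)"
    and "G \<equiv> \<lambda>p. \<sigma> * sqrt h * (((sqrt 2 - 1) / 2 - h * b p / 2) / (1 + h * lam p) + (3 - sqrt 2) / 2)"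
    and "j \<equiv> \<lambda>p. 1 / (1 + (3 - sqrt 2) / 2 * h * lam p)"
  shows "\<bar>\<sigma>\<^sup>2 * q p / (2 * (lam p + b p)) -
      (q p * (G p * j p)\<^sup>2 / (1 - (R p)\<^sup>2) + (1 / 2 * \<sigma> * sqrt h)\<^sup>2 * (q p / (1 + h / 2 * lam p)))\<bar>
    \<le> 4 * (lam 0 / (lam 0 - L)) * L * \<sigma>\<^sup>2 * h powr (1 + s) * (lam p powr (- 1 + s) * q p)"
    (is "\<bar>?v - ?w\<bar> \<le> _")
proof -
  define x where "x = h * lam p"
  define y where "y = h * b p"
  define \<kappa> :: real where "\<kappa> = (3 - sqrt 2) / 2"
  have s2: "1 \<le> sqrt 2" "sqrt 2 \<le> 3/2" by (simp, rule real_le_lsqrt, simp_all add: power2_eq_square)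
  then have \<kappa>: "1/4 \<le> \<kappa>" "\<kappa> \<le> 1" unfolding \<kappa>_def by auto
  have x: "x > 0" unfolding x_def using h lam_gt0[of p] by simp
  have L0: "0 \<le> L" using b(1)[of p] by linarith
  have yL: "\<bar>y\<bar> \<le> h * L" unfolding y_def using b(1)[of p] h(1) by (simp add: abs_mult)
  have y: "\<bar>y\<bar> < 1" using yL h(2) by linarith
  have lb: "0 < lam p - L" "lam p - L \<le> lam p + b p" using b(1)[of p] b(2) lam_ge[of p] by auto
  have xyh: "x + y = h * (lam p + b p)" by (simp add: x_def y_def distrib_left)
  have xy: "x + y > 0" unfolding xyh using h(1) lb by (intro mult_pos_pos) auto
  define c where "c = lam 0 / (lam 0 - L)"
  have c: "x / (x + y) \<le> c"
  proof -
    have "x / (x + y) = lam p / (lam p + b p)" unfolding xyh unfolding x_def using h(1) by simp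
    also have "\<dots> \<le> lam p / (lam p - L)" using lb lam_gt0[of p] by (intro divide_left_mono) auto
    also have "\<dots> \<le> c"
    proof -
      have "lam p * (lam 0 - L) \<le> lam 0 * (lam p - L)"
        using mult_right_mono[OF lam_ge[of p] L0] by (simp add: algebra_simps)
      then show ?thesis unfolding c_def using lb b(2) by (simp add: divide_simps mult.commute)
    qed
    finally show ?thesis .
  qed
  let ?j = "1 / (1 + \<kappa> * x)"
  let ?E = "(1 - y * ?j / 2)\<^sup>2 / ((x + y) * (2 + x - y)) + 1 / (2 * (2 + x))"
  have w: "?w = \<sigma>\<^sup>2 * h * q p * ?E"
  proof -
    have kx: "1 + \<kappa> * x > 0" using x \<kappa> by (simp add: add_pos_pos)
    have "j p = ?j" unfolding j_def x_def \<kappa>_def by simp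
    moreover have "((sqrt 2 - 1) / 2 - y / 2) / (1 + x) + (3 - sqrt 2) / 2 = (1 + \<kappa> * x - y / 2) / (1 + x)"
      unfolding \<kappa>_def using x by (simp add: divide_simps) (simp add: algebra_simps)
    ultimately have "G p * j p = \<sigma> * sqrt h * ((1 + \<kappa> * x - y / 2) / (1 + x)) * ?j"
      unfolding G_def by (simp add: x_def y_def)
    also have "\<dots> = \<sigma> * sqrt h * ((1 - y * ?j / 2) / (1 + x))"
      using kx x by (simp add: divide_simps) (simp add: algebra_simps)
    finally have Gj: "(G p * j p)\<^sup>2 = \<sigma>\<^sup>2 * h * ((1 - y * ?j / 2)\<^sup>2 / (1 + x)\<^sup>2)"
      using h(1) by (simp add: power_mult_distrib power_divide)
    have R: "1 - (R p)\<^sup>2 = (x + y) * (2 + x - y) / (1 + x)\<^sup>2"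
      unfolding R_def x_def[symmetric] y_def[symmetric] using x
      by (simp add: power_divide divide_simps) (simp add: power2_eq_square algebra_simps)
    have "(1 + x)\<^sup>2 \<noteq> 0" using x by simp
    then have 1: "q p * (G p * j p)\<^sup>2 / (1 - (R p)\<^sup>2) = \<sigma>\<^sup>2 * h * q p * ((1 - y * ?j / 2)\<^sup>2 / ((x + y) * (2 + x - y)))"
      unfolding Gj R by simp
    have "1 + h / 2 * lam p = (2 + x) / 2" by (simp add: x_def)
    then have 2: "(1 / 2 * \<sigma> * sqrt h)\<^sup>2 * (q p / (1 + h / 2 * lam p)) = \<sigma>\<^sup>2 * h * q p * (1 / (2 * (2 + x)))"
      using h(1) x by (simp add: power_mult_distrib power_divide field_simps)
    show ?thesis unfolding 1 2 by (simp only: distrib_left)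
  qed
  have v: "?v = \<sigma>\<^sup>2 * h * q p * (1 / (2 * (x + y)))"
    unfolding xyh using h(1) by simp
  have sq: "0 \<le> \<sigma>\<^sup>2 * h * q p" using h(1) q_nonneg[of p] by simp
  have c0: "0 \<le> c" unfolding c_def using lam_pos b(2) by simp
  have "\<bar>?v - ?w\<bar> = \<sigma>\<^sup>2 * h * q p * \<bar>?E - 1 / (2 * (x + y))\<bar>"
    unfolding v w right_diff_distrib[symmetric] abs_mult[of "\<sigma>\<^sup>2 * h * q p"] using sq by (simp add: abs_minus_commute)
  also have "\<dots> \<le> \<sigma>\<^sup>2 * h * q p * (4 * c * \<bar>y\<bar> / (1 + x)\<^sup>2)"
    by (rule mult_left_mono[OF variance_defect_le[OF x \<kappa> y xy c] sq])
  also have "\<dots> \<le> \<sigma>\<^sup>2 * h * q p * (4 * c * (h * L) * x powr (- 1 + s))"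
  proof (rule mult_left_mono[OF _ sq])
    have "1 / (1 + x)\<^sup>2 \<le> x powr (- 1 + s)"
    proof -
      have "x powr (1 - s) \<le> (1 + x) powr (1 - s)" using x s by (intro powr_mono2) auto
      also have "\<dots> \<le> (1 + x) powr 2" using x s by (intro powr_mono) auto
      finally have "x powr (1 - s) \<le> (1 + x)\<^sup>2" using x by simp
      moreover have "x powr (- 1 + s) = 1 / x powr (1 - s)" using x by (simp add: powr_minus_divide[symmetric])
      ultimately show ?thesis using x by (simp add: divide_left_mono)
    qed
    then have "4 * c * \<bar>y\<bar> * (1 / (1 + x)\<^sup>2) \<le> 4 * c * (h * L) * x powr (- 1 + s)"
      using yL c0 by (intro mult_mono) (auto intro: order_trans[OF abs_ge_zero])
    then show "4 * c * \<bar>y\<bar> / (1 + x)\<^sup>2 \<le> 4 * c * (h * L) * x powr (- 1 + s)" by simp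
  qed
  also have "\<dots> = 4 * c * L * \<sigma>\<^sup>2 * h powr (1 + s) * (lam p powr (- 1 + s) * q p)"
  proof -
    have "h * h * h powr (- 1 + s) = h powr (1 + s)"
      using h(1) powr_add[of h 2 "- 1 + s"] by (simp add: power2_eq_square[symmetric])
    then show ?thesis unfolding x_def using h(1) lam_gt0[of p]
      by (simp add: powr_mult mult_ac)
  qed
  finally show ?thesis unfolding c_def .
qed

section \<open>Weak error and exactness\<close>

lemma spde_variance_summable:
  fixes \<sigma> L :: real and b :: "nat \<Rightarrow> real"
  assumes b: "\<And>p. \<bar>b p\<bar> \<le> L" "L < lam 0"
  shows "0 \<le> \<sigma>\<^sup>2 * q p / (2 * (lam p + b p))" and "summable (\<lambda>p. \<sigma>\<^sup>2 * q p / (2 * (lam p + b p)))"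
proof -
  have lb: "0 < lam p - L" "lam p - L \<le> lam p + b p" for p using b(1)[of p] b(2) lam_ge[of p] by auto
  have L0: "0 \<le> L" using b(1)[of 0] by linarith
  show nn: "0 \<le> \<sigma>\<^sup>2 * q p / (2 * (lam p + b p))" for p
    using lb[of p] q_nonneg[of p] by (intro divide_nonneg_pos mult_nonneg_nonneg) auto
  define c where "c = lam 0 / (lam 0 - L)"
  show "summable (\<lambda>p. \<sigma>\<^sup>2 * q p / (2 * (lam p + b p)))"
  proof (rule summable_comparison_test'[OF summable_mult[OF q_div_lam_summable, of "\<sigma>\<^sup>2 * c"], of 0])
    fix p
    have "lam p * (lam 0 - L) \<le> lam 0 * (lam p - L)"
      using mult_right_mono[OF lam_ge[of p] L0] by (simp add: algebra_simps)
    then have "1 / (lam p - L) \<le> c / lam p"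
      unfolding c_def using lb[of p] b(2) lam_gt0[of p] by (simp add: divide_simps mult.commute)
    moreover have "1 / (2 * (lam p + b p)) \<le> 1 / (lam p - L)" using lb[of p] by (intro divide_left_mono) auto
    ultimately have "\<sigma>\<^sup>2 * q p * (1 / (2 * (lam p + b p))) \<le> \<sigma>\<^sup>2 * q p * (c / lam p)"
      using q_nonneg[of p] by (intro mult_left_mono) auto
    then show "norm (\<sigma>\<^sup>2 * q p / (2 * (lam p + b p))) \<le> \<sigma>\<^sup>2 * c * (q p / lam p)"
      unfolding real_norm_def abs_of_nonneg[OF nn] by (simp add: mult_ac)
  qed
qed

theorem weak_error_bound:
  fixes \<sigma> h L s :: real and b :: "nat \<Rightarrow> real" and M :: "'w measure"
  assumes W: "indep_wiener_family M \<beta>"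
    and B: "bounded_linear B" "\<And>p. B (e p) = - (b p *\<^sub>R e p)" and b: "\<And>p. \<bar>b p\<bar> \<le> L" "L < lam 0"
    and \<mu>: "diag_gaussian \<mu> (\<lambda>p. \<sigma>\<^sup>2 * q p / (2 * (lam p + b p)))"
    and s: "0 < s" "s < 1" "summable (\<lambda>p. lam p powr (- 1 + s) * q p)"
    and h: "h > 0" "h * L < 1" and J3: "admissible_J3 D A Q h J3"
    and inv: "scheme_invariant M D A B e q \<beta> \<sigma> J3 h \<pi>"
    and C2: "C2_function \<phi> \<phi>' \<phi>''" and K: "\<And>v. norm (\<phi>'' v) \<le> K"
  shows "integrable \<mu> \<phi>" and "integrable (distr \<pi> borel snd) \<phi>"
    and "\<bar>(\<integral>v. \<phi> v \<partial>\<mu>) - (\<integral>v. \<phi> v \<partial>(distr \<pi> borel snd))\<bar> \<le>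
      K / 2 * (4 * (lam 0 / (lam 0 - L)) * L * \<sigma>\<^sup>2 * h powr (1 + s) * (\<Sum>p. lam p powr (- 1 + s) * q p))"
proof -
  let ?\<nu> = "distr \<pi> borel snd"
  define v where "v p = \<sigma>\<^sup>2 * q p / (2 * (lam p + b p))" for p
  define w where "w p = q p * (\<sigma> * sqrt h * (((sqrt 2 - 1) / 2 - h * b p / 2) / (1 + h * lam p) + (3 - sqrt 2) / 2)
      * (1 / (1 + (3 - sqrt 2) / 2 * h * lam p)))\<^sup>2 / (1 - ((1 - h * b p) / (1 + h * lam p))\<^sup>2)
    + (1 / 2 * \<sigma> * sqrt h)\<^sup>2 * (q p / (1 + h / 2 * lam p))" for p
  let ?k = "4 * (lam 0 / (lam 0 - L)) * L * \<sigma>\<^sup>2 * h powr (1 + s)"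
  have \<mu>v: "diag_gaussian \<mu> v" using \<mu> by (simp only: v_def[abs_def])
  have \<nu>w: "diag_gaussian ?\<nu> w"
    using scheme_invariant_gaussian[OF W B b h J3 inv] by (simp only: w_def[abs_def])
  have diff: "\<bar>v p - w p\<bar> \<le> ?k * (lam p powr (- 1 + s) * q p)" for p
    unfolding v_def w_def by (rule variance_difference[OF b h s(1,2)])
  note sk = summable_mult[OF s(3), of ?k]
  have sd: "summable (\<lambda>p. \<bar>v p - w p\<bar>)"
    by (rule summable_comparison_test'[OF sk, of 0]) (use diff in auto)
  have v: "0 \<le> v p" "summable v" for p
    using spde_variance_summable[OF b, of \<sigma>] by (simp_all add: v_def[abs_def])
  have w: "0 \<le> w p" for p
  proof -
    have "\<bar>h * b p\<bar> \<le> h * L" using b(1)[of p] h(1) by (simp add: abs_mult)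
    moreover have "h * L < h * lam p" using b(2) lam_ge[of p] h(1) by simp
    ultimately have "0 \<le> 1 - h * b p" "1 - h * b p \<le> 1 + h * lam p" "0 < 1 + h * lam p"
      using h(2) mult_pos_pos[OF h(1) lam_gt0[of p]] by linarith+
    then have "((1 - h * b p) / (1 + h * lam p))\<^sup>2 \<le> 1" by (intro power_le_one) auto
    then have "0 \<le> 1 - ((1 - h * b p) / (1 + h * lam p))\<^sup>2" by simp
    then show ?thesis unfolding w_def using q_nonneg[of p] h(1) lam_gt0[of p]
      by (intro add_nonneg_nonneg divide_nonneg_nonneg mult_nonneg_nonneg) auto
  qed
  have "summable (\<lambda>p. v p - (v p - w p))"
    by (rule summable_diff[OF v(2) summable_rabs_cancel[OF sd]])
  then have sw: "summable w" by simp
  note G = wiener_increments_gaussian[OF W h(1)]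
  have ps: "prob_space \<mu>" "sets \<mu> = sets borel" "prob_space ?\<nu>" "sets ?\<nu> = sets borel"
    using \<mu>v \<nu>w by (auto simp: diag_gaussian_def)
  show "integrable \<mu> \<phi>"
    by (rule C2_integrable[OF ps(1,2) diag_gaussian_second_moment(1)[OF G \<mu>v v] C2 K])
  show "integrable ?\<nu> \<phi>"
    by (rule C2_integrable[OF ps(3,4) diag_gaussian_second_moment(1)[OF G \<nu>w w sw] C2 K])
  have K0: "0 \<le> K" using K[of 0] norm_ge_zero order_trans by blast
  have "\<bar>(\<integral>v. \<phi> v \<partial>\<mu>) - (\<integral>v. \<phi> v \<partial>?\<nu>)\<bar> \<le> K / 2 * (\<Sum>p. \<bar>v p - w p\<bar>)"
    by (rule gaussian_comparison[OF G \<mu>v \<nu>w v w sw C2 K])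
  also have "\<dots> \<le> K / 2 * (\<Sum>p. ?k * (lam p powr (- 1 + s) * q p))"
    using K0 by (intro mult_left_mono suminf_le diff sd sk) auto
  also have "\<dots> = K / 2 * (?k * (\<Sum>p. lam p powr (- 1 + s) * q p))"
    by (simp only: suminf_mult[OF s(3)])
  finally show "\<bar>(\<integral>v. \<phi> v \<partial>\<mu>) - (\<integral>v. \<phi> v \<partial>?\<nu>)\<bar> \<le> K / 2 * (?k * (\<Sum>p. lam p powr (- 1 + s) * q p))" .
qed

theorem exact_if_unperturbed:
  fixes \<sigma> h :: real and M :: "'w measure"
  assumes W: "indep_wiener_family M \<beta>"
    and B: "bounded_linear B" "\<And>p. B (e p) = - (b p *\<^sub>R e p)" and b: "\<And>p. b p = 0"
    and \<mu>: "diag_gaussian \<mu> (\<lambda>p. \<sigma>\<^sup>2 * q p / (2 * (lam p + b p)))"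
    and h: "h > 0" and J3: "admissible_J3 D A Q h J3"
    and inv: "scheme_invariant M D A B e q \<beta> \<sigma> J3 h \<pi>"
  shows "distr \<pi> borel snd = \<mu>"
proof -
  (* with L = 0 the bound on the variance difference is zero for any admissible exponent *)
  have b0: "\<bar>b p\<bar> \<le> 0" for p using b by simp
  have h0: "h * 0 < 1" by simp
  have s: "(0::real) < 1 / 2" "1 / 2 < (1::real)" by auto
  define v where "v p = \<sigma>\<^sup>2 * q p / (2 * (lam p + b p))" for p
  define w where "w p = q p * (\<sigma> * sqrt h * (((sqrt 2 - 1) / 2 - h * b p / 2) / (1 + h * lam p) + (3 - sqrt 2) / 2)
      * (1 / (1 + (3 - sqrt 2) / 2 * h * lam p)))\<^sup>2 / (1 - ((1 - h * b p) / (1 + h * lam p))\<^sup>2)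
    + (1 / 2 * \<sigma> * sqrt h)\<^sup>2 * (q p / (1 + h / 2 * lam p))" for p
  have "\<bar>v p - w p\<bar> \<le> 4 * (lam 0 / (lam 0 - 0)) * 0 * \<sigma>\<^sup>2 * h powr (1 + 1 / 2) * (lam p powr (- 1 + 1 / 2) * q p)" for p
    unfolding v_def w_def by (rule variance_difference[OF b0 lam_pos h h0 s])
  then have "w = v" by (auto simp: fun_eq_iff)
  moreover have "diag_gaussian (distr \<pi> borel snd) w"
    using scheme_invariant_gaussian[OF W B b0 lam_pos h h0 J3 inv] by (simp only: w_def[abs_def])
  moreover have "diag_gaussian \<mu> v" using \<mu> by (simp only: v_def[abs_def])
  ultimately show ?thesis using diag_gaussian_unique by metis
qed

end

theorem theorem3p7:
  fixes D :: "'h::{real_inner, polish_space} set"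
    and A B Q :: "'h \<Rightarrow> 'h"
    and lam q b :: "nat \<Rightarrow> real"
    and e :: "nat \<Rightarrow> 'h"
    and \<sigma> L :: real
    and M :: "'w measure"
    and \<beta> :: "nat \<Rightarrow> real \<Rightarrow> 'w \<Rightarrow> real"
    and u :: "'h \<Rightarrow> real \<Rightarrow> 'w \<Rightarrow> 'h"
    and \<mu> :: "'h measure"
  assumes setting: "spde_setting D A lam e Q q"
    and wiener: "indep_wiener_family M \<beta>"
    and sigma: "0 < \<sigma>"
    and B_bounded: "bounded_linear B"
    and B_eigen: "\<And>p. B (e p) = - (b p *\<^sub>R e p)"
    and b_range: "\<And>p. - lam 0 < b p \<and> b p < lam 0"
    and L_def: "L = (SUP p. \<bar>b p\<bar>)"
    and L_less: "L < lam 0"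
    and solution: "\<And>x. weak_solution M D A B \<sigma> (wiener_pairing q e \<beta>) x (u x)"
    and invariant: "spde_invariant M u \<mu>"
  shows "(\<forall>s. ereal s < s_bar lam e Q \<longrightarrow>
           (\<exists>C>0. \<forall>\<phi> \<phi>' \<phi>'' h J3 \<pi>.
              C2_function \<phi> \<phi>' \<phi>'' \<longrightarrow> bdd_above (range (\<lambda>v. norm (\<phi>'' v))) \<longrightarrow>
              0 < h \<longrightarrow> (L = 0 \<or> h < 1 / L) \<longrightarrow>
              admissible_J3 D A Q h J3 \<longrightarrow>
              scheme_invariant M D A B e q \<beta> \<sigma> J3 h \<pi> \<longrightarrow>
              integrable \<mu> \<phi> \<and> integrable (distr \<pi> borel snd) \<phi> \<and>
              \<bar>(\<integral>v. \<phi> v \<partial>\<mu>) - (\<integral>v. \<phi> v \<partial>(distr \<pi> borel snd))\<bar>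
                \<le> C * (SUP v. norm (\<phi>'' v)) * \<sigma>\<^sup>2 * h powr (1 + s))) \<and>
         ((\<forall>p. b p = 0) \<longrightarrow>
           (\<forall>h J3 \<pi>. 0 < h \<longrightarrow> admissible_J3 D A Q h J3 \<longrightarrow>
              scheme_invariant M D A B e q \<beta> \<sigma> J3 h \<pi> \<longrightarrow>
              distr \<pi> borel snd = \<mu>))"
proof -
  interpret spde_setting D A lam e Q q by (rule setting)
  have "bdd_above (range (\<lambda>p. \<bar>b p\<bar>))"
    using b_range by (intro bdd_aboveI[of _ "lam 0"]) (auto simp: abs_less_iff intro!: less_imp_le, smt (verit) b_range)
  then have bL: "\<bar>b p\<bar> \<le> L" for p unfolding L_def by (rule cSUP_upper[OF UNIV_I])
  have L0: "0 \<le> L" using bL[of 0] by linarith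
  have \<mu>: "diag_gaussian \<mu> (\<lambda>p. \<sigma>\<^sup>2 * q p / (2 * (lam p + b p)))"
    by (rule spde_invariant_gaussian[OF wiener B_bounded B_eigen bL L_less solution invariant])
  show ?thesis
  proof (intro conjI allI impI)
    fix s assume "ereal s < s_bar lam e Q"
    then obtain s' where s': "s < s'" "0 < s'" "s' < 1" and sm: "summable (\<lambda>p. lam p powr (- 1 + s') * q p)"
      using trace_summable by blast
    define T where "T = (\<Sum>p. lam p powr (- 1 + s') * q p)"
    (* h powr (s' - s) is at most (1 / L) powr (s' - s) because h < 1 / L; the summand 1 keeps C
       positive when L = 0 *)
    define C where "C = 2 * (lam 0 / (lam 0 - L)) * L * T * (1 / L) powr (s' - s) + 1"
    have T0: "0 \<le> T" unfolding T_def using q_nonneg by (intro suminf_nonneg sm) auto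
    have c0: "0 \<le> lam 0 / (lam 0 - L)" using lam_pos L_less by simp
    have C0: "0 \<le> 2 * (lam 0 / (lam 0 - L)) * L * T * (1 / L) powr (s' - s)"
      using T0 c0 L0 by (intro mult_nonneg_nonneg) auto
    show "\<exists>C>0. \<forall>\<phi> \<phi>' \<phi>'' h J3 \<pi>.
              C2_function \<phi> \<phi>' \<phi>'' \<longrightarrow> bdd_above (range (\<lambda>v. norm (\<phi>'' v))) \<longrightarrow>
              0 < h \<longrightarrow> (L = 0 \<or> h < 1 / L) \<longrightarrow>
              admissible_J3 D A Q h J3 \<longrightarrow>
              scheme_invariant M D A B e q \<beta> \<sigma> J3 h \<pi> \<longrightarrow>
              integrable \<mu> \<phi> \<and> integrable (distr \<pi> borel snd) \<phi> \<and>
              \<bar>(\<integral>v. \<phi> v \<partial>\<mu>) - (\<integral>v. \<phi> v \<partial>(distr \<pi> borel snd))\<bar>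
                \<le> C * (SUP v. norm (\<phi>'' v)) * \<sigma>\<^sup>2 * h powr (1 + s)"
    proof (intro exI[of _ C] conjI allI impI)
      show "0 < C" unfolding C_def using C0 by linarith
      fix \<phi> :: "'h \<Rightarrow> real" and \<phi>' \<phi>'' h J3 \<pi>
      assume C2: "C2_function \<phi> \<phi>' \<phi>''" and bdd: "bdd_above (range (\<lambda>v. norm (\<phi>'' v)))"
        and h: "0 < h" "L = 0 \<or> h < 1 / L" and J3: "admissible_J3 D A Q h J3"
        and inv: "scheme_invariant M D A B e q \<beta> \<sigma> J3 h \<pi>"
      define K where "K = (SUP v. norm (\<phi>'' v))"
      have K: "norm (\<phi>'' v) \<le> K" for v unfolding K_def by (rule cSUP_upper[OF UNIV_I bdd])
      have K0: "0 \<le> K" using K[of 0] norm_ge_zero order_trans by blast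
      have hL: "h * L < 1" using h L0 by (cases "L = 0") (auto simp: field_simps)
      note E = weak_error_bound[OF wiener B_bounded B_eigen bL L_less \<mu> s'(2,3) sm h(1) hL J3 inv C2 K]
      show "integrable \<mu> \<phi>" "integrable (distr \<pi> borel snd) \<phi>" by (rule E)+
      have pow: "L * h powr (1 + s') \<le> L * ((1 / L) powr (s' - s) * h powr (1 + s))"
      proof (cases "L = 0")
        case False
        then have "h powr (s' - s) \<le> (1 / L) powr (s' - s)" using h s'(1) by (intro powr_mono2) auto
        then have "h powr (s' - s) * h powr (1 + s) \<le> (1 / L) powr (s' - s) * h powr (1 + s)"
          by (intro mult_right_mono) auto
        moreover have "h powr (s' - s) * h powr (1 + s) = h powr (1 + s')" by (simp add: powr_add[symmetric] add.commute)
        ultimately show ?thesis using L0 by (intro mult_left_mono) auto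
      qed simp
      have "\<bar>(\<integral>v. \<phi> v \<partial>\<mu>) - (\<integral>v. \<phi> v \<partial>(distr \<pi> borel snd))\<bar> \<le>
          (2 * (lam 0 / (lam 0 - L)) * T * K * \<sigma>\<^sup>2) * (L * h powr (1 + s'))"
        using E(3) unfolding T_def[symmetric] by (simp add: mult_ac)
      also have "\<dots> \<le> (2 * (lam 0 / (lam 0 - L)) * T * K * \<sigma>\<^sup>2) * (L * ((1 / L) powr (s' - s) * h powr (1 + s)))"
        using T0 K0 c0 by (intro mult_left_mono[OF pow] mult_nonneg_nonneg) auto
      also have "\<dots> = (C - 1) * (K * \<sigma>\<^sup>2 * h powr (1 + s))" unfolding C_def by (simp add: mult_ac)
      also have "\<dots> \<le> C * (K * \<sigma>\<^sup>2 * h powr (1 + s))" using K0 by (intro mult_right_mono) auto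
      finally show "\<bar>(\<integral>v. \<phi> v \<partial>\<mu>) - (\<integral>v. \<phi> v \<partial>(distr \<pi> borel snd))\<bar>
          \<le> C * (SUP v. norm (\<phi>'' v)) * \<sigma>\<^sup>2 * h powr (1 + s)"
        unfolding K_def[symmetric] by (simp add: mult.assoc)
    qed
  next
    fix h J3 \<pi>
    assume b0: "\<forall>p. b p = 0" and h: "0 < h" and J3: "admissible_J3 D A Q h J3"
      and inv: "scheme_invariant M D A B e q \<beta> \<sigma> J3 h \<pi>"
    show "distr \<pi> borel snd = \<mu>"
      by (rule exact_if_unperturbed[OF wiener B_bounded B_eigen b0[rule_format] \<mu> h J3 inv])
  qed
qed

end
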